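(* Let $P\subset\mathbb R^2$ be an arbitrary polygon, let $dz$ be Lebesgue measure on $P$, and for $z\in P$, $l>0$ let $gc_z(l)$ be the position counting function for the billiard flow in $P$. Then $$2\int_P gc_z(l)\,dz=\pi\,\kappa(P)\,l^2 .$$
   Context: A polygon $P$ is a compact connected region bounded by finitely many straight sides; it need not be simply connected (it may contain polygonal obstacles). $p$ is the number of corners of $P$ (including those of the obstacles), $q$ the number of obstacles (so the boundary has $q+1$ components), and $\kappa(P)=p+2q-2$. The billiard flow moves a point with unit speed along straight lines in $P$, reflecting at the sides by the law of geometric optics; an orbit stops when it reaches a corner. $gc_z(l)$ is the number of singular billiard orbits of length at most $l$ starting from $z$, i.e. the number of initial directions at $z$ whose billiard orbit reaches a corner of $P$ by time $l$. *)

theory Defs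
  imports "HOL-Analysis.Analysis"
begin

type_synonym point = "real ^ 2"

text \<open>A closed polygonal curve is given by the cyclic list of its vertices.\<close>

definition curve_sides :: "point list \<Rightarrow> (point \<times> point) set" where
  "curve_sides vs = {(vs ! i, vs ! (Suc i mod length vs)) | i. i < length vs}"

definition curve :: "point list \<Rightarrow> point set" where
  "curve vs = (\<Union>(a, b) \<in> curve_sides vs. closed_segment a b)"

text \<open>Two different sides meet only in a common end point, so the curve is a Jordan curve.
  An angle equal to \<open>\<pi>\<close> at a vertex is not excluded.\<close>

definition simple_polygon :: "point list \<Rightarrow> bool" where
  "simple_polygon vs \<longleftrightarrow> 3 \<le> length vs \<and> distinct vs \<and>
     (\<forall>(a, b) \<in> curve_sides vs. \<forall>(c, d) \<in> curve_sides vs.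
        (a, b) \<noteq> (c, d) \<longrightarrow> closed_segment a b \<inter> closed_segment c d = {a, b} \<inter> {c, d})"

definition filled :: "point list \<Rightarrow> point set" where
  "filled vs = curve vs \<union> inside (curve vs)"

record polygon =
  outline :: "point list"
  obstacles :: "point list set"

definition polygon_region :: "polygon \<Rightarrow> point set" where
  "polygon_region P = filled (outline P) - (\<Union>vs \<in> obstacles P. inside (curve vs))"

text \<open>The obstacles are finitely many disjoint closed polygonal discs in the interior of the
  outer polygon. Hence the region is compact and connected, and its boundary components are
  precisely the outline and the curves bounding the obstacles.\<close>

definition is_polygon :: "polygon \<Rightarrow> bool" where
  "is_polygon P \<longleftrightarrow>
     simple_polygon (outline P) \<and>
     finite (obstacles P) \<and>
     (\<forall>vs \<in> obstacles P. simple_polygon vs \<and> filled vs \<subseteq> inside (curve (outline P))) \<and>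
     pairwise (\<lambda>vs ws. disjnt (filled vs) (filled ws)) (obstacles P)"

definition sides :: "polygon \<Rightarrow> (point \<times> point) set" where
  "sides P = curve_sides (outline P) \<union> (\<Union>vs \<in> obstacles P. curve_sides vs)"

definition corners :: "polygon \<Rightarrow> point set" where
  "corners P = set (outline P) \<union> (\<Union>vs \<in> obstacles P. set vs)"

definition kappa :: "polygon \<Rightarrow> int" where
  "kappa P = int (card (corners P)) + 2 * int (card (obstacles P)) - 2"

text \<open>Reflection of a velocity in the line through \<open>a\<close> and \<open>b\<close>: the tangential component is
  kept, the normal component changes sign.\<close>

definition reflect :: "point \<Rightarrow> point \<Rightarrow> point \<Rightarrow> point" where
  "reflect a b v = (2 * (v \<bullet> (b - a)) / ((b - a) \<bullet> (b - a))) *\<^sub>R (b - a) - v"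

text \<open>\<open>billiard_flow P t (x, v) (y, w)\<close>: the orbit leaving \<open>x\<close> with velocity \<open>v\<close> is at \<open>y\<close> at
  time \<open>t > 0\<close>, having arrived there with velocity \<open>w\<close> (so at a point of a side, \<open>w\<close> is the
  velocity before the reflection). Reflection takes place only at relative interior points of
  sides, and the pieces between reflections stay in the interior of the region, so
  an orbit that arrives at a corner has no continuation.\<close>

inductive billiard_flow :: "polygon \<Rightarrow> real \<Rightarrow> point \<times> point \<Rightarrow> point \<times> point \<Rightarrow> bool"
  for P :: polygon
where
  free: "\<lbrakk>0 < t; open_segment x (x + t *\<^sub>R v) \<subseteq> interior (polygon_region P)\<rbrakk>
    \<Longrightarrow> billiard_flow P t (x, v) (x + t *\<^sub>R v, v)"
| reflection: "\<lbrakk>billiard_flow P t (x, v) (y, w);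
     (a, b) \<in> sides P; y \<in> open_segment a b;
     0 < s; open_segment y (y + s *\<^sub>R reflect a b w) \<subseteq> interior (polygon_region P)\<rbrakk>
    \<Longrightarrow> billiard_flow P (t + s) (x, v) (y + s *\<^sub>R reflect a b w, reflect a b w)"

definition singular_directions :: "polygon \<Rightarrow> point \<Rightarrow> real \<Rightarrow> point set" where
  "singular_directions P z l =
     {u. norm u = 1 \<and> (\<exists>t c w. t \<le> l \<and> c \<in> corners P \<and> billiard_flow P t (z, u) (c, w))}"

definition gc :: "polygon \<Rightarrow> point \<Rightarrow> real \<Rightarrow> nat" where
  "gc P z l = card (singular_directions P z l)"

end

theory Submission
  imports Defs "HOL-Complex_Analysis.Winding_Numbers"
begin

text \<open>
  Reversing an orbit that starts at \<open>z\<close> and runs into a corner \<open>c\<close> gives an orbit from \<open>c\<close> to \<open>z\<close>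
  of the same length. Fix the itinerary of sides. Unfolding the reflections straightens the orbits
  from \<open>c\<close>, so the map from (direction, time) at \<open>c\<close> to the end point is the polar map followed by
  a planar isometry. Hence the integral of the counting function is the sum over the corners of the
  areas of circular sectors of radius \<open>l\<close> that consist of the directions at \<open>c\<close> pointing into the
  polygon, up to the null set of directions whose orbit meets a corner. Orbits cannot bounce
  infinitely often in finite time: the reflections near an accumulation point \<open>X\<close> fix \<open>X\<close>, so
  the unfolded orbit is a straight segment ending at \<open>X\<close>, and the region is conical near \<open>X\<close>.

  The interior angles of a simple \<open>n\<close>-gon add up to \<open>(n - 2) * \<pi>\<close>: for points close to a
  corner the winding number of the boundary is the sum of the angles subtended by the sides, which
  expresses the interior angle by the angle \<open>S\<close> that the rest of the curve sweeps as seen from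
  that corner. A discrete version of Hopf's argument (the
  directions of the chords from \<open>v\<^sub>i\<close> to \<open>v\<^sub>j\<close>, \<open>i < j\<close>) computes the sum of the turning angles from
  \<open>S\<close>. An obstacle contributes the complementary angles, with sum \<open>(n + 2) * \<pi>\<close>.
\<close>

section \<open>Reflections and unfolding\<close>

text \<open>The factor 2 on the left is the ratio of angle to area: a sector of angle a and radius l
  has area a * l^2 / 2. Angles are kept as areas of subsets of the unit disc throughout. This is
  also how the interior angle is read off from S. For an approach direction e, the limit of the
  winding sum is S plus two angles between e and the sides at the corner; it equals 2 * pi * sigma
  (sigma the orientation) if e points inside and 0 if it points outside. Averaged over the disc,
  each of the two angles vanishes, being odd under reflection in the line of its side. So the inward
  directions have area sigma * S / 2. The total turning is 2 * (S + t), with t the turn at the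
  corner from which S is seen. S + t is an odd multiple of pi, and 0 <= sigma * S <= 2 * pi and |t|
  < pi leave only sigma * (S + t) = pi. A separate obstacle is that \<open>gc\<close> is a
  cardinality and so 0 on infinite sets. Orbits are therefore first counted with values in
  [0, infinity], where Tonelli applies; since the total area is finite, infinite counts occur only
  on a null set.\<close>

lemma open_segment_ray:
  fixes x d :: "'a::real_vector"
  assumes "d \<noteq> 0" "s < t"
  shows "open_segment (x + s *\<^sub>R d) (x + t *\<^sub>R d) = (\<lambda>u. x + u *\<^sub>R d) ` {s<..<t}"
proof -
  have eq: "(1 - u) *\<^sub>R (x + s *\<^sub>R d) + u *\<^sub>R (x + t *\<^sub>R d) = x + (s + u * (t - s)) *\<^sub>R d" for u
    by (simp add: algebra_simps)
  have ne: "x + s *\<^sub>R d \<noteq> x + t *\<^sub>R d"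
    using assms by simp
  have "y \<in> open_segment (x + s *\<^sub>R d) (x + t *\<^sub>R d) \<longleftrightarrow> (\<exists>u. 0 < u \<and> u < 1 \<and> y = x + (s + u * (t - s)) *\<^sub>R d)" for y
    using ne unfolding in_segment eq by blast
  moreover have "(\<exists>u. 0 < u \<and> u < 1 \<and> y = x + (s + u * (t - s)) *\<^sub>R d) \<longleftrightarrow> y \<in> (\<lambda>u. x + u *\<^sub>R d) ` {s<..<t}" for y
  proof
    assume "\<exists>u. 0 < u \<and> u < 1 \<and> y = x + (s + u * (t - s)) *\<^sub>R d"
    then obtain u where u: "0 < u" "u < 1" "y = x + (s + u * (t - s)) *\<^sub>R d" by blast
    have "u * (t - s) < 1 * (t - s)" using u assms by (intro mult_strict_right_mono) auto
    moreover have "0 < u * (t - s)" using u assms by simp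
    ultimately have "s + u * (t - s) \<in> {s<..<t}" by simp
    then show "y \<in> (\<lambda>u. x + u *\<^sub>R d) ` {s<..<t}" using u by blast
  next
    assume "y \<in> (\<lambda>u. x + u *\<^sub>R d) ` {s<..<t}"
    then obtain w where w: "s < w" "w < t" "y = x + w *\<^sub>R d" by auto
    show "\<exists>u. 0 < u \<and> u < 1 \<and> y = x + (s + u * (t - s)) *\<^sub>R d"
      using w assms by (intro exI[of _ "(w - s) / (t - s)"]) (auto simp: field_simps)
  qed
  ultimately show ?thesis by blast
qed

lemma open_segmentE:
  fixes x p :: "'a::real_vector"
  assumes "q \<in> open_segment x p"
  obtains u where "0 < u" "u < 1" "q = x + u *\<^sub>R (p - x)" "x \<noteq> p"
  using assms unfolding in_segment by (auto simp: algebra_simps)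

lemma open_segmentI:
  fixes x p :: "'a::real_vector"
  assumes "0 < u" "u < 1" "x \<noteq> p"
  shows "x + u *\<^sub>R (p - x) \<in> open_segment x p"
  using assms unfolding in_segment by (auto simp: algebra_simps)

lemma open_segment_split:
  fixes x p :: "'a::real_vector"
  assumes "q \<in> open_segment x p"
  shows "open_segment x p = open_segment x q \<union> {q} \<union> open_segment q p"
proof -
  obtain u where u: "0 < u" "u < 1" "q = x + u *\<^sub>R (p - x)" "x \<noteq> p"
    using assms by (rule open_segmentE)
  have d: "p - x \<noteq> 0" using u by simp
  have 1: "open_segment x p = (\<lambda>u. x + u *\<^sub>R (p - x)) ` {0<..<1}"
    using open_segment_ray[OF d, of 0 1 x] by simp
  have 2: "open_segment x q = (\<lambda>u. x + u *\<^sub>R (p - x)) ` {0<..<u}"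
    using open_segment_ray[OF d, of 0 u x] u by simp
  have 3: "open_segment q p = (\<lambda>u. x + u *\<^sub>R (p - x)) ` {u<..<1}"
    using open_segment_ray[OF d, of u 1 x] u by simp
  have "{0<..<1} = {0<..<u} \<union> {u} \<union> {u<..<1}" using u by auto
  then show ?thesis unfolding 1 2 3 using u by auto
qed

lemma open_segment_between1:
  fixes x p :: "'a::real_vector"
  assumes "q \<in> open_segment x p" "m \<in> open_segment x q"
  shows "q \<in> open_segment m p"
proof -
  obtain u where u: "0 < u" "u < 1" "q = x + u *\<^sub>R (p - x)" "x \<noteq> p"
    using assms(1) by (rule open_segmentE)
  obtain v where v: "0 < v" "v < 1" "m = x + v *\<^sub>R (q - x)"
    using assms(2) by (rule open_segmentE)
  have m: "m = x + (v * u) *\<^sub>R (p - x)" using u v by simp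
  have "v * u < 1 * u" using u v by (intro mult_strict_right_mono) auto
  then have lt: "v * u < u" by simp
  then have "open_segment m p = (\<lambda>u. x + u *\<^sub>R (p - x)) ` {v * u<..<1}"
    using open_segment_ray[of "p - x" "v * u" 1 x] u m order.strict_trans[OF lt \<open>u < 1\<close>] by simp
  with lt show ?thesis using u by auto
qed

lemma open_segment_between2:
  fixes x p :: "'a::real_vector"
  assumes "m \<in> open_segment x p" "q \<in> open_segment m p"
  shows "m \<in> open_segment x q"
  using open_segment_between1[of m p x q] assms by (simp add: open_segment_commute)

lemma open_segment_trans1:
  fixes x p :: "'a::real_vector"
  assumes "q \<in> open_segment x p"
  shows "open_segment x q \<subseteq> open_segment x p" "open_segment q p \<subseteq> open_segment x p"
  using open_segment_split[OF assms] by auto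

lemma dist_open_segment:
  fixes x p :: "'a::real_normed_vector"
  assumes "m \<in> open_segment x p"
  shows "dist x p = dist x m + dist m p"
proof -
  obtain u where u: "0 < u" "u < 1" "m = x + u *\<^sub>R (p - x)"
    using assms by (rule open_segmentE)
  have "dist x m = u * dist x p" using u by (simp add: dist_norm norm_minus_commute)
  moreover have "m - p = (1 - u) *\<^sub>R (x - p)" using u by (simp add: algebra_simps)
  then have "dist m p = (1 - u) * dist x p" using u by (simp add: dist_norm)
  ultimately show ?thesis by (simp add: algebra_simps)
qed

section \<open>Reflections and their compositions as isometries\<close>

lemma reflect_linear: "linear (reflect a b)"
proof -
  define w where "w = b - a"
  show ?thesis
    unfolding reflect_def w_def[symmetric]
    by (rule linearI) (simp_all add: inner_add_left add_divide_distrib distrib_left scaleR_left_distrib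
        scaleR_right_diff_distrib)
qed

lemma norm_reflect [simp]: "norm (reflect a b v) = norm v"
proof (cases "a = b")
  case True then show ?thesis by (simp add: reflect_def)
next
  case False
  define w where "w = b - a"
  have "w \<bullet> w \<noteq> 0" using False by (simp add: w_def)
  then have "reflect a b v \<bullet> reflect a b v = v \<bullet> v"
    unfolding reflect_def w_def[symmetric]
    by (simp add: inner_diff_left inner_diff_right inner_commute[of w v] field_simps power2_eq_square)
  then show ?thesis by (simp add: norm_eq_sqrt_inner)
qed

lemma reflect_reflect [simp]: "reflect a b (reflect a b v) = v"
proof (cases "a = b")
  case True then show ?thesis by (simp add: reflect_def)
next
  case False
  define w where "w = b - a"
  have "w \<bullet> w \<noteq> 0" using False by (simp add: w_def)
  then have "(2 * (v \<bullet> w) / (w \<bullet> w)) *\<^sub>R w \<bullet> w = 2 * (v \<bullet> w)" by simp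
  then show ?thesis
    unfolding reflect_def w_def[symmetric] by (simp add: inner_diff_left)
qed

definition mirror :: "point \<times> point \<Rightarrow> point \<Rightarrow> point" where
  "mirror e y = fst e + reflect (fst e) (snd e) (y - fst e)"

lemma mirror_mirror [simp]: "mirror e (mirror e y) = y"
  by (simp add: mirror_def)

lemma mirror_add: "mirror e (y + v) = mirror e y + reflect (fst e) (snd e) v"
  using linear_add[OF reflect_linear, of "fst e" "snd e" "y - fst e" v]
  by (simp add: mirror_def algebra_simps)

lemma mirror_on_line:
  assumes "y = fst e + u *\<^sub>R (snd e - fst e)"
  shows "mirror e y = y"
proof (cases "fst e = snd e")
  case True then show ?thesis using assms by (simp add: mirror_def reflect_def)
next
  case False
  define w where "w = snd e - fst e"
  have "w \<bullet> w \<noteq> 0" using False by (simp add: w_def)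
  then show ?thesis unfolding assms mirror_def reflect_def w_def[symmetric]
    by (simp flip: scaleR_left_diff_distrib)
qed

lemma mirror_on_segment:
  assumes "y \<in> closed_segment (fst e) (snd e)"
  shows "mirror e y = y"
proof -
  obtain u where "y = (1 - u) *\<^sub>R fst e + u *\<^sub>R snd e" using assms by (auto simp: in_segment)
  then show ?thesis by (intro mirror_on_line[of _ _ u]) (simp add: algebra_simps)
qed

text \<open>If an orbit bounces off the sides \<open>s\<close> in this order and its straightened path ends at \<open>p\<close>,
  then the orbit itself ends at \<open>unfold_map s p\<close>.\<close>

primrec unfold_map :: "(point \<times> point) list \<Rightarrow> point \<Rightarrow> point" where
  "unfold_map [] y = y"
| "unfold_map (e # s) y = unfold_map s (mirror e y)"

text \<open>The linear part of \<open>unfold_map\<close>; it carries the initial velocity of an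
  orbit to its final velocity.\<close>

primrec unfold_lin :: "(point \<times> point) list \<Rightarrow> point \<Rightarrow> point" where
  "unfold_lin [] v = v"
| "unfold_lin (e # s) v = unfold_lin s (reflect (fst e) (snd e) v)"

lemma unfold_map_append: "unfold_map (s @ r) y = unfold_map r (unfold_map s y)"
  by (induction s arbitrary: y) auto

lemma unfold_lin_append: "unfold_lin (s @ r) y = unfold_lin r (unfold_lin s y)"
  by (induction s arbitrary: y) auto

lemma unfold_map_rev [simp]: "unfold_map (rev s) (unfold_map s y) = y"
  by (induction s arbitrary: y) (auto simp: unfold_map_append)

lemma unfold_map_rev' [simp]: "unfold_map s (unfold_map (rev s) y) = y"
  using unfold_map_rev[of "rev s"] by simp

lemma unfold_map_add: "unfold_map s (y + v) = unfold_map s y + unfold_lin s v"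
  by (induction s arbitrary: y v) (auto simp: mirror_add)

lemma unfold_lin_linear: "linear (unfold_lin s)"
proof (induction s)
  case Nil then show ?case by (simp add: linear_id[unfolded id_def])
next
  case (Cons e s)
  then show ?case using linear_compose[OF reflect_linear Cons] by (simp add: o_def)
qed

lemma norm_unfold_lin [simp]: "norm (unfold_lin s v) = norm v"
  by (induction s arbitrary: v) auto

lemma unfold_map_alt: "unfold_map s y = unfold_map s x + unfold_lin s (y - x)"
  using unfold_map_add[of s x "y - x"] by simp

lemma dist_unfold_map [simp]: "dist (unfold_map s x) (unfold_map s y) = dist x y"
  by (simp add: unfold_map_alt[of s y x] dist_norm norm_minus_commute)

lemma unfold_map_eq_iff [simp]: "unfold_map s x = unfold_map s y \<longleftrightarrow> x = y"
  by (metis unfold_map_rev)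

lemma unfold_map_combo:
  "unfold_map s (x + u *\<^sub>R (p - x)) = unfold_map s x + u *\<^sub>R (unfold_map s p - unfold_map s x)"
  by (simp add: unfold_map_alt[of s p x] unfold_map_add linear_scale[OF unfold_lin_linear])

lemma unfold_map_open_segment:
  "unfold_map s ` open_segment x p = open_segment (unfold_map s x) (unfold_map s p)"
proof (intro set_eqI iffI)
  fix y assume "y \<in> unfold_map s ` open_segment x p"
  then obtain q where "y = unfold_map s q" "q \<in> open_segment x p" by blast
  then obtain u where "0 < u" "u < 1" "q = x + u *\<^sub>R (p - x)" "x \<noteq> p" by (metis open_segmentE)
  then show "y \<in> open_segment (unfold_map s x) (unfold_map s p)"
    using open_segmentI[of u "unfold_map s x" "unfold_map s p"] \<open>y = _\<close> by (simp add: unfold_map_combo)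
next
  fix y assume "y \<in> open_segment (unfold_map s x) (unfold_map s p)"
  then obtain u where "0 < u" "u < 1" "y = unfold_map s x + u *\<^sub>R (unfold_map s p - unfold_map s x)" "x \<noteq> p"
    by (metis open_segmentE)
  then show "y \<in> unfold_map s ` open_segment x p"
    using open_segmentI[of u x p] by (simp add: unfold_map_combo[symmetric])
qed

lemma unfold_map_in_open_segment:
  "unfold_map s q \<in> open_segment (unfold_map s x) (unfold_map s p) \<longleftrightarrow> q \<in> open_segment x p"
  unfolding unfold_map_open_segment[symmetric] by auto

lemma mirror_in_open_segment:
  "mirror e q \<in> open_segment (mirror e x) (mirror e p) \<longleftrightarrow> q \<in> open_segment x p"
  using unfold_map_in_open_segment[of "[e]"] by simp

lemma dist_mirror [simp]: "dist (mirror e x) (mirror e y) = dist x y"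
  using dist_unfold_map[of "[e]"] by simp

abbreviation side_closed :: "point \<times> point \<Rightarrow> point set" where
  "side_closed e \<equiv> closed_segment (fst e) (snd e)"

abbreviation side_open :: "point \<times> point \<Rightarrow> point set" where
  "side_open e \<equiv> open_segment (fst e) (snd e)"

lemma mirror_side_open: "y \<in> side_open e \<Longrightarrow> mirror e y = y"
  by (rule mirror_on_segment) (auto simp: open_segment_def)

section \<open>Itineraries of billiard orbits\<close>

text \<open>All that the dynamics needs: a bounded open set whose boundary is contained in finitely
  many segments meeting only at end points. Jordan curves and angle sums enter only when the sector
  areas are computed.\<close>

locale billiard_table =
  fixes S :: "(point \<times> point) set" and Om :: "point set"
  assumes finite_S: "finite S"
    and open_Om: "open Om" and bounded_Om: "bounded Om"
    and side_disjoint: "e \<in> S \<Longrightarrow> side_closed e \<inter> Om = {}"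
    and closure_Om: "closure Om \<subseteq> Om \<union> (\<Union>e\<in>S. side_closed e)"
    and nondegenerate: "e \<in> S \<Longrightarrow> fst e \<noteq> snd e"
    and sides_meet: "e \<in> S \<Longrightarrow> f \<in> S \<Longrightarrow> e \<noteq> f \<Longrightarrow>
      side_closed e \<inter> side_closed f \<subseteq> {fst e, snd e} \<inter> {fst f, snd f}"
begin

definition Cor :: "point set" where "Cor = fst ` S \<union> snd ` S"

definition Bd :: "point set" where "Bd = (\<Union>e\<in>S. side_closed e)"

lemma side_open_not_Om: "e \<in> S \<Longrightarrow> y \<in> side_open e \<Longrightarrow> y \<notin> Om"
  using side_disjoint by (fastforce simp: open_segment_def)

lemma side_open_unique:
  assumes "e \<in> S" "f \<in> S" "y \<in> side_open e" "y \<in> side_closed f"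
  shows "e = f"
proof (rule ccontr)
  assume "e \<noteq> f"
  then have "y \<in> {fst e, snd e}" using sides_meet[of e f] assms by (auto simp: open_segment_def)
  then show False using assms by (auto simp: open_segment_def)
qed

lemma corner_not_open: assumes "c \<in> Cor" "e \<in> S" shows "c \<notin> side_open e"
proof
  assume c: "c \<in> side_open e"
  obtain f where f: "f \<in> S" "c = fst f \<or> c = snd f" using assms by (auto simp: Cor_def)
  then have "e = f" using side_open_unique[of e f c] c assms by auto
  then show False using c f by (auto simp: open_segment_def)
qed

lemma corner_not_Om: "c \<in> Cor \<Longrightarrow> c \<notin> Om"
  using side_disjoint unfolding Cor_def by fastforce

lemma finite_Cor: "finite Cor" using finite_S by (simp add: Cor_def)

lemma Bd_cases:
  assumes "y \<in> Bd"
  obtains "y \<in> Cor" | e where "e \<in> S" "y \<in> side_open e"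
  using assms unfolding Bd_def Cor_def open_segment_def by blast

lemma Bd_disjoint: "Bd \<inter> Om = {}" using side_disjoint by (auto simp: Bd_def)

text \<open>Here \<open>p\<close> is the end point of the straightened orbit from \<open>x\<close>, not of the orbit itself.\<close>

primrec reach :: "(point \<times> point) list \<Rightarrow> point \<Rightarrow> point \<Rightarrow> bool" where
  "reach [] x p \<longleftrightarrow> x \<noteq> p \<and> open_segment x p \<subseteq> Om"
| "reach (e # s) x p \<longleftrightarrow> (\<exists>m. e \<in> S \<and> m \<in> side_open e \<and> m \<in> open_segment x p \<and>
      open_segment x m \<subseteq> Om \<and> reach s m (mirror e p))"

lemma reach_neq: "reach s x p \<Longrightarrow> x \<noteq> p"
  by (cases s) auto

lemma reach_sides: "reach s x p \<Longrightarrow> set s \<subseteq> S"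
  by (induction s arbitrary: x p) auto

text \<open>\<open>reach\<close> peels off the first bounce, whereas the flow and time reversal add
  a last one. This lemma and \<open>reach_snocD\<close> describe an itinerary from its far end, with
  \<open>q\<close> the last bounce on the straightened path.\<close>

lemma reach_snocI:
  assumes "reach s x q" "q \<in> open_segment x p" "e \<in> S" "unfold_map s q \<in> side_open e"
    "open_segment (unfold_map s q) (mirror e (unfold_map s p)) \<subseteq> Om"
  shows "reach (s @ [e]) x p"
  using assms
proof (induction s arbitrary: x p q)
  case Nil
  then have "mirror e q = q" by (simp add: mirror_side_open)
  moreover have "q \<noteq> p" using Nil by (auto simp: open_segment_def)
  ultimately have "q \<noteq> mirror e p" by (metis mirror_mirror)
  then show ?case using Nil by auto
next
  case (Cons f s)
  then obtain m where m: "f \<in> S" "m \<in> side_open f" "m \<in> open_segment x q"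
    "open_segment x m \<subseteq> Om" "reach s m (mirror f q)" by auto
  have "q \<in> open_segment m p" using open_segment_between1 Cons.prems m by blast
  then have "mirror f q \<in> open_segment m (mirror f p)"
    using mirror_in_open_segment[of f q m p] mirror_side_open[OF m(2)] by simp
  then have "reach (s @ [e]) m (mirror f p)"
    using Cons.IH[OF m(5)] Cons.prems by simp
  moreover have "m \<in> open_segment x p" using Cons.prems m open_segment_trans1(1) by blast
  ultimately show ?case using m by auto
qed

lemma reach_snocD:
  assumes "reach (s @ [e]) x p"
  obtains q where "q \<in> open_segment x p" "reach s x q" "e \<in> S" "unfold_map s q \<in> side_open e"
    "open_segment (unfold_map s q) (mirror e (unfold_map s p)) \<subseteq> Om"
proof -
  have "\<exists>q. q \<in> open_segment x p \<and> reach s x q \<and> e \<in> S \<and> unfold_map s q \<in> side_open e \<and>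
    open_segment (unfold_map s q) (mirror e (unfold_map s p)) \<subseteq> Om"
    using assms
  proof (induction s arbitrary: x p)
    case Nil
    then obtain m where "e \<in> S" "m \<in> side_open e" "m \<in> open_segment x p" "open_segment x m \<subseteq> Om"
      "reach [] m (mirror e p)" by auto
    then show ?case by (intro exI[of _ m]) (auto simp: open_segment_def)
  next
    case (Cons f s)
    then obtain m where m: "f \<in> S" "m \<in> side_open f" "m \<in> open_segment x p"
      "open_segment x m \<subseteq> Om" "reach (s @ [e]) m (mirror f p)" by auto
    from Cons.IH[OF m(5)] obtain q where q: "q \<in> open_segment m (mirror f p)" "reach s m q" "e \<in> S"
      "unfold_map s q \<in> side_open e"
      "open_segment (unfold_map s q) (mirror e (unfold_map s (mirror f p))) \<subseteq> Om" by blast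
    have "mirror f q \<in> open_segment m p"
      using mirror_in_open_segment[of f "mirror f q" m p] mirror_side_open[OF m(2)] q by simp
    then have "m \<in> open_segment x (mirror f q)" "mirror f q \<in> open_segment x p"
      using open_segment_between2 open_segment_trans1(2) m by blast+
    then show ?case using q m by (intro exI[of _ "mirror f q"]) auto
  qed
  then show ?thesis using that by blast
qed

text \<open>The first bounce of the orbit is the last one of the reversed orbit, so the induction
  step is \<open>reach_snocI\<close>. Applying \<open>unfold_map s\<close> moves the straightened
  path to the position in which its end, rather than its start, is the true one.\<close>

lemma reach_rev:
  assumes "reach s x p"
  shows "reach (rev s) (unfold_map s p) (unfold_map s x)"
  using assms
proof (induction s arbitrary: x p)
  case Nil then show ?case by (auto simp: open_segment_commute)
next
  case (Cons e s)
  then obtain m where m: "e \<in> S" "m \<in> side_open e" "m \<in> open_segment x p"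
    "open_segment x m \<subseteq> Om" "reach s m (mirror e p)" by auto
  have "reach (rev s @ [e]) (unfold_map s (mirror e p)) (unfold_map s (mirror e x))"
  proof (rule reach_snocI)
    show "reach (rev s) (unfold_map s (mirror e p)) (unfold_map s m)" by (rule Cons.IH[OF m(5)])
    have "m \<in> open_segment (mirror e p) (mirror e x)"
      using mirror_in_open_segment[of e m p x] mirror_side_open[OF m(2)] m(3)
      by (simp add: open_segment_commute)
    then show "unfold_map s m \<in> open_segment (unfold_map s (mirror e p)) (unfold_map s (mirror e x))"
      by (simp add: unfold_map_in_open_segment)
  qed (use m in \<open>auto simp: open_segment_commute\<close>)
  then show ?case by simp
qed

lemma reach_rev_iff: "reach (rev s) (unfold_map s p) (unfold_map s x) \<longleftrightarrow> reach s x p"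
  using reach_rev[of "rev s" "unfold_map s p" "unfold_map s x"] reach_rev[of s x p] by auto

text \<open>Orbits are deterministic: two orbits with the same initial direction leave
  \<open>Om\<close> first at the same point, hence bounce off the same side, and so on. When the
  shorter orbit ends, the longer one is still under way; if it does not bounce there, it is in
  \<open>Om\<close>. In particular no orbit continues beyond a corner.\<close>

lemma reach_prefix:
  assumes "reach s x q" "reach s' x p" "q \<in> open_segment x p" "\<forall>e\<in>S. unfold_map s q \<notin> side_open e"
  shows "unfold_map s q \<in> Om \<and> (\<exists>r. s' = s @ r \<and> reach r (unfold_map s q) (unfold_map s p))"
  using assms
proof (induction s arbitrary: x p q s')
  case Nil
  show ?case
  proof (cases s')
    case Nil': Nil
    then have "q \<in> Om" "open_segment q p \<subseteq> Om"
      using Nil.prems open_segment_trans1(2)[OF Nil.prems(3)] by auto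
    moreover have "q \<noteq> p" using Nil.prems(3) by (auto simp: open_segment_def)
    ultimately show ?thesis using Nil' by simp
  next
    case (Cons e r)
    then obtain m where m: "e \<in> S" "m \<in> side_open e" "m \<in> open_segment x p"
      "open_segment x m \<subseteq> Om" "reach r m (mirror e p)" using Nil.prems by auto
    have "m \<notin> open_segment x q" using Nil.prems(1) side_open_not_Om[OF m(1,2)] by auto
    moreover have "m \<noteq> q" using Nil.prems m by auto
    ultimately have mq: "m \<in> open_segment q p" using m(3) open_segment_split[OF Nil.prems(3)] by auto
    then have qm: "q \<in> open_segment x m" using Nil.prems open_segment_between2 by blast
    then have "q \<in> Om" "open_segment q m \<subseteq> Om" using m open_segment_trans1(2) by blast+
    then show ?thesis using m mq Cons by auto
  qed
next
  case (Cons e s)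
  then obtain m where m: "e \<in> S" "m \<in> side_open e" "m \<in> open_segment x q"
    "open_segment x m \<subseteq> Om" "reach s m (mirror e q)" by auto
  have mp: "m \<in> open_segment x p" using m(3) open_segment_trans1(1)[OF Cons.prems(3)] by blast
  have "s' \<noteq> []" using Cons.prems(2) mp side_open_not_Om[OF m(1,2)] by auto
  then obtain f r where s': "s' = f # r" by (cases s') auto
  then obtain m' where m': "f \<in> S" "m' \<in> side_open f" "m' \<in> open_segment x p"
    "open_segment x m' \<subseteq> Om" "reach r m' (mirror f p)" using Cons.prems(2) by auto
  \<comment> \<open>\<open>m\<close> and \<open>m'\<close> are both the first point beyond
    \<open>x\<close> on the ray that is not in \<open>Om\<close>.\<close>
  have "m' \<notin> open_segment x m" using m m' side_open_not_Om by blast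
  moreover have "m' \<notin> open_segment m p"
    using open_segment_between2[OF mp, of m'] m m' side_open_not_Om by blast
  ultimately have mm: "m' = m" using m'(3) open_segment_split[OF mp] by auto
  then have ef: "f = e" using side_open_unique[of f e m] m m' by (auto simp: open_segment_def)
  have "q \<in> open_segment m p" using open_segment_between1 Cons.prems m by blast
  then have "mirror e q \<in> open_segment m (mirror e p)"
    using mirror_in_open_segment[of e q m p] mirror_side_open[OF m(2)] by simp
  then show ?case
    using Cons.IH[OF m(5), of r "mirror e p"] m' Cons.prems(4) unfolding mm ef s' by auto
qed

lemma reach_unique:
  assumes "reach s x p" "reach s' x p" "\<forall>e\<in>S. unfold_map s p \<notin> side_open e"
    "\<forall>e\<in>S. unfold_map s' p \<notin> side_open e"
  shows "s = s'"
  using assms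
proof (induction s arbitrary: x p s')
  case Nil
  then show ?case by (cases s') (use side_open_not_Om in auto)
next
  case (Cons e s)
  then obtain m where m: "e \<in> S" "m \<in> side_open e" "m \<in> open_segment x p"
    "open_segment x m \<subseteq> Om" "reach s m (mirror e p)" by auto
  have "s' \<noteq> []" using Cons.prems(2) m(3) side_open_not_Om[OF m(1,2)] by auto
  then obtain f r where s': "s' = f # r" by (cases s') auto
  then obtain m' where m': "f \<in> S" "m' \<in> side_open f" "m' \<in> open_segment x p"
    "open_segment x m' \<subseteq> Om" "reach r m' (mirror f p)" using Cons.prems(2) by auto
  have "m' \<notin> open_segment x m" using m m' side_open_not_Om by blast
  moreover have "m' \<notin> open_segment m p"
    using open_segment_between2[OF m(3), of m'] m m' side_open_not_Om by blast
  ultimately have mm: "m' = m" using m'(3) open_segment_split[OF m(3)] by auto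
  then have ef: "f = e" using side_open_unique[of f e m] m m' by (auto simp: open_segment_def)
  show ?case
    using Cons.IH[OF m(5), of r] m' Cons.prems unfolding mm ef s' by auto
qed

lemma reach_concat:
  assumes "reach s x q" "unfold_map s q \<in> Om" "q \<in> open_segment x p"
    "reach r (unfold_map s q) (unfold_map s p)"
  shows "reach (s @ r) x p"
  using assms
proof (induction s arbitrary: x p q)
  case Nil
  show ?case
  proof (cases r)
    case Nil': Nil
    then show ?thesis using Nil.prems open_segment_split[OF Nil.prems(3)] by (auto simp: open_segment_def)
  next
    case (Cons e r')
    then obtain m where m: "e \<in> S" "m \<in> side_open e" "m \<in> open_segment q p"
      "open_segment q m \<subseteq> Om" "reach r' m (mirror e p)" using Nil.prems by auto
    have qm: "q \<in> open_segment x m" "m \<in> open_segment x p"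
      using open_segment_between2 open_segment_trans1(2) m Nil.prems(3) by blast+
    have "open_segment x m \<subseteq> Om"
      using open_segment_split[OF qm(1)] Nil.prems m by auto
    then show ?thesis using m qm Cons by auto
  qed
next
  case (Cons e s)
  then obtain m where m: "e \<in> S" "m \<in> side_open e" "m \<in> open_segment x q"
    "open_segment x m \<subseteq> Om" "reach s m (mirror e q)" by auto
  have mp: "m \<in> open_segment x p" using m(3) open_segment_trans1(1)[OF Cons.prems(3)] by blast
  have "q \<in> open_segment m p" using open_segment_between1 Cons.prems m by blast
  then have "mirror e q \<in> open_segment m (mirror e p)"
    using mirror_in_open_segment[of e q m p] mirror_side_open[OF m(2)] by simp
  then have "reach (s @ r) m (mirror e p)" using Cons.IH[OF m(5)] Cons.prems by simp
  then show ?case using m mp by auto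
qed

text \<open>The mirror at a bounce fixes the bounce point, so it preserves the remaining length, and
  the triangle inequality applies. This confines the bounces of a short orbit to a small ball,
  whatever their number.\<close>

lemma reach_bounce_dist:
  assumes "reach s x p" "e \<in> set s"
  shows "\<exists>m\<in>side_open e. dist x m \<le> dist x p"
  using assms
proof (induction s arbitrary: x p)
  case (Cons f s)
  then obtain m where m: "f \<in> S" "m \<in> side_open f" "m \<in> open_segment x p"
    "open_segment x m \<subseteq> Om" "reach s m (mirror f p)" by auto
  have d: "dist x p = dist x m + dist m p" using dist_open_segment m by blast
  show ?case
  proof (cases "e = f")
    case True then show ?thesis using m d by (intro bexI[of _ m]) auto
  next
    case False
    then obtain k where k: "k \<in> side_open e" "dist m k \<le> dist m (mirror f p)"
      using Cons.IH[OF m(5)] Cons.prems(2) by auto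
    have "dist m (mirror f p) = dist m p"
      using dist_mirror[of f m p] mirror_side_open[OF m(2)] by simp
    then have "dist x k \<le> dist x p" using d k dist_triangle[of x k m] by linarith
    then show ?thesis using k by blast
  qed
qed auto

section \<open>Correspondence between \<open>reach\<close> and the billiard flow\<close>

lemma flow_imp_reach:
  assumes "billiard_flow P t (x, v) (y, w)" "v \<noteq> 0" "sides P = S" "interior (polygon_region P) = Om"
  shows "0 < t \<and> (\<exists>s. reach s x (x + t *\<^sub>R v) \<and> y = unfold_map s (x + t *\<^sub>R v) \<and> w = unfold_lin s v)"
  using assms
proof (induction t "(x, v)" "(y, w)" arbitrary: y w rule: billiard_flow.induct)
  case (free t)
  then show ?case by (intro conjI exI[of _ "[]"]) auto
next
  case (reflection t y w a b t')
  then obtain s where s: "0 < t" "reach s x (x + t *\<^sub>R v)" "y = unfold_map s (x + t *\<^sub>R v)" "w = unfold_lin s v"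
    by auto
  let ?p = "x + (t + t') *\<^sub>R v" and ?e = "(a, b)"
  have e: "?e \<in> S" "y \<in> side_open ?e" using reflection by auto
  have "?p = (x + t *\<^sub>R v) + t' *\<^sub>R v" by (simp add: algebra_simps)
  then have "unfold_map s ?p = y + t' *\<^sub>R w"
    by (simp only: unfold_map_add s linear_scale[OF unfold_lin_linear])
  then have m: "mirror ?e (unfold_map s ?p) = y + t' *\<^sub>R reflect a b w"
    using mirror_side_open[OF e(2)] by (simp add: mirror_add linear_scale[OF reflect_linear])
  have "x + t *\<^sub>R v = x + (t / (t + t')) *\<^sub>R (?p - x)" using s reflection by simp
  moreover have "0 < t / (t + t')" "t / (t + t') < 1" "x \<noteq> ?p" using s reflection by auto
  ultimately have "x + t *\<^sub>R v \<in> open_segment x ?p" using open_segmentI by metis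
  then have "reach (s @ [?e]) x ?p"
    by (rule reach_snocI[OF s(2)]) (use e s m reflection in auto)
  then show ?case using s reflection m
    by (intro conjI exI[of _ "s @ [?e]"]) (auto simp: unfold_map_append unfold_lin_append)
qed

lemma reach_imp_flow:
  assumes "reach s x (x + t *\<^sub>R v)" "0 < t" "sides P = S" "interior (polygon_region P) = Om"
  shows "billiard_flow P t (x, v) (unfold_map s (x + t *\<^sub>R v), unfold_lin s v)"
  using assms
proof (induction s arbitrary: t rule: rev_induct)
  case Nil
  then show ?case using billiard_flow.free[of t x v P] by auto
next
  case (snoc e s)
  let ?p = "x + t *\<^sub>R v"
  obtain q where q: "q \<in> open_segment x ?p" "reach s x q" "e \<in> S" "unfold_map s q \<in> side_open e"
    "open_segment (unfold_map s q) (mirror e (unfold_map s ?p)) \<subseteq> Om"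
    using reach_snocD[OF snoc.prems(1)] .
  obtain u where u: "0 < u" "u < 1" "q = x + u *\<^sub>R (?p - x)" using q(1) by (rule open_segmentE)
  define t1 where "t1 = u * t"
  define w where "w = unfold_lin s v"
  have t1: "0 < t1" "t1 < t" "q = x + t1 *\<^sub>R v" using u snoc.prems by (auto simp: t1_def)
  have fl: "billiard_flow P t1 (x, v) (unfold_map s q, w)"
    using snoc.IH[of t1] q t1 snoc.prems w_def by auto
  have "?p = q + (t - t1) *\<^sub>R v" using t1 by (simp add: algebra_simps)
  then have "unfold_map s ?p = unfold_map s q + (t - t1) *\<^sub>R w"
    by (simp only: unfold_map_add linear_scale[OF unfold_lin_linear] w_def)
  then have m: "mirror e (unfold_map s ?p) = unfold_map s q + (t - t1) *\<^sub>R reflect (fst e) (snd e) w"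
    using mirror_side_open[OF q(4)] by (simp add: mirror_add linear_scale[OF reflect_linear])
  have "billiard_flow P (t1 + (t - t1)) (x, v) (unfold_map s q + (t - t1) *\<^sub>R reflect (fst e) (snd e) w, reflect (fst e) (snd e) w)"
    by (rule billiard_flow.reflection[OF fl]) (use q t1 m snoc.prems in auto)
  then show ?case using m by (simp add: unfold_map_append unfold_lin_append w_def)
qed

end

section \<open>Continuation of orbits\<close>

context billiard_table
begin

section \<open>The table is conical near each point\<close>

definition local_radius :: "point \<Rightarrow> real \<Rightarrow> bool" where
  "local_radius X r \<longleftrightarrow> 0 < r \<and> (\<forall>e\<in>S. side_closed e \<inter> ball X r \<noteq> {} \<longrightarrow> X \<in> side_closed e) \<and>
     Cor \<inter> ball X r \<subseteq> {X}"

lemma local_radius_exists: "\<exists>r. local_radius X r"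
proof -
  define F where "F = side_closed ` {e\<in>S. X \<notin> side_closed e} \<union> {Cor - {X}}"
  have "closed (\<Union>F)"
    by (rule closed_Union) (auto simp: F_def finite_S finite_Cor finite_imp_closed)
  moreover have "X \<notin> \<Union>F" by (auto simp: F_def)
  ultimately obtain r where "0 < r" "ball X r \<inter> \<Union>F = {}"
    by (metis ComplI disjoint_eq_subset_Compl openE open_Compl)
  then have "local_radius X r" unfolding local_radius_def F_def by blast
  then show ?thesis ..
qed

lemma connected_Om:
  assumes "connected T" "T \<inter> Bd = {}" "T \<inter> Om \<noteq> {}"
  shows "T \<subseteq> Om"
proof (rule ccontr)
  assume "\<not> T \<subseteq> Om"
  then have "T \<inter> frontier Om \<noteq> {}" using connected_Int_frontier[of T Om] assms by blast
  moreover have "frontier Om \<subseteq> Bd"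
    using closure_Om open_Om by (auto simp: frontier_def Bd_def interior_open)
  ultimately show False using assms by blast
qed

text \<open>A side that meets the ball contains \<open>X\<close>. If it also contained another point
  of the ray through \<open>y\<close>, then \<open>y\<close> would lie on its line but beyond one of
  its ends. That end would be a corner other than \<open>X\<close> and no farther from
  \<open>X\<close> than \<open>y\<close>, contradicting the choice of \<open>r\<close>.\<close>

lemma local_ray_Bd:
  assumes r: "local_radius X r" and y: "y \<in> ball X r" "y \<noteq> X" "y \<notin> Bd"
    and z: "X + \<mu> *\<^sub>R (y - X) \<in> ball X r" "0 < \<mu>"
  shows "X + \<mu> *\<^sub>R (y - X) \<notin> Bd"
proof
  let ?z = "X + \<mu> *\<^sub>R (y - X)"
  assume "?z \<in> Bd"
  then obtain e where e: "e \<in> S" "?z \<in> side_closed e" by (auto simp: Bd_def)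
  have Xe: "X \<in> side_closed e" using r z e unfolding local_radius_def by blast
  have ye: "y \<notin> side_closed e" using y e by (auto simp: Bd_def)
  define d where "d = snd e - fst e"
  obtain s where s: "0 \<le> s" "s \<le> 1" "X = fst e + s *\<^sub>R d"
    using Xe by (auto simp: in_segment d_def algebra_simps)
  obtain t where t: "0 \<le> t" "t \<le> 1" "?z = fst e + t *\<^sub>R d"
    using e(2) by (auto simp: in_segment d_def algebra_simps)
  have "\<mu> *\<^sub>R (y - X) = (t - s) *\<^sub>R d" using s(3) t(3) by (simp add: algebra_simps)
  then have "y - X = (1 / \<mu>) *\<^sub>R ((t - s) *\<^sub>R d)" using z(2) by (metis divideR_right less_irrefl inverse_eq_divide)
  then have yX: "y = X + ((t - s) / \<mu>) *\<^sub>R d" by (simp add: diff_eq_eq add.commute)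
  define w where "w = s + (t - s) / \<mu>"
  have yw: "y = fst e + w *\<^sub>R d" using yX s(3) by (simp add: w_def algebra_simps)
  have dy: "dist X y = \<bar>w - s\<bar> * norm d" using yX by (simp add: w_def dist_norm)
  have dr: "dist X y < r" using y by simp
  have ends: "b \<notin> {fst e, snd e} \<or> b = X \<or> dist X b \<ge> r" for b
    using r e(1) unfolding local_radius_def Cor_def by auto
  have w: "w < 0 \<or> 1 < w"
  proof (rule ccontr)
    assume "\<not> ?thesis"
    then have "y \<in> side_closed e" using yw by (auto simp: in_segment d_def algebra_simps intro!: exI[of _ w])
    then show False using ye by simp
  qed
  then show False
  proof
    assume w0: "w < 0"
    then have "(t - s) / \<mu> < 0" using s by (simp add: w_def)
    then have "t < s" using z(2) by (simp add: divide_less_0_iff)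
    then have s0: "0 < s" using t by simp
    have "dist X (fst e) = s * norm d" using s by (simp add: dist_norm)
    moreover have "s * norm d \<le> \<bar>w - s\<bar> * norm d" using w0 s by (intro mult_right_mono) auto
    ultimately have "dist X (fst e) < r" using dy dr by simp
    moreover have "fst e \<noteq> X" using s s0 nondegenerate[OF e(1)] by (auto simp: d_def)
    ultimately show False using ends[of "fst e"] by auto
  next
    assume w1: "1 < w"
    then have "0 < (t - s) / \<mu>" using s unfolding w_def by linarith
    then have "s < t" using z(2) by (simp add: zero_less_divide_iff)
    then have s0: "s < 1" using t by simp
    have sd: "snd e = X + (1 - s) *\<^sub>R d" using s by (simp add: d_def algebra_simps)
    then have "dist X (snd e) = (1 - s) * norm d" using s by (simp add: dist_norm)
    moreover have "(1 - s) * norm d \<le> \<bar>w - s\<bar> * norm d" using w1 s by (intro mult_right_mono) auto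
    ultimately have "dist X (snd e) < r" using dy dr by simp
    moreover have "snd e \<noteq> X" using sd s0 nondegenerate[OF e(1)] by (auto simp: d_def)
    ultimately show False using ends[of "snd e"] by auto
  qed
qed

lemma ray_in_ball:
  fixes X y :: point
  assumes "y \<in> ball X r" "0 \<le> \<mu>" "\<mu> \<le> 1"
  shows "X + \<mu> *\<^sub>R (y - X) \<in> ball X r"
proof -
  have "\<mu> * norm (y - X) \<le> 1 * norm (y - X)" using assms by (intro mult_right_mono) auto
  then show ?thesis using assms by (simp add: dist_norm norm_minus_commute)
qed

lemma local_ray_Om:
  assumes r: "local_radius X r" and y: "y \<in> ball X r" "y \<in> Om"
    and z: "X + \<mu> *\<^sub>R (y - X) \<in> ball X r" "0 < \<mu>"
  shows "X + \<mu> *\<^sub>R (y - X) \<in> Om"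
proof (cases "y = X")
  case True then show ?thesis using y by simp
next
  case False
  let ?z = "X + \<mu> *\<^sub>R (y - X)"
  have yB: "y \<notin> Bd" using y Bd_disjoint by auto
  have "closed_segment y ?z \<inter> Bd = {}"
  proof -
    have "w \<notin> Bd" if seg: "w \<in> closed_segment y ?z" for w
    proof -
      obtain u where u: "0 \<le> u" "u \<le> 1" "w = (1 - u) *\<^sub>R y + u *\<^sub>R ?z"
        using seg unfolding in_segment by blast
      have w: "w = X + ((1 - u) + u * \<mu>) *\<^sub>R (y - X)" using u by (simp add: algebra_simps)
      have "0 < (1 - u) + u * \<mu>"
        using u z(2) by (cases "u = 1") (auto intro: add_pos_nonneg)
      moreover have "w \<in> ball X r"
        using seg closed_segment_subset[OF y(1) z(1) convex_ball] by blast
      ultimately show ?thesis using local_ray_Bd[OF r y(1) False yB, of "(1 - u) + u * \<mu>"] w by simp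
    qed
    then show ?thesis by blast
  qed
  then have "closed_segment y ?z \<subseteq> Om"
    using connected_Om[OF connected_segment] y(2) by blast
  then show ?thesis by auto
qed

lemma local_open_segment:
  assumes r: "local_radius X r" and y: "y \<in> ball X r" "y \<in> Om"
  shows "open_segment X y \<subseteq> Om"
proof
  fix w assume "w \<in> open_segment X y"
  then obtain u where u: "0 < u" "u < 1" "w = X + u *\<^sub>R (y - X)" by (metis open_segmentE)
  then show "w \<in> Om" using local_ray_Om[OF r y, of u] ray_in_ball[OF y(1), of u] by simp
qed

text \<open>The new point is the image of \<open>y\<close> in the perpendicular to \<open>e\<close>
  at \<open>X\<close>: an orbit that comes from \<open>y\<close> leaves \<open>X\<close> towards it.
  The segment between the two is parallel to \<open>e\<close> and off its line, and \<open>e\<close>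
  is the only side in the ball, so the segment cannot leave \<open>Om\<close>.\<close>

lemma reflected_Om:
  assumes r: "local_radius X r" and e: "e \<in> S" "X \<in> side_open e"
    and y: "y \<in> ball X r" "y \<in> Om"
  shows "2 *\<^sub>R X - mirror e y \<in> Om \<inter> ball X r"
proof
  let ?y = "2 *\<^sub>R X - mirror e y"
  define d where "d = snd e - fst e"
  have d: "d \<noteq> 0" using nondegenerate[OF e(1)] by (simp add: d_def)
  obtain s where s: "0 < s" "s < 1" "X = fst e + s *\<^sub>R d"
    using open_segmentE[OF e(2)] unfolding d_def by metis
  define k where "k = 2 * ((y - X) \<bullet> d) / (d \<bullet> d)"
  have "mirror e y = mirror e X + reflect (fst e) (snd e) (y - X)"
    using mirror_add[of e X "y - X"] by simp
  then have my: "mirror e y = X + k *\<^sub>R d - (y - X)"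
    using mirror_side_open[OF e(2)] by (simp add: reflect_def k_def d_def)
  have "dist X (mirror e y) = dist X y"
    using dist_mirror[of e X y] mirror_side_open[OF e(2)] by simp
  then show ball: "?y \<in> ball X r" using y by (simp add: dist_norm scaleR_2 norm_minus_commute)
  have yB: "y \<notin> Bd" using y Bd_disjoint by auto
  have yX: "y \<noteq> X" using e yB by (auto simp: Bd_def open_segment_def)
  have off: "y - X \<noteq> \<beta> *\<^sub>R d" for \<beta>
  proof
    assume b: "y - X = \<beta> *\<^sub>R d"
    \<comment> \<open>Shrinking \<open>y - X\<close> by this factor would bring \<open>y\<close>
      onto the side itself. The summand 1 covers the case \<open>\<beta> = 0\<close>.\<close>
    define \<mu> where "\<mu> = min 1 (min s (1 - s) / (\<bar>\<beta>\<bar> + 1))"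
    have m0: "0 < \<mu>" "\<mu> \<le> 1" using s by (auto simp: \<mu>_def)
    have "\<mu> * \<bar>\<beta>\<bar> \<le> min s (1 - s) / (\<bar>\<beta>\<bar> + 1) * \<bar>\<beta>\<bar>" by (intro mult_right_mono) (auto simp: \<mu>_def)
    also have "\<dots> \<le> min s (1 - s)" using s by (auto simp: field_simps min_def)
    finally have "\<bar>\<mu> * \<beta>\<bar> \<le> min s (1 - s)" using m0 by (simp add: abs_mult)
    then have "0 \<le> s + \<mu> * \<beta>" "s + \<mu> * \<beta> \<le> 1" by linarith+
    moreover have "X + \<mu> *\<^sub>R (y - X) = fst e + (s + \<mu> * \<beta>) *\<^sub>R d" using b s(3) by (simp add: algebra_simps)
    ultimately have "X + \<mu> *\<^sub>R (y - X) \<in> side_closed e"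
      by (auto simp: in_segment d_def algebra_simps intro!: exI[of _ "s + \<mu> * \<beta>"])
    then have "X + \<mu> *\<^sub>R (y - X) \<in> Bd" using e by (auto simp: Bd_def)
    moreover have "X + \<mu> *\<^sub>R (y - X) \<in> ball X r" using ray_in_ball[OF y(1), of \<mu>] m0 by simp
    ultimately show False using local_ray_Bd[OF r y(1) yX yB _ m0(1)] by blast
  qed
  have "closed_segment y ?y \<inter> Bd = {}"
  proof -
    have "w \<notin> Bd" if w: "w \<in> closed_segment y ?y" for w
    proof
      assume "w \<in> Bd"
      then obtain f where f: "f \<in> S" "w \<in> side_closed f" by (auto simp: Bd_def)
      have "w \<in> ball X r"
        using w closed_segment_subset[OF y(1) ball convex_ball] by blast
      then have "X \<in> side_closed f" using r f unfolding local_radius_def by blast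
      then have fe: "f = e" using side_open_unique[OF e(1) f(1) e(2)] by simp
      obtain t where t: "w = fst e + t *\<^sub>R d" using f fe by (auto simp: in_segment d_def algebra_simps)
      obtain u where u: "w = (1 - u) *\<^sub>R y + u *\<^sub>R ?y" using w unfolding in_segment by blast
      have "w - X = (y - X) - (u * k) *\<^sub>R d" unfolding u my by (simp add: algebra_simps scaleR_2)
      moreover have "w - X = (t - s) *\<^sub>R d" using t s(3) by (simp add: algebra_simps)
      ultimately have "y - X = (t - s + u * k) *\<^sub>R d" by (simp add: algebra_simps)
      then show False using off by blast
    qed
    then show ?thesis by blast
  qed
  then have "closed_segment y ?y \<subseteq> Om"
    using connected_Om[OF connected_segment] y(2) by blast
  then show "?y \<in> Om" by auto
qed

lemma unfold_map_ray: "unfold_map s (c + t *\<^sub>R v) = unfold_map s c + t *\<^sub>R unfold_lin s v"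
  by (simp add: unfold_map_add linear_scale[OF unfold_lin_linear])

lemma ray_open_segment:
  fixes c v :: point
  assumes "v \<noteq> 0" "0 < a" "a < b"
  shows "c + a *\<^sub>R v \<in> open_segment c (c + b *\<^sub>R v)"
  using open_segment_ray[of v 0 b c] assms by auto

lemma unfold_map_fixed:
  assumes "\<forall>e\<in>set s. X \<in> side_closed e"
  shows "unfold_map s X = X"
  using assms by (induction s) (auto simp: mirror_on_segment)

text \<open>Existence of orbits up to a null set. The last two alternatives forget whether the
  itinerary is really followed: they only have to place \<open>c + v\<close> on one of countably
  many lines.\<close>

lemma billiard_total:
  assumes start: "0 < r0" "\<forall>r\<in>{0<..<r0}. c + r *\<^sub>R v \<in> Om" and v: "v \<noteq> 0"
  shows "(\<exists>s. reach s c (c + v) \<and> unfold_map s (c + v) \<in> Om) \<or>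
    (\<exists>s q. set s \<subseteq> S \<and> q \<in> open_segment c (c + v) \<and> unfold_map s q \<in> Cor) \<or>
    (\<exists>s. set s \<subseteq> S \<and> unfold_map s (c + v) \<in> Bd)"
proof (rule ccontr)
  assume not: "\<not> ?thesis"
  define q where "q t = c + t *\<^sub>R v" for t
  define T where "T = {t. 0 < t \<and> t \<le> 1 \<and> (\<exists>s. reach s c (q t) \<and> unfold_map s (q t) \<in> Om)}"
  have q1: "q 1 = c + v" by (simp add: q_def)
  have dq: "dist (q a) (q b) = \<bar>a - b\<bar> * norm v" for a b
    by (simp add: q_def dist_norm flip: scaleR_left_diff_distrib)
  have T1: "1 \<notin> T" using not q1 by (auto simp: T_def)
  have "min 1 (r0 / 2) \<in> T"
  proof -
    let ?a = "min 1 (r0 / 2)"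
    have a: "0 < ?a" "?a < r0" using start by auto
    have "open_segment c (q ?a) = (\<lambda>u. c + u *\<^sub>R v) ` {0<..<?a}"
      using open_segment_ray[OF v a(1), of c] by (simp add: q_def)
    then have "open_segment c (q ?a) \<subseteq> Om" "q ?a \<in> Om" using start a by (auto simp: q_def)
    then show ?thesis using a v by (auto simp: T_def q_def intro!: exI[of _ "[]"])
  qed
  then have Tne: "T \<noteq> {}" by auto
  have Tbdd: "bdd_above T" by (rule bdd_aboveI[of _ 1]) (auto simp: T_def)
  define L where "L = Sup T"
  have TL: "t \<le> L" if "t \<in> T" for t using cSup_upper[OF that Tbdd] by (simp add: L_def)
  have L1: "L \<le> 1" using cSup_least[OF Tne, of 1] by (auto simp: L_def T_def)
  have L0: "0 < L" using TL[OF \<open>min 1 (r0 / 2) \<in> T\<close>] start by linarith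
  \<comment> \<open>Since \<open>Om\<close> is open, an orbit that is inside at time
    \<open>L\<close> can be prolonged. Hence the supremum is not attained, and the behaviour at
    \<open>L\<close> has to be found as a limit.\<close>
  have extend: "\<exists>t>L. t \<in> T" if ext: "L < 1" "reach s c (q L)" "unfold_map s (q L) \<in> Om" for s
  proof -
    obtain r where r: "0 < r" "ball (unfold_map s (q L)) r \<subseteq> Om"
      using open_Om ext(3) by (meson openE)
    define h where "h = min (1 - L) (r / (2 * norm v))"
    have h: "0 < h" "L + h \<le> 1" using ext(1) r v by (auto simp: h_def)
    have "h * norm v \<le> r / (2 * norm v) * norm v" by (intro mult_right_mono) (auto simp: h_def)
    then have "h * norm v < r" using r v by simp
    then have d: "unfold_map s (q (L + h)) \<in> ball (unfold_map s (q L)) r"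
      using h by (simp add: dq)
    then have "closed_segment (unfold_map s (q L)) (unfold_map s (q (L + h))) \<subseteq> ball (unfold_map s (q L)) r"
      using r by (intro closed_segment_subset) auto
    then have "open_segment (unfold_map s (q L)) (unfold_map s (q (L + h))) \<subseteq> Om"
      using r by (auto simp: open_segment_def)
    moreover have "q L \<noteq> q (L + h)" using h v by (simp add: q_def)
    ultimately have "reach [] (unfold_map s (q L)) (unfold_map s (q (L + h)))" by simp
    then have "reach (s @ []) c (q (L + h))"
      using ext h v L0 by (intro reach_concat) (auto simp: q_def intro!: ray_open_segment)
    moreover have "unfold_map s (q (L + h)) \<in> Om" using d r(2) by blast
    ultimately have "L + h \<in> T" using h L0 unfolding T_def by auto
    then show ?thesis using h by (intro exI[of _ "L + h"]) auto
  qed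
  have LT: "L \<notin> T"
  proof
    assume "L \<in> T"
    then obtain s where s: "reach s c (q L)" "unfold_map s (q L) \<in> Om" by (auto simp: T_def)
    have "L < 1" using T1 \<open>L \<in> T\<close> L1 by (cases "L = 1") auto
    then obtain t where "L < t" "t \<in> T" using extend s by blast
    then show False using TL[of t] by simp
  qed
  have "\<forall>n. \<exists>t. t \<in> T \<and> L - 1 / Suc n < t"
  proof
    fix n
    have "L - 1 / Suc n < Sup T" by (simp add: L_def)
    then show "\<exists>t. t \<in> T \<and> L - 1 / Suc n < t" by (rule less_cSupE[OF _ Tne]) blast
  qed
  then obtain t where t: "\<And>n. t n \<in> T" "\<And>n. L - 1 / Suc n < t n" by metis
  have tlt: "t n < L" for n using TL[OF t(1)[of n]] LT t(1)[of n] by (cases "t n = L") auto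
  have tlim: "t \<longlonglongrightarrow> L"
  proof (rule tendsto_sandwich[of "\<lambda>n. L - 1 / Suc n" t sequentially "\<lambda>n. L"])
    show "(\<lambda>n. L - 1 / Suc n) \<longlonglongrightarrow> L"
      using tendsto_diff[OF tendsto_const LIMSEQ_inverse_real_of_nat, of L] by (simp add: inverse_eq_divide)
  qed (use t tlt in \<open>auto intro!: always_eventually less_imp_le\<close>)
  have "\<forall>n. \<exists>s. reach s c (q (t n)) \<and> unfold_map s (q (t n)) \<in> Om" using t by (auto simp: T_def)
  then obtain s where s: "\<And>n. reach (s n) c (q (t n))" "\<And>n. unfold_map (s n) (q (t n)) \<in> Om" by metis
  define x where "x n = unfold_map (s n) (q (t n))" for n
  have "compact (closure Om)" using bounded_Om by (simp add: compact_closure)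
  moreover have "\<forall>n. x n \<in> closure Om" using s closure_subset by (auto simp: x_def)
  ultimately obtain X f where X: "X \<in> closure Om" "strict_mono f" "(x \<circ> f) \<longlonglongrightarrow> X"
    unfolding compact_def by blast
  obtain r where r: "local_radius X r" using local_radius_exists by blast
  have r0: "0 < r" using r by (simp add: local_radius_def)
  have tf: "(t \<circ> f) \<longlonglongrightarrow> L" using LIMSEQ_subseq_LIMSEQ[OF tlim X(2)] .
  \<comment> \<open>The radius is halved because a later bounce differs from \<open>X\<close> by at
    most the present distance to \<open>X\<close> plus the length of the path still to go.\<close>
  have "\<forall>\<^sub>F n in sequentially. dist ((x \<circ> f) n) X < r / 2"
    by (rule tendstoD[OF X(3)]) (use r0 in simp)
  moreover have "\<forall>\<^sub>F n in sequentially. dist ((t \<circ> f) n) L < r / (2 * norm v)"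
    by (rule tendstoD[OF tf]) (use r0 v in simp)
  ultimately have "\<forall>\<^sub>F n in sequentially. dist ((x \<circ> f) n) X < r / 2 \<and> dist ((t \<circ> f) n) L < r / (2 * norm v)"
    by eventually_elim auto
  then obtain N where N: "dist ((x \<circ> f) N) X < r / 2" "dist ((t \<circ> f) N) L < r / (2 * norm v)"
    by (auto simp: eventually_sequentially)
  define t0 where "t0 = t (f N)"
  define s0 where "s0 = s (f N)"
  define x0 where "x0 = x (f N)"
  define y where "y a = unfold_map s0 (q a)" for a
  have t0: "0 < t0" "t0 < L" using t(1)[of "f N"] tlt[of "f N"] by (auto simp: t0_def T_def)
  have x0: "x0 = y t0" "x0 \<in> Om" "reach s0 c (q t0)" using s by (auto simp: x0_def y_def x_def t0_def s0_def)
  have "(L - t0) * norm v < r / (2 * norm v) * norm v"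
    using N(2) v t0 by (intro mult_strict_right_mono) (auto simp: t0_def dist_real_def)
  then have Lr: "(L - t0) * norm v < r / 2" using v by simp
  \<comment> \<open>From \<open>t0\<close> on, all reflections are in sides through \<open>X\<close>, which fix \<open>X\<close>.\<close>
  have later: "dist (x (f n)) X = dist (y (t (f n))) X" if "t0 < t (f n)" for n
  proof -
    have "q t0 \<in> open_segment c (q (t (f n)))"
      using ray_open_segment[OF v t0(1) that] by (simp add: q_def)
    moreover have "\<forall>e\<in>S. unfold_map s0 (q t0) \<notin> side_open e"
      using x0 side_open_not_Om unfolding y_def by blast
    ultimately obtain g where g: "s (f n) = s0 @ g" "reach g x0 (y (t (f n)))"
      using reach_prefix[OF x0(3) s(1)[of "f n"]] x0(1) by (auto simp: y_def)
    have "X \<in> side_closed e" if "e \<in> set g" for e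
    proof -
      obtain m where m: "m \<in> side_open e" "dist x0 m \<le> dist x0 (y (t (f n)))"
        using reach_bounce_dist[OF g(2) \<open>e \<in> set g\<close>] by blast
      have "dist x0 (y (t (f n))) = (t (f n) - t0) * norm v"
        using \<open>t0 < t (f n)\<close> by (simp add: x0 y_def dq)
      also have "\<dots> \<le> (L - t0) * norm v" using tlt[of "f n"] by (intro mult_right_mono) auto
      finally have "m \<in> ball X r"
        using Lr N(1) m(2) dist_triangle[of X m x0] by (simp add: x0_def dist_commute)
      moreover have "e \<in> S" using that reach_sides[OF g(2)] by auto
      moreover have "m \<in> side_closed e" using m by (simp add: open_segment_def)
      ultimately show ?thesis using r unfolding local_radius_def by blast
    qed
    then have "unfold_map g X = X" by (intro unfold_map_fixed) auto
    moreover have "x (f n) = unfold_map g (y (t (f n)))" by (simp add: x_def g unfold_map_append y_def)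
    ultimately show ?thesis by (metis dist_unfold_map)
  qed
  \<comment> \<open>\<open>y\<close> goes straight on with the itinerary frozen at time
    \<open>t0\<close>. By \<open>later\<close> its distance from \<open>X\<close> is that of the
    true orbit, which tends to 0 along the subsequence.\<close>
  have "y L = X"
  proof -
    have "\<forall>\<^sub>F n in sequentially. t0 < (t \<circ> f) n" by (rule order_tendstoD(1)[OF tf t0(2)])
    then have ev: "\<forall>\<^sub>F n in sequentially. dist ((x \<circ> f) n) X = dist (y ((t \<circ> f) n)) X"
      by eventually_elim (simp add: later)
    have yy: "y a = y 0 + a *\<^sub>R unfold_lin s0 v" for a by (simp add: y_def q_def unfold_map_ray)
    have "(\<lambda>n. y ((t \<circ> f) n)) \<longlonglongrightarrow> y L"
      unfolding yy[of "(t \<circ> f) _"] yy[of L] by (intro tendsto_intros tf)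
    then have "(\<lambda>n. dist (y ((t \<circ> f) n)) X) \<longlonglongrightarrow> dist (y L) X" by (intro tendsto_intros)
    moreover have "(\<lambda>n. dist ((x \<circ> f) n) X) \<longlonglongrightarrow> dist X X" by (intro tendsto_intros X(3))
    then have "(\<lambda>n. dist (y ((t \<circ> f) n)) X) \<longlonglongrightarrow> dist X X" using tendsto_cong[OF ev] by simp
    ultimately have "dist (y L) X = dist X X" by (rule LIMSEQ_unique)
    then show ?thesis by simp
  qed
  have xX: "x0 \<in> ball X r" using N(1) r0 by (simp add: x0_def dist_commute)
  have neq: "q t0 \<noteq> q L" using t0 v by (simp add: q_def)
  have "reach [] (unfold_map s0 (q t0)) (unfold_map s0 (q L))"
    using local_open_segment[OF r xX x0(2)] x0(1) \<open>y L = X\<close>[symmetric] neq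
    by (simp add: y_def open_segment_commute)
  then have "reach (s0 @ []) c (q L)"
    using x0 t0 v by (intro reach_concat) (auto simp: y_def q_def intro!: ray_open_segment)
  then have rL: "reach s0 c (q L)" by simp
  have s0S: "set s0 \<subseteq> S" using reach_sides[OF rL] .
  have uL: "unfold_map s0 (q L) = X" using \<open>y L = X\<close> by (simp add: y_def)
  have "X \<notin> Om" using LT rL uL L0 L1 by (auto simp: T_def)
  then have XB: "X \<in> Bd" using X closure_Om by (auto simp: Bd_def)
  have "L \<noteq> 1" using not XB s0S uL q1 by metis
  then have L1': "L < 1" using L1 by simp
  from XB show False
  proof (cases rule: Bd_cases)
    case 1
    have "q L \<in> open_segment c (c + v)" using ray_open_segment[OF v L0 L1'] by (simp add: q_def)
    then show False using not s0S uL 1 by blast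
  next
    case (2 e)
    define y' where "y' = 2 *\<^sub>R X - mirror e x0"
    have y': "y' \<in> Om" "y' \<in> ball X r" using reflected_Om[OF r 2 xX x0(2)] by (auto simp: y'_def)
    \<comment> \<open>With \<open>h \<le> L - t0\<close> the outgoing piece stays on the segment
      from \<open>X\<close> to \<open>y'\<close>, hence in the ball and in
      \<open>Om\<close>.\<close>
    define h where "h = min (1 - L) (L - t0)"
    have h: "0 < h" "L + h \<le> 1" "h \<le> L - t0" using L1' t0 by (auto simp: h_def)
    define w where "w = unfold_lin (s0 @ [e]) v"
    have J: "unfold_map (s0 @ [e]) (q a) = unfold_map (s0 @ [e]) c + a *\<^sub>R w" for a
      by (simp add: q_def unfold_map_ray w_def)
    have JL: "unfold_map (s0 @ [e]) (q L) = X" using uL mirror_side_open[OF 2(2)] by (simp add: unfold_map_append)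
    have mt: "unfold_map (s0 @ [e]) (q t0) = mirror e x0" using x0 by (simp add: unfold_map_append y_def)
    have "y' - X = X - mirror e x0" by (simp add: y'_def scaleR_2)
    also have "\<dots> = (L - t0) *\<^sub>R w" unfolding JL[symmetric] mt[symmetric] J by (simp add: algebra_simps)
    finally have "y' - X = (L - t0) *\<^sub>R w" .
    then have w: "w = (1 / (L - t0)) *\<^sub>R (y' - X)" using t0 by simp
    have "unfold_map (s0 @ [e]) (q (L + h)) = unfold_map (s0 @ [e]) (q L) + h *\<^sub>R w"
      unfolding J by (simp add: algebra_simps)
    then have Jh: "unfold_map (s0 @ [e]) (q (L + h)) = X + (h / (L - t0)) *\<^sub>R (y' - X)"
      unfolding JL w by simp
    have mu: "0 < h / (L - t0)" "h / (L - t0) \<le> 1" using h t0 by auto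
    have in_ball: "X + (h / (L - t0)) *\<^sub>R (y' - X) \<in> ball X r" using ray_in_ball[OF y'(2)] mu by simp
    have Om': "X + (h / (L - t0)) *\<^sub>R (y' - X) \<in> Om"
      using local_ray_Om[OF r y'(2,1) in_ball mu(1)] .
    have "reach (s0 @ [e]) c (q (L + h))"
    proof (rule reach_snocI[OF rL])
      show "q L \<in> open_segment c (q (L + h))" using ray_open_segment[OF v L0, of "L + h"] h by (simp add: q_def)
      show "open_segment (unfold_map s0 (q L)) (mirror e (unfold_map s0 (q (L + h)))) \<subseteq> Om"
        using local_open_segment[OF r in_ball Om'] Jh uL by (simp add: unfold_map_append)
    qed (use 2 uL in auto)
    then have "L + h \<in> T" using h L0 Om' Jh by (auto simp: T_def)
    then show False using TL[of "L + h"] h by simp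
  qed
qed

end

section \<open>Measurability of itineraries\<close>

definition perp :: "point \<Rightarrow> point" where
  "perp d = vector [- (d $ 2), d $ 1]"

lemma inner_perp: "w \<bullet> perp d = w $ 2 * d $ 1 - w $ 1 * d $ 2"
  by (simp add: perp_def inner_vec_def sum_2)

lemma perp_orthogonal_imp_parallel:
  assumes "w \<bullet> perp d = 0" "d \<noteq> 0"
  obtains \<beta> where "w = \<beta> *\<^sub>R d"
proof -
  have eq: "w $ 2 * d $ 1 = w $ 1 * d $ 2" using assms(1) by (simp add: inner_perp)
  show ?thesis
  proof (cases "d $ 1 = 0")
    case True
    then have "d $ 2 \<noteq> 0" using assms(2) by (auto simp: vec_eq_iff forall_2)
    then show ?thesis using eq True that[of "w $ 2 / d $ 2"] by (auto simp: vec_eq_iff forall_2)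
  next
    case False
    then show ?thesis using eq that[of "w $ 1 / d $ 1"] by (auto simp: vec_eq_iff forall_2 field_simps)
  qed
qed

lemma perp_nonzero: "d \<noteq> 0 \<Longrightarrow> perp d \<noteq> 0"
  by (auto simp: perp_def vec_eq_iff forall_2)

lemma negligible_line: "negligible {a + t *\<^sub>R w | t. True}" for a w :: point
proof (cases "w = 0")
  case True
  then have "{a + t *\<^sub>R w | t. True} = {a}" by auto
  then show ?thesis by simp
next
  case False
  have "perp w \<bullet> w = 0" by (simp add: inner_commute[of "perp w"] inner_perp)
  then have "{a + t *\<^sub>R w | t. True} \<subseteq> {x. perp w \<bullet> x = perp w \<bullet> a}"
    by (auto simp: inner_add_right)
  then show ?thesis
    using negligible_hyperplane[of "perp w" "perp w \<bullet> a"] perp_nonzero[OF False] negligible_subset by blast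
qed

lemma distr_lborel_orthogonal:
  fixes f :: "point \<Rightarrow> point"
  assumes f: "orthogonal_transformation f"
  shows "distr lborel borel f = lborel"
proof (rule lborel_eqI[symmetric])
  obtain g where g: "orthogonal_transformation g" "\<And>x. f (g x) = x" "\<And>x. g (f x) = x"
    using orthogonal_transformation_inv[OF f] orthogonal_transformation_bij[OF f]
    by (metis bij_inv_eq_iff)
  have [measurable]: "f \<in> borel_measurable borel"
    using orthogonal_transformation_linear[OF f]
    by (intro borel_measurable_continuous_onI linear_continuous_on) (simp add: linear_conv_bounded_linear)
  fix l u :: point
  assume lu: "\<And>b. b \<in> Basis \<Longrightarrow> l \<bullet> b \<le> u \<bullet> b"
  have vim: "f -` box l u = g ` box l u" using g(2,3) by (auto intro: image_eqI[of _ _ "f _"])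
  have m: "f -` box l u \<in> lmeasurable" "measure lebesgue (f -` box l u) = measure lebesgue (box l u)"
    unfolding vim using measurable_orthogonal_image[OF g(1)] measure_orthogonal_image[OF g(1)] by auto
  have "emeasure (distr lborel borel f) (box l u) = emeasure lborel (f -` box l u)"
    by (simp add: emeasure_distr)
  also have "\<dots> = emeasure lebesgue (f -` box l u)"
  proof -
    have "f -` box l u \<in> sets borel" by (rule measurable_sets_borel[of f borel]) auto
    then show ?thesis by simp
  qed
  also have "\<dots> = emeasure lebesgue (box l u)"
    using m by (simp add: emeasure_eq_measure2 fmeasurable_box)
  also have "\<dots> = (\<Prod>b\<in>Basis. (u - l) \<bullet> b)" using lu by (simp add: emeasure_lborel_box_eq)
  finally show "emeasure (distr lborel borel f) (box l u) = (\<Prod>b\<in>Basis. (u - l) \<bullet> b)" .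
qed simp

lemma unfold_lin_orthogonal: "orthogonal_transformation (unfold_lin s)"
  by (simp add: orthogonal_transformation unfold_lin_linear)

lemma continuous_unfold_lin: "continuous_on UNIV (unfold_lin s)"
  using linear_continuous_on[of "unfold_lin s" UNIV] unfold_lin_linear
  by (simp add: linear_conv_bounded_linear)

lemma borel_measurable_unfold_map [measurable]: "unfold_map s \<in> borel_measurable borel"
proof -
  have eq: "unfold_map s = (\<lambda>x. unfold_map s 0 + unfold_lin s x)"
    by (rule ext) (metis add.left_neutral unfold_map_add)
  show ?thesis
    by (subst eq) (intro borel_measurable_continuous_onI continuous_intros continuous_unfold_lin)
qed

lemma distr_lborel_unfold_map: "distr lborel borel (unfold_map s) = lborel"
proof -
  have lin [measurable]: "unfold_lin s \<in> borel_measurable borel"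
    by (rule borel_measurable_continuous_onI[OF continuous_unfold_lin])
  have "unfold_map s = (+) (unfold_map s 0) \<circ> unfold_lin s"
    by (rule ext) (metis add.left_neutral comp_apply unfold_map_add)
  then have "distr lborel borel (unfold_map s) = distr (distr lborel borel (unfold_lin s)) borel ((+) (unfold_map s 0))"
    using lin by (simp add: distr_distr)
  then show ?thesis
    by (simp add: distr_lborel_orthogonal[OF unfold_lin_orthogonal] lborel_distr_plus)
qed

lemma emeasure_unfold_map_vimage:
  assumes "A \<in> sets borel"
  shows "emeasure lborel (unfold_map s -` A) = emeasure lborel A"
  using emeasure_distr[of "unfold_map s" lborel borel A] assms by (simp add: distr_lborel_unfold_map)

context billiard_table
begin

text \<open>The junk value for a vanishing denominator is harmless: an orbit cannot hit a side that is
  parallel to it.\<close>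

definition cross :: "point \<times> point \<Rightarrow> point \<times> point \<Rightarrow> real" where
  "cross e xp = ((fst e - fst xp) \<bullet> perp (snd e - fst e)) / ((snd xp - fst xp) \<bullet> perp (snd e - fst e))"

definition cross_pt :: "point \<times> point \<Rightarrow> point \<times> point \<Rightarrow> point" where
  "cross_pt e xp = fst xp + cross e xp *\<^sub>R (snd xp - fst xp)"

definition free_seg :: "(point \<times> point) set" where
  "free_seg = {xp. open_segment (fst xp) (snd xp) \<subseteq> Om}"

text \<open>A segment is not free iff some parameter in (0, 1) hits the closed set
  \<open>- Om\<close>. Exhausting (0, 1) by compact intervals makes this a countable union of
  projections along compact sets, which are closed. The diagonal is removed because there the open
  segment is empty while the parametrization still yields a point.\<close>

lemma free_seg_borel [measurable]: "free_seg \<inter> {xp. fst xp \<noteq> snd xp} \<in> sets borel"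
proof -
  define F where "F = {z :: real \<times> (point \<times> point). fst (snd z) + fst z *\<^sub>R (snd (snd z) - fst (snd z)) \<in> - Om}"
  have "closed F"
    unfolding F_def using closed_vimage[OF closed_Compl[OF open_Om], of "\<lambda>z. fst (snd z) + fst z *\<^sub>R (snd (snd z) - fst (snd z))"]
    by (simp add: vimage_def continuous_intros)
  then have cl: "closed {y. \<exists>u. u \<in> {1 / (real n + 2)..1 - 1 / (real n + 2)} \<and> (u, y) \<in> F}" for n
    by (intro closed_compact_projection) auto
  define U where "U = (\<Union>n. {y. \<exists>u. u \<in> {1 / (real n + 2)..1 - 1 / (real n + 2)} \<and> (u, y) \<in> F})"
  have 1: "(\<forall>u. 0 < u \<and> u < 1 \<longrightarrow> (u, y) \<notin> F) \<longleftrightarrow> y \<notin> U" (is "?l y \<longleftrightarrow> ?r y") for y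
  proof
    assume l: "?l y"
    show "?r y"
    proof
      assume "y \<in> U"
      then obtain n u where u: "1 / (real n + 2) \<le> u" "u \<le> 1 - 1 / (real n + 2)" "(u, y) \<in> F"
        by (auto simp: U_def)
      have "0 < 1 / (real n + 2)" by simp
      then have "0 < u" "u < 1" using u by linarith+
      then show False using l u by blast
    qed
  next
    assume r: "?r y"
    show "?l y"
    proof (intro allI impI notI)
      fix u assume u: "0 < u \<and> u < 1" "(u, y) \<in> F"
      obtain n :: nat where n: "1 / min u (1 - u) < real n" using reals_Archimedean2 by blast
      have m: "0 < min u (1 - u)" using u by auto
      have "1 / (real n + 2) \<le> 1 / (1 / min u (1 - u))"
        using n m by (intro divide_left_mono) (auto simp: add_pos_pos)
      then have "1 / (real n + 2) \<le> min u (1 - u)" by simp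
      then have "1 / (real n + 2) \<le> u" "u \<le> 1 - 1 / (real n + 2)" by linarith+
      then show False using r u by (auto simp: U_def)
    qed
  qed
  have 2: "open_segment (fst xp) (snd xp) \<subseteq> Om \<longleftrightarrow> (\<forall>u. 0 < u \<and> u < 1 \<longrightarrow> (u, xp) \<notin> F)"
    if ne: "fst xp \<noteq> snd xp" for xp
  proof
    assume "open_segment (fst xp) (snd xp) \<subseteq> Om"
    then show "\<forall>u. 0 < u \<and> u < 1 \<longrightarrow> (u, xp) \<notin> F"
      using open_segmentI[OF _ _ ne] by (auto simp: F_def)
  next
    assume F: "\<forall>u. 0 < u \<and> u < 1 \<longrightarrow> (u, xp) \<notin> F"
    show "open_segment (fst xp) (snd xp) \<subseteq> Om"
    proof
      fix w assume "w \<in> open_segment (fst xp) (snd xp)"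
      then obtain u where "0 < u" "u < 1" "w = fst xp + u *\<^sub>R (snd xp - fst xp)" by (rule open_segmentE)
      then show "w \<in> Om" using F by (auto simp: F_def)
    qed
  qed
  have eq: "free_seg \<inter> {xp. fst xp \<noteq> snd xp} = - U \<inter> {xp. fst xp \<noteq> snd xp}"
  proof (rule set_eqI)
    fix xp show "xp \<in> free_seg \<inter> {xp. fst xp \<noteq> snd xp} \<longleftrightarrow> xp \<in> - U \<inter> {xp. fst xp \<noteq> snd xp}"
      using 1[of xp] 2[of xp] by (cases "fst xp = snd xp") (simp_all add: free_seg_def)
  qed
  have "open {xp :: point \<times> point. fst xp \<noteq> snd xp}"
    by (intro open_Collect_neq continuous_intros)
  moreover have "U \<in> sets borel"
    unfolding U_def using borel_closed[OF cl] by (intro sets.countable_UN) blast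
  ultimately show ?thesis
    unfolding eq by (intro sets.Int borel_comp) (auto intro: borel_open)
qed

text \<open>Quantifying over the bounce point would only exhibit the set of admissible pairs as a
  projection. With the bounce point computed by a Borel function, the recursion step becomes a
  preimage.\<close>

lemma reach_Cons_cross:
  "reach (e # s) x p \<longleftrightarrow> e \<in> S \<and> x \<noteq> p \<and> cross_pt e (x, p) \<in> side_open e \<and>
     0 < cross e (x, p) \<and> cross e (x, p) < 1 \<and>
     (x, cross_pt e (x, p)) \<in> free_seg \<inter> {xp. fst xp \<noteq> snd xp} \<and> reach s (cross_pt e (x, p)) (mirror e p)"
  (is "?l \<longleftrightarrow> ?r")
proof
  assume ?l
  then obtain m where m: "e \<in> S" "m \<in> side_open e" "m \<in> open_segment x p"
    "open_segment x m \<subseteq> Om" "reach s m (mirror e p)" by auto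
  obtain u where u: "0 < u" "u < 1" "m = x + u *\<^sub>R (p - x)" "x \<noteq> p" using m(3) by (rule open_segmentE)
  define d where "d = snd e - fst e"
  have d: "d \<noteq> 0" using nondegenerate[OF m(1)] by (simp add: d_def)
  obtain s' where s': "0 < s'" "s' < 1" "m = fst e + s' *\<^sub>R d"
    using open_segmentE[OF m(2)] unfolding d_def by metis
  have dp: "d \<bullet> perp d = 0" by (simp add: inner_perp)
  \<comment> \<open>An orbit parallel to the side would already be on it shortly before
    \<open>m\<close>, at distance governed by \<open>h\<close>, although it is still in
    \<open>Om\<close> there.\<close>
  have "(p - x) \<bullet> perp d \<noteq> 0"
  proof
    assume "(p - x) \<bullet> perp d = 0"
    then obtain \<beta> where b: "p - x = \<beta> *\<^sub>R d" using perp_orthogonal_imp_parallel d by metis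
    define h where "h = min (u / 2) (min s' (1 - s') / (\<bar>\<beta>\<bar> + 1))"
    have h0: "0 < h" "h < u" using u s' by (auto simp: h_def)
    have "h * \<bar>\<beta>\<bar> \<le> min s' (1 - s') / (\<bar>\<beta>\<bar> + 1) * \<bar>\<beta>\<bar>" by (intro mult_right_mono) (auto simp: h_def)
    also have "\<dots> \<le> min s' (1 - s')" using s' by (auto simp: field_simps min_def)
    finally have "\<bar>h * \<beta>\<bar> \<le> min s' (1 - s')" using h0 by (simp add: abs_mult)
    then have r: "0 \<le> s' - h * \<beta>" "s' - h * \<beta> \<le> 1" by linarith+
    have "x + (u - h) *\<^sub>R (p - x) = m - h *\<^sub>R (p - x)" using u by (simp add: algebra_simps)
    also have "\<dots> = fst e + (s' - h * \<beta>) *\<^sub>R d" using b s' by (simp add: algebra_simps)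
    finally have "x + (u - h) *\<^sub>R (p - x) \<in> side_closed e"
      using r by (auto simp: in_segment d_def algebra_simps intro!: exI[of _ "s' - h * \<beta>"])
    moreover have "x + (u - h) *\<^sub>R (p - x) \<in> open_segment x m"
      using open_segment_ray[of "p - x" 0 u x] u h0 by auto
    ultimately show False using m side_disjoint by blast
  qed
  moreover have "(fst e - x) \<bullet> perp d = u * ((p - x) \<bullet> perp d)"
  proof -
    have "fst e - x = u *\<^sub>R (p - x) - s' *\<^sub>R d" using u s' by (simp add: algebra_simps)
    then show ?thesis by (simp add: inner_diff_left dp)
  qed
  ultimately have c: "cross e (x, p) = u" by (simp add: cross_def d_def)
  then have "cross_pt e (x, p) = m" using u by (simp add: cross_pt_def)
  then show ?r using m u c by (auto simp: free_seg_def)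
next
  assume r: ?r
  have "cross_pt e (x, p) \<in> open_segment x p" using r open_segmentI[of "cross e (x, p)" x p] by (simp add: cross_pt_def)
  then show ?l using r by (auto simp: free_seg_def)
qed

lemma cross_measurable [measurable]: "cross e \<in> borel_measurable borel"
  unfolding cross_def[abs_def]
  by (intro borel_measurable_divide borel_measurable_continuous_onI continuous_intros)

lemma cross_pt_measurable [measurable]: "cross_pt e \<in> borel_measurable borel"
  unfolding cross_pt_def[abs_def]
  by (intro borel_measurable_add borel_measurable_scaleR cross_measurable borel_measurable_continuous_onI continuous_intros)

lemma side_open_borel [measurable]: "side_open e \<in> sets borel"
  unfolding open_segment_def by (intro sets.Diff borel_closed) (auto intro: finite_imp_closed)

lemma borel_pair: "f \<in> borel_measurable M \<Longrightarrow> g \<in> borel_measurable M \<Longrightarrow>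
    (\<lambda>x. (f x, g x) :: point \<times> point) \<in> borel_measurable M"
  unfolding borel_prod[symmetric] by (rule measurable_Pair)

text \<open>Measurability is joint in start and end because the recursion moves both. The slice at a
  fixed corner is taken only afterwards.\<close>

lemma reach_borel: "{xp. reach s (fst xp) (snd xp)} \<in> sets borel"
proof (induction s)
  case Nil
  have "{xp. reach [] (fst xp) (snd xp)} = free_seg \<inter> {xp. fst xp \<noteq> snd xp}" by (auto simp: free_seg_def)
  then show ?case using free_seg_borel by simp
next
  case (Cons e s)
  show ?case
  proof (cases "e \<in> S")
    case False then show ?thesis by simp
  next
    case True
    have m1: "(\<lambda>xp. (fst xp, cross_pt e xp)) \<in> borel_measurable borel"
      by (intro borel_pair cross_pt_measurable borel_measurable_continuous_onI continuous_intros)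
    have "mirror e = unfold_map [e]" by auto
    then have "mirror e \<in> borel_measurable borel" by simp
    then have "(\<lambda>xp. mirror e (snd xp)) \<in> borel_measurable (borel :: (point \<times> point) measure)"
      by (rule measurable_compose[rotated]) (intro borel_measurable_continuous_onI continuous_intros)
    then have m2: "(\<lambda>xp. (cross_pt e xp, mirror e (snd xp))) \<in> borel_measurable borel"
      by (intro borel_pair cross_pt_measurable)
    have "{xp. reach (e # s) (fst xp) (snd xp)} =
      {xp. fst xp \<noteq> snd xp} \<inter> cross_pt e -` side_open e \<inter> cross e -` {0<..<1} \<inter>
      (\<lambda>xp. (fst xp, cross_pt e xp)) -` (free_seg \<inter> {xp. fst xp \<noteq> snd xp}) \<inter>
      (\<lambda>xp. (cross_pt e xp, mirror e (snd xp))) -` {xp. reach s (fst xp) (snd xp)}"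
      unfolding reach_Cons_cross using True by auto
    also have "\<dots> \<in> sets borel"
    proof (intro sets.Int)
      show "{xp :: point \<times> point. fst xp \<noteq> snd xp} \<in> sets borel"
        by (intro borel_open open_Collect_neq continuous_intros)
    qed (use measurable_sets_borel[OF m1 free_seg_borel] measurable_sets_borel[OF m2 Cons]
        measurable_sets_borel[OF cross_pt_measurable side_open_borel]
        measurable_sets_borel[OF cross_measurable] in auto)
    finally show ?thesis .
  qed
qed

lemma reach_borel1: "{p. reach s c p} \<in> sets borel"
proof -
  have "(\<lambda>p. (c, p)) \<in> borel_measurable borel"
    by (intro borel_measurable_continuous_onI continuous_intros)
  from measurable_sets_borel[OF this reach_borel[of s]] show ?thesis by (simp add: vimage_def)
qed

end

section \<open>Counting orbits that run into corners\<close>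

context billiard_table
begin

definition directions_into :: "point \<Rightarrow> point set" where
  "directions_into c = {v. \<exists>r0>0. \<forall>r\<in>{0<..<r0}. c + r *\<^sub>R v \<in> Om}"

definition sector :: "point \<Rightarrow> real \<Rightarrow> point set" where
  "sector c l = {p. dist c p \<le> l \<and> p - c \<in> directions_into c}"

text \<open>Consists of straightened end points, not of true positions: in this form the sets for
  different itineraries tile the sector at \<open>c\<close>.\<close>

definition wavefront :: "point \<Rightarrow> real \<Rightarrow> (point \<times> point) list \<Rightarrow> point set" where
  "wavefront c l s = {p. dist c p \<le> l \<and> reach s c p \<and> unfold_map s p \<in> Om}"

definition singular :: "point \<Rightarrow> real \<Rightarrow> point set" where
  "singular z l = {u. norm u = 1 \<and> (\<exists>t s. 0 < t \<and> t \<le> l \<and> reach s z (z + t *\<^sub>R u) \<and> unfold_map s (z + t *\<^sub>R u) \<in> Cor)}"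

lemma countable_lists_S: "countable (lists S)"
  by (intro countable_lists countable_finite finite_S)

lemma wavefront_borel: "wavefront c l s \<in> sets borel"
proof -
  have "wavefront c l s = cball c l \<inter> {p. reach s c p} \<inter> unfold_map s -` Om"
    by (auto simp: wavefront_def)
  moreover have "unfold_map s -` Om \<in> sets borel"
    by (rule measurable_sets_borel[OF borel_measurable_unfold_map]) (simp add: open_Om)
  ultimately show ?thesis using reach_borel1 by auto
qed

lemma wavefront_disjoint: "disjoint_family_on (wavefront c l) (lists S)"
  unfolding disjoint_family_on_def
proof (intro ballI impI, rule ccontr)
  fix s s' assume ne: "s \<noteq> s'" "wavefront c l s \<inter> wavefront c l s' \<noteq> {}"
  then obtain p where p: "reach s c p" "unfold_map s p \<in> Om" "reach s' c p" "unfold_map s' p \<in> Om"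
    by (auto simp: wavefront_def)
  have "s = s'" by (rule reach_unique[OF p(1,3)]) (use p side_open_not_Om in blast)+
  then show False using ne by simp
qed

lemma directions_into_nonzero: "c \<notin> Om \<Longrightarrow> v \<in> directions_into c \<Longrightarrow> v \<noteq> 0"
proof
  assume c: "c \<notin> Om" "v \<in> directions_into c" "v = 0"
  then obtain r0 where "0 < r0" "\<forall>r\<in>{0<..<r0}. c + r *\<^sub>R v \<in> Om"
    unfolding directions_into_def by blast
  then show False using c dense[of 0 r0] by auto
qed

lemma reach_initial: "reach s c p \<Longrightarrow> p - c \<in> directions_into c"
proof -
  assume a: "reach s c p"
  have "\<exists>m. (m = p \<or> m \<in> open_segment c p) \<and> m \<noteq> c \<and> open_segment c m \<subseteq> Om"
  proof (cases s)
    case Nil then show ?thesis using a by auto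
  next
    case (Cons e r)
    then obtain m where "m \<in> open_segment c p" "open_segment c m \<subseteq> Om" using a by auto
    then show ?thesis by (intro exI[of _ m]) (auto simp: open_segment_def)
  qed
  then obtain m where m: "m = p \<or> m \<in> open_segment c p" "m \<noteq> c" "open_segment c m \<subseteq> Om" by blast
  obtain w where w: "0 < w" "m = c + w *\<^sub>R (p - c)"
  proof (cases "m = p")
    case True then show ?thesis using that[of 1] by simp
  next
    case False
    then have "m \<in> open_segment c p" using m by simp
    then show ?thesis using that by (metis open_segmentE)
  qed
  have "p - c \<noteq> 0" using m w by auto
  then have "open_segment c m = (\<lambda>u. c + u *\<^sub>R (p - c)) ` {0<..<w}"
    using open_segment_ray[of "p - c" 0 w c] w by simp
  then have "\<forall>r\<in>{0<..<w}. c + r *\<^sub>R (p - c) \<in> Om" using m(3) by auto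
  then show ?thesis using w(1) by (auto simp: directions_into_def)
qed

text \<open>Lines through \<open>c\<close> and an unfolded corner catch the orbits that run into a
  corner; unfolded lines of sides catch those that end on the boundary. All itineraries are
  included, followed or not, since a countable union of lines is null anyway.\<close>

definition exceptional :: "point \<Rightarrow> point set" where
  "exceptional c = (\<Union>s\<in>lists S. (\<Union>c'\<in>Cor. {c + t *\<^sub>R (unfold_map (rev s) c' - c) |t. True}) \<union>
     (\<Union>e\<in>S. {unfold_map (rev s) (fst e) + t *\<^sub>R unfold_lin (rev s) (snd e - fst e) |t. True}))"

lemma negligible_exceptional: "negligible (exceptional c)"
  unfolding exceptional_def
proof (rule negligible_countable_Union, goal_cases)
  case 1
  then show ?case using countable_lists_S by (rule countable_image)
next
  case (2 T)
  then show ?case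
    using finite_Cor finite_S by (auto intro!: negligible_Un negligible_Union negligible_line[simplified])
qed

lemma sector_subset_wavefronts:
  assumes c: "c \<notin> Om"
  shows "sector c l \<subseteq> (\<Union>s\<in>lists S. wavefront c l s) \<union> exceptional c"
proof
  fix p assume p: "p \<in> sector c l"
  then have v: "p - c \<in> directions_into c" by (simp add: sector_def)
  then obtain r0 where r0: "0 < r0" "\<forall>r\<in>{0<..<r0}. c + r *\<^sub>R (p - c) \<in> Om" by (auto simp: directions_into_def)
  have cp: "c + (p - c) = p" by simp
  have "(\<exists>s. reach s c p \<and> unfold_map s p \<in> Om) \<or>
    (\<exists>s q. set s \<subseteq> S \<and> q \<in> open_segment c p \<and> unfold_map s q \<in> Cor) \<or>
    (\<exists>s. set s \<subseteq> S \<and> unfold_map s p \<in> Bd)"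
    using billiard_total[OF r0 directions_into_nonzero[OF c v]] unfolding cp .
  then show "p \<in> (\<Union>s\<in>lists S. wavefront c l s) \<union> exceptional c"
  proof (elim disjE exE conjE)
    fix s assume "reach s c p" "unfold_map s p \<in> Om"
    then show ?thesis using p reach_sides[of s c p] by (auto simp: wavefront_def sector_def)
  next
    fix s q assume s: "set s \<subseteq> S" "q \<in> open_segment c p" "unfold_map s q \<in> Cor"
    obtain u where u: "0 < u" "u < 1" "q = c + u *\<^sub>R (p - c)" using s(2) by (rule open_segmentE)
    have "p = c + (1 / u) *\<^sub>R (q - c)" using u by simp
    moreover have "q = unfold_map (rev s) (unfold_map s q)" by simp
    ultimately have "p \<in> {c + t *\<^sub>R (unfold_map (rev s) (unfold_map s q) - c) |t. True}" by auto
    moreover have "s \<in> lists S" using s by auto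
    ultimately show ?thesis using s(3) unfolding exceptional_def by blast
  next
    fix s assume s: "set s \<subseteq> S" "unfold_map s p \<in> Bd"
    then obtain e where e: "e \<in> S" "unfold_map s p \<in> side_closed e" by (auto simp: Bd_def)
    then obtain t where "unfold_map s p = fst e + t *\<^sub>R (snd e - fst e)"
      by (auto simp: in_segment algebra_simps)
    then have "p = unfold_map (rev s) (fst e) + t *\<^sub>R unfold_lin (rev s) (snd e - fst e)"
      by (metis unfold_map_ray unfold_map_rev)
    then have line: "p \<in> {unfold_map (rev s) (fst e) + t *\<^sub>R unfold_lin (rev s) (snd e - fst e) |t. True}"
      by blast
    have sl: "s \<in> lists S" using s by auto
    have "p \<in> exceptional c"
      unfolding exceptional_def by (rule UN_I[OF sl], rule UnI2, rule UN_I[OF e(1)], rule line)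
    then show ?thesis by (rule UnI2)
  qed
qed

lemma wavefronts_subset_sector: "(\<Union>s\<in>lists S. wavefront c l s) \<subseteq> sector c l"
  using reach_initial by (auto simp: wavefront_def sector_def)

lemma wavefronts_borel: "(\<Union>s\<in>lists S. wavefront c l s) \<in> sets borel"
  using countable_lists_S wavefront_borel by (intro sets.countable_UN') auto

text \<open>Borel measurability is established only for the wavefronts. The sector is compared with
  them up to a null set and is therefore measured by \<open>lebesgue\<close> rather than
  \<open>lborel\<close>.\<close>

lemma sector_wavefronts:
  assumes "c \<notin> Om"
  obtains N where "N \<in> null_sets lebesgue" "sector c l = (\<Union>s\<in>lists S. wavefront c l s) \<union> N"
proof
  let ?N = "sector c l - (\<Union>s\<in>lists S. wavefront c l s)"
  have "?N \<subseteq> exceptional c" using sector_subset_wavefronts[OF assms] by blast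
  then show "?N \<in> null_sets lebesgue"
    using negligible_subset[OF negligible_exceptional] by (simp flip: negligible_iff_null_sets)
  show "sector c l = (\<Union>s\<in>lists S. wavefront c l s) \<union> ?N" using wavefronts_subset_sector by blast
qed

lemma sector_measurable:
  assumes "c \<notin> Om" shows "sector c l \<in> sets lebesgue"
proof -
  obtain N where N: "N \<in> null_sets lebesgue" "sector c l = (\<Union>s\<in>lists S. wavefront c l s) \<union> N"
    using sector_wavefronts[OF assms] .
  show ?thesis unfolding N(2) using N(1) wavefronts_borel by (intro sets.Un) auto
qed

lemma emeasure_sector:
  assumes "c \<notin> Om"
  shows "emeasure lebesgue (sector c l) = emeasure lborel (\<Union>s\<in>lists S. wavefront c l s)"
proof -
  obtain N where N: "N \<in> null_sets lebesgue" "sector c l = (\<Union>s\<in>lists S. wavefront c l s) \<union> N"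
    using sector_wavefronts[OF assms] .
  have "emeasure lebesgue (sector c l) = emeasure lebesgue (\<Union>s\<in>lists S. wavefront c l s)"
    unfolding N(2) using wavefronts_borel by (intro emeasure_Un_null_set N(1)) auto
  then show ?thesis using wavefronts_borel[of c l] by simp
qed

section \<open>Orbits from a variable point into a fixed corner\<close>

definition backward :: "point \<Rightarrow> real \<Rightarrow> (point \<times> point) list \<Rightarrow> point set" where
  "backward c l s = unfold_map s -` wavefront c l (rev s)"

lemma backward_borel: "backward c l s \<in> sets borel"
  unfolding backward_def by (rule measurable_sets_borel[OF borel_measurable_unfold_map wavefront_borel])

text \<open>Time reversal in the form used for integration: \<open>backward c l s\<close> is an
  isometric copy of a wavefront at \<open>c\<close>, yet it describes orbits that start at
  \<open>z\<close> and end at \<open>c\<close>.\<close>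

lemma mem_backward:
  "z \<in> backward c l s \<longleftrightarrow> z \<in> Om \<and> dist z (unfold_map (rev s) c) \<le> l \<and> reach s z (unfold_map (rev s) c)"
proof -
  have "reach s z (unfold_map (rev s) c) \<longleftrightarrow> reach (rev s) c (unfold_map s z)"
    using reach_rev_iff[of s "unfold_map (rev s) c" z] by simp
  moreover have "dist z (unfold_map (rev s) c) = dist c (unfold_map s z)"
    using dist_unfold_map[of s z "unfold_map (rev s) c"] by (simp add: dist_commute)
  ultimately show ?thesis by (auto simp: backward_def wavefront_def)
qed

definition hits :: "point \<Rightarrow> real \<Rightarrow> point \<Rightarrow> (point \<times> point) list set" where
  "hits c l z = {s \<in> lists S. z \<in> backward c l s}"

text \<open>Counting measure instead of \<open>card\<close>, so that infinitely many orbits count as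
  infinity and not as 0.\<close>

definition hit_count :: "real \<Rightarrow> point \<Rightarrow> ennreal" where
  "hit_count l z = (\<Sum>c\<in>Cor. emeasure (count_space (lists S)) (hits c l z))"

lemma hits_integral:
  "emeasure (count_space (lists S)) (hits c l z) = (\<integral>\<^sup>+s. indicator (backward c l s) z \<partial>count_space (lists S))"
proof -
  have "(\<integral>\<^sup>+s. indicator (backward c l s) z \<partial>count_space (lists S)) =
    (\<integral>\<^sup>+s. indicator (hits c l z) s \<partial>count_space (lists S))"
    by (intro nn_integral_cong) (auto simp: hits_def indicator_def)
  also have "\<dots> = emeasure (count_space (lists S)) (hits c l z)"
    by (intro nn_integral_indicator) (auto simp: hits_def)
  finally show ?thesis by simp
qed

lemma hits_measurable: "(\<lambda>z. emeasure (count_space (lists S)) (hits c l z)) \<in> borel_measurable lborel"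
  unfolding hits_integral
proof -
  have "(\<lambda>z. \<integral>\<^sup>+s. indicator (backward c l s) z \<partial>count_space (lists S)) \<in> borel_measurable borel"
  proof (rule sigma_finite_measure.borel_measurable_nn_integral)
    show "sigma_finite_measure (count_space (lists S))"
      by (rule sigma_finite_measure_count_space_countable[OF countable_lists_S])
    have "(\<lambda>zs. indicator (backward c l (snd zs)) (fst zs) :: ennreal) \<in> borel_measurable (borel \<Otimes>\<^sub>M count_space (lists S))"
    proof (rule measurable_compose_countable'[where f = "\<lambda>s zs. indicator (backward c l s) (fst zs)" and g = snd and I = "lists S"])
      fix s
      have "indicator (backward c l s) \<in> borel_measurable borel"
        using backward_borel by simp
      then show "(\<lambda>zs. indicator (backward c l s) (fst zs) :: ennreal) \<in> borel_measurable (borel \<Otimes>\<^sub>M count_space (lists S))"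
        by (rule measurable_compose[OF measurable_fst])
    qed (auto intro: countable_lists_S)
    then show "(\<lambda>(z, s). indicator (backward c l s) z :: ennreal) \<in> borel_measurable (borel \<Otimes>\<^sub>M count_space (lists S))"
      by (simp add: case_prod_beta')
  qed
  then show "(\<lambda>z. \<integral>\<^sup>+s. indicator (backward c l s) z \<partial>count_space (lists S)) \<in> borel_measurable lborel"
    by simp
qed

text \<open>Tonelli exchanges the integral over starting points with the sum over itineraries. Each
  summand is the area of a wavefront because unfolding preserves area; reversal permutes the
  itineraries, and the disjoint wavefronts fill the sector.\<close>

lemma integral_hits:
  assumes "c \<notin> Om"
  shows "(\<integral>\<^sup>+z. emeasure (count_space (lists S)) (hits c l z) \<partial>lborel) = emeasure lebesgue (sector c l)"
proof -
  have "(\<integral>\<^sup>+z. emeasure (count_space (lists S)) (hits c l z) \<partial>lborel) =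
     (\<integral>\<^sup>+s. \<integral>\<^sup>+z. indicator (backward c l s) z \<partial>lborel \<partial>count_space (lists S))"
    unfolding hits_integral using backward_borel
    by (intro nn_integral_count_space_nn_integral countable_lists_S) auto
  also have "\<dots> = (\<integral>\<^sup>+s. emeasure lborel (wavefront c l (rev s)) \<partial>count_space (lists S))"
    using backward_borel emeasure_unfold_map_vimage[OF wavefront_borel]
    by (intro nn_integral_cong) (simp add: backward_def)
  also have "\<dots> = (\<integral>\<^sup>+s. emeasure lborel (wavefront c l s) \<partial>count_space (lists S))"
    by (rule nn_integral_bij_count_space)
       (auto intro!: bij_betw_byWitness[of _ rev] simp: in_lists_conv_set)
  also have "\<dots> = emeasure lborel (\<Union>s\<in>lists S. wavefront c l s)"
    using wavefront_borel countable_lists_S wavefront_disjoint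
    by (intro emeasure_UN_countable[symmetric]) auto
  finally show ?thesis by (simp add: emeasure_sector[OF assms])
qed

lemma hit_count_measurable: "hit_count l \<in> borel_measurable lborel"
  unfolding hit_count_def[abs_def] by (intro borel_measurable_sum hits_measurable)

lemma integral_hit_count: "(\<integral>\<^sup>+z. hit_count l z \<partial>lborel) = (\<Sum>c\<in>Cor. emeasure lebesgue (sector c l))"
  unfolding hit_count_def using hits_measurable
  by (subst nn_integral_sum) (auto intro!: sum.cong integral_hits simp: corner_not_Om)

lemma emeasure_sector_finite:
  assumes "c \<notin> Om" shows "emeasure lebesgue (sector c l) < \<infinity>"
proof -
  have "emeasure lebesgue (sector c l) \<le> emeasure lebesgue (cball c l)"
    by (intro emeasure_mono) (auto simp: sector_def)
  also have "\<dots> < \<infinity>"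
    using fmeasurableD2[of "cball c l" lebesgue] by (simp add: top.not_eq_extremum)
  finally show ?thesis .
qed

definition direction :: "point \<Rightarrow> point \<times> (point \<times> point) list \<Rightarrow> point" where
  "direction z cs = (1 / dist z (unfold_map (rev (snd cs)) (fst cs))) *\<^sub>R (unfold_map (rev (snd cs)) (fst cs) - z)"

lemma singular_eq:
  assumes "z \<in> Om"
  shows "singular z l = direction z ` (SIGMA c:Cor. hits c l z)"
proof (intro set_eqI iffI)
  fix u assume "u \<in> singular z l"
  then obtain t s where u: "norm u = 1" "0 < t" "t \<le> l" "reach s z (z + t *\<^sub>R u)" "unfold_map s (z + t *\<^sub>R u) \<in> Cor"
    by (auto simp: singular_def)
  define c where "c = unfold_map s (z + t *\<^sub>R u)"
  have p: "unfold_map (rev s) c = z + t *\<^sub>R u" by (simp add: c_def)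
  have d: "dist z (z + t *\<^sub>R u) = t" using u by (simp add: dist_norm)
  have "direction z (c, s) = u" using u by (simp add: direction_def p d)
  moreover have "(c, s) \<in> (SIGMA c:Cor. hits c l z)"
    using u assms reach_sides[OF u(4)] by (auto simp: hits_def mem_backward p d c_def[symmetric])
  ultimately show "u \<in> direction z ` (SIGMA c:Cor. hits c l z)" by force
next
  fix u assume "u \<in> direction z ` (SIGMA c:Cor. hits c l z)"
  then obtain c s where cs: "c \<in> Cor" "s \<in> hits c l z" "u = direction z (c, s)" by auto
  define p where "p = unfold_map (rev s) c"
  have r: "reach s z p" "dist z p \<le> l" using cs by (auto simp: hits_def mem_backward p_def)
  have "z \<noteq> p" using reach_neq[OF r(1)] .
  then have "norm u = 1" "z + dist z p *\<^sub>R u = p"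
    by (auto simp: cs direction_def p_def[symmetric] dist_norm norm_minus_commute)
  moreover have "unfold_map s p \<in> Cor" using cs by (simp add: p_def)
  ultimately show "u \<in> singular z l" using r \<open>z \<noteq> p\<close>
    unfolding singular_def by (auto intro!: exI[of _ "dist z p"] exI[of _ s])
qed

text \<open>Suppose two orbits into corners have the same initial direction. If one is shorter, its
  end would be in \<open>Om\<close> by \<open>reach_prefix\<close>, which is impossible for a
  corner. If they are equally long, \<open>reach_unique\<close> identifies them.\<close>

lemma direction_inj:
  assumes "z \<in> Om"
  shows "inj_on (direction z) (SIGMA c:Cor. hits c l z)"
proof (rule inj_onI, clarify)
  have le: "dist z (unfold_map (rev s) c) \<ge> dist z (unfold_map (rev s') c')"
    if "c \<in> Cor" "s \<in> hits c l z" "s' \<in> hits c' l z" "direction z (c, s) = direction z (c', s')"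
    for c s c' s'
  proof (rule ccontr)
    define p where "p = unfold_map (rev s) c"
    define p' where "p' = unfold_map (rev s') c'"
    have r: "reach s z p" "reach s' z p'" using that by (auto simp: hits_def mem_backward p_def p'_def)
    have ne: "z \<noteq> p" "z \<noteq> p'" using r reach_neq by blast+
    assume "\<not> ?thesis"
    then have lt: "dist z p < dist z p'" by (simp add: p_def p'_def)
    have "(1 / dist z p) *\<^sub>R (p - z) = (1 / dist z p') *\<^sub>R (p' - z)"
      using that(4) by (simp add: direction_def p_def p'_def)
    then have "dist z p *\<^sub>R ((1 / dist z p) *\<^sub>R (p - z)) = dist z p *\<^sub>R ((1 / dist z p') *\<^sub>R (p' - z))" by simp
    then have "p = z + (dist z p / dist z p') *\<^sub>R (p' - z)" using ne by simp (metis add_diff_cancel_left' diff_add_cancel add.commute)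
    moreover have "0 < dist z p / dist z p'" "dist z p / dist z p' < 1" using lt ne by auto
    ultimately have "p \<in> open_segment z p'" using open_segmentI ne by metis
    moreover have "unfold_map s p = c" by (simp add: p_def)
    ultimately have "c \<in> Om" using reach_prefix[OF r] corner_not_open[OF that(1)] by auto
    then show False using corner_not_Om that(1) by blast
  qed
  fix c s c' s'
  assume cs: "c \<in> Cor" "s \<in> hits c l z" "c' \<in> Cor" "s' \<in> hits c' l z" "direction z (c, s) = direction z (c', s')"
  define p where "p = unfold_map (rev s) c"
  define p' where "p' = unfold_map (rev s') c'"
  have r: "reach s z p" "reach s' z p'" using cs by (auto simp: hits_def mem_backward p_def p'_def)
  have "dist z p = dist z p'" using le[of c s s' c'] le[of c' s' s c] cs by (simp add: p_def p'_def)
  moreover have "(1 / dist z p) *\<^sub>R (p - z) = (1 / dist z p') *\<^sub>R (p' - z)"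
    using cs(5) by (simp add: direction_def p_def p'_def)
  ultimately have pp: "p = p'" using reach_neq[OF r(1)] reach_neq[OF r(2)] by simp
  have "unfold_map s' p' = c'" by (simp add: p'_def)
  then have c': "unfold_map s' p = c'" by (simp add: pp)
  have c: "unfold_map s p = c" by (simp add: p_def)
  have "s = s'" using reach_unique[OF r(1)] r(2) pp c c' corner_not_open cs by metis
  then show "c = c' \<and> s = s'" using c c' by simp
qed

lemma hit_count_eq_card:
  assumes "z \<in> Om" "hit_count l z \<noteq> \<infinity>"
  shows "finite (singular z l)" "hit_count l z = of_nat (card (singular z l))"
proof -
  have "finite (hits c l z)" if "c \<in> Cor" for c
  proof (rule ccontr)
    assume "infinite (hits c l z)"
    then have "emeasure (count_space (lists S)) (hits c l z) = \<infinity>"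
      by (simp add: emeasure_count_space hits_def)
    then have "hit_count l z = \<infinity>" using that finite_Cor unfolding hit_count_def
      by (auto simp: ennreal_sum_eq_top)
    then show False using assms by simp
  qed
  then have fin: "finite (SIGMA c:Cor. hits c l z)" and
    m: "hit_count l z = (\<Sum>c\<in>Cor. of_nat (card (hits c l z)))"
    using finite_Cor by (auto simp: hit_count_def hits_def emeasure_count_space intro!: sum.cong)
  show "finite (singular z l)" using fin by (simp add: singular_eq[OF assms(1)])
  have "card (singular z l) = (\<Sum>c\<in>Cor. card (hits c l z))"
    unfolding singular_eq[OF assms(1)] card_image[OF direction_inj[OF assms(1)]]
    using finite_Cor \<open>\<And>c. c \<in> Cor \<Longrightarrow> finite (hits c l z)\<close> by (intro card_SigmaI) auto
  then show "hit_count l z = of_nat (card (singular z l))" by (simp add: m)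
qed

lemma hit_count_outside: "z \<notin> Om \<Longrightarrow> hit_count l z = 0"
  by (simp add: hit_count_def hits_def mem_backward)

text \<open>Sectors are bounded, so \<open>hit_count\<close> has finite integral and is finite
  almost everywhere; at such points it is the cardinality.\<close>

theorem counting_integral:
  shows "AE z in lborel. z \<in> Om \<longrightarrow> finite (singular z l)"
    and "(\<integral>\<^sup>+z. indicator Om z * of_nat (card (singular z l)) \<partial>lborel) = (\<Sum>c\<in>Cor. emeasure lebesgue (sector c l))"
proof -
  have "(\<integral>\<^sup>+z. hit_count l z \<partial>lborel) \<noteq> \<infinity>"
    unfolding integral_hit_count using finite_Cor emeasure_sector_finite corner_not_Om
    by (simp add: ennreal_sum_less_top less_top[symmetric])
  then have AE: "AE z in lborel. hit_count l z \<noteq> \<infinity>"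
    by (intro nn_integral_noteq_infinite hit_count_measurable)
  then show "AE z in lborel. z \<in> Om \<longrightarrow> finite (singular z l)"
    by eventually_elim (use hit_count_eq_card in blast)
  have "AE z in lborel. indicator Om z * of_nat (card (singular z l)) = hit_count l z"
    using AE by eventually_elim (use hit_count_eq_card hit_count_outside in \<open>auto simp: indicator_def\<close>)
  then have "(\<integral>\<^sup>+z. indicator Om z * of_nat (card (singular z l)) \<partial>lborel) = (\<integral>\<^sup>+z. hit_count l z \<partial>lborel)"
    by (rule nn_integral_cong_AE)
  then show "(\<integral>\<^sup>+z. indicator Om z * of_nat (card (singular z l)) \<partial>lborel) = (\<Sum>c\<in>Cor. emeasure lebesgue (sector c l))"
    by (simp add: integral_hit_count)
qed

section \<open>Sector areas scale with the square of the radius\<close>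

lemma directions_into_scale:
  assumes "0 < a" "v \<in> directions_into c" shows "a *\<^sub>R v \<in> directions_into c"
proof -
  obtain r0 where r0: "0 < r0" "\<forall>r\<in>{0<..<r0}. c + r *\<^sub>R v \<in> Om" using assms by (auto simp: directions_into_def)
  have "\<forall>r\<in>{0<..<r0 / a}. c + (r * a) *\<^sub>R v \<in> Om" using r0 assms by (auto simp: pos_less_divide_eq)
  then show ?thesis using r0 assms by (auto simp: directions_into_def intro!: exI[of _ "r0 / a"])
qed

lemma sector_affine:
  assumes "0 < l"
  shows "sector c l = (\<lambda>x. l *\<^sub>R x + c) ` (directions_into c \<inter> cball 0 1)"
proof (intro set_eqI iffI)
  fix p assume p: "p \<in> sector c l"
  then have "(1 / l) *\<^sub>R (p - c) \<in> directions_into c" using assms by (auto simp: sector_def intro: directions_into_scale)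
  moreover have "norm ((1 / l) *\<^sub>R (p - c)) \<le> 1"
    using p assms by (simp add: sector_def dist_norm norm_minus_commute)
  moreover have "p = l *\<^sub>R ((1 / l) *\<^sub>R (p - c)) + c" using assms by simp
  ultimately show "p \<in> (\<lambda>x. l *\<^sub>R x + c) ` (directions_into c \<inter> cball 0 1)" by (intro image_eqI) auto
next
  fix p assume "p \<in> (\<lambda>x. l *\<^sub>R x + c) ` (directions_into c \<inter> cball 0 1)"
  then obtain x where x: "x \<in> directions_into c" "norm x \<le> 1" "p = l *\<^sub>R x + c" by auto
  have "l * norm x \<le> l * 1" using x assms by (intro mult_left_mono) auto
  then show "p \<in> sector c l" using x assms directions_into_scale[OF assms x(1)] by (auto simp: sector_def dist_norm)
qed

lemma directions_into_measurable:
  assumes "c \<notin> Om"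
  shows "directions_into c \<inter> cball 0 1 \<in> lmeasurable"
proof -
  have "sector c 1 \<in> lmeasurable"
    using sector_measurable[OF assms] emeasure_sector_finite[OF assms] by (simp add: fmeasurable_def)
  then have "(+) (- c) ` sector c 1 \<in> lmeasurable" by (rule measurable_translation)
  moreover have "(+) (- c) ` sector c 1 = directions_into c \<inter> cball 0 1"
    unfolding sector_affine[OF zero_less_one] by (auto simp: image_image)
  ultimately show ?thesis by simp
qed

lemma emeasure_sector_eq:
  assumes "c \<notin> Om" "0 < l"
  shows "emeasure lebesgue (sector c l) = ennreal (l\<^sup>2 * measure lebesgue (directions_into c \<inter> cball 0 1))"
proof -
  let ?A = "directions_into c \<inter> cball 0 1"
  have "emeasure lebesgue ?A = ennreal (measure lebesgue ?A)"
    using fmeasurableD2[OF directions_into_measurable[OF assms(1)]] by (intro emeasure_eq_ennreal_measure) auto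
  moreover have "emeasure lebesgue (sector c l) = ennreal (l\<^sup>2) * emeasure lebesgue ?A"
    unfolding sector_affine[OF assms(2)] emeasure_lebesgue_affine by (simp add: ennreal_power)
  ultimately show ?thesis by (simp only: ennreal_mult zero_le_power2 measure_nonneg)
qed

end

section \<open>Turning number of a closed polygon\<close>

definition ang :: "complex \<Rightarrow> complex \<Rightarrow> real" where
  "ang a b = Arg (b / a)"

lemma ang_minus: "ang (- a) (- b) = ang a b"
  by (simp add: ang_def)

text \<open>\<open>w\<close> rotates a common half plane into the right half plane, where
  \<open>Arg\<close> is free of jumps. There angles are differences of one function and hence
  additive.\<close>

lemma ang_halfplane:
  assumes "0 < Re (w * a)" "0 < Re (w * b)"
  shows "ang a b = Arg (w * b) - Arg (w * a)" "\<bar>ang a b\<bar> < pi"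
proof -
  have ne: "w * a \<noteq> 0" "w * b \<noteq> 0" using assms by auto
  have "\<bar>Arg (w * a)\<bar> < pi / 2" "\<bar>Arg (w * b)\<bar> < pi / 2"
    using assms unfolding Arg_Re_pos by blast+
  then have r: "\<bar>Arg (w * b) - Arg (w * a)\<bar> < pi" by linarith
  then have "Arg ((w * b) / (w * a)) = Arg (w * b) - Arg (w * a)"
    using ne by (subst Arg_divide') (auto simp: abs_less_iff)
  moreover have "(w * b) / (w * a) = b / a" using ne by simp
  ultimately show "ang a b = Arg (w * b) - Arg (w * a)" by (simp add: ang_def)
  then show "\<bar>ang a b\<bar> < pi" using r by simp
qed

lemma ang_add:
  assumes "0 < Re (w * a)" "0 < Re (w * b)" "0 < Re (w * c)"
  shows "ang a b + ang b c = ang a c"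
  unfolding ang_halfplane(1)[OF assms(1,2)] ang_halfplane(1)[OF assms(2,3)] ang_halfplane(1)[OF assms(1,3)]
  by simp

lemma convex_halfplane:
  assumes "convex H" "closed H" "0 \<notin> H" "H \<noteq> {}"
  obtains w :: complex where "\<And>x. x \<in> H \<Longrightarrow> 0 < Re (w * x)"
proof -
  obtain a b where "a \<noteq> 0" "0 < b" "\<And>x. x \<in> H \<Longrightarrow> b < a \<bullet> x"
    using separating_hyperplane_closed_0[of H] assms by metis
  then show ?thesis using that[of "cnj a"] by (fastforce simp: inner_complex_def)
qed

text \<open>The chords from a point of the first segment to a point of the second form a closed
  convex set without 0, so they lie in a half plane. Thus the total change of chord direction around
  the parameter square is 0.\<close>

lemma ang_cell:
  assumes "closed_segment a b \<inter> closed_segment c d = {}"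
  shows "ang (c - a) (d - a) + ang (d - a) (d - b) = ang (c - a) (c - b) + ang (c - b) (d - b)"
proof -
  define H where "H = (\<Union>y\<in>closed_segment c d. \<Union>x\<in>closed_segment a b. {y - x})"
  have cv: "convex H" unfolding H_def by (intro convex_differences convex_closed_segment)
  have "H = {y - x | y x. y \<in> closed_segment c d \<and> x \<in> closed_segment a b}" unfolding H_def by blast
  then have cl: "closed H"
    using compact_differences[of "closed_segment c d" "closed_segment a b"] by (simp add: compact_imp_closed)
  have z: "0 \<notin> H" using assms by (auto simp: H_def)
  have e: "H \<noteq> {}" by (auto simp: H_def)
  obtain w where w: "\<And>x. x \<in> H \<Longrightarrow> 0 < Re (w * x)" using convex_halfplane[OF cv cl z e] by blast
  have mem: "y - x \<in> H" if "y \<in> closed_segment c d" "x \<in> closed_segment a b" for x y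
    using that unfolding H_def by blast
  have *: "0 < Re (w * (c - a))" "0 < Re (w * (d - a))" "0 < Re (w * (c - b))" "0 < Re (w * (d - b))"
    by (rule w[OF mem]; rule ends_in_segment)+
  show ?thesis
    unfolding ang_halfplane(1)[OF *(1,2)] ang_halfplane(1)[OF *(2,4)] ang_halfplane(1)[OF *(1,3)] ang_halfplane(1)[OF *(3,4)]
    by simp
qed

text \<open>If \<open>b - a\<close> and \<open>c - b\<close> were opposite, the two sides would
  overlap beyond \<open>b\<close>. So the segment between these two vectors misses 0 and lies in a
  half plane, which then contains their sum \<open>c - a\<close>.\<close>

lemma adjacent_halfplane:
  assumes seg: "closed_segment a b \<inter> closed_segment b c = {b}" and "a \<noteq> b" "b \<noteq> c"
  obtains w where "0 < Re (w * (b - a))" "0 < Re (w * (c - b))" "0 < Re (w * (c - a))"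
proof -
  have "0 \<notin> closed_segment (b - a) (c - b)"
  proof
    assume "0 \<in> closed_segment (b - a) (c - b)"
    then obtain u where u: "0 \<le> u" "u \<le> 1" "(1 - u) *\<^sub>R (b - a) + u *\<^sub>R (c - b) = 0"
      by (auto simp: in_segment)
    have u0: "0 < u" using u assms by (cases "u = 0") auto
    have u1: "u < 1" using u assms by (cases "u = 1") auto
    let ?y = "b + u *\<^sub>R (c - b)"
    have "?y \<in> closed_segment b c" using u by (auto simp: in_segment algebra_simps intro!: exI[of _ u])
    moreover have "u *\<^sub>R (c - b) = - ((1 - u) *\<^sub>R (b - a))" using u(3) by (simp add: add_eq_0_iff)
    then have "?y = (1 - u) *\<^sub>R a + u *\<^sub>R b" by (simp add: algebra_simps)
    then have "?y \<in> closed_segment a b" using u by (auto simp: in_segment)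
    ultimately have "?y = b" using seg by blast
    then show False using u0 assms by simp
  qed
  then obtain w where w: "\<And>x. x \<in> closed_segment (b - a) (c - b) \<Longrightarrow> 0 < Re (w * x)"
    using convex_halfplane[of "closed_segment (b - a) (c - b)"] by auto
  have *: "0 < Re (w * (b - a))" "0 < Re (w * (c - b))" by (rule w; simp)+
  moreover have "w * (c - a) = w * (b - a) + w * (c - b)" by (simp add: algebra_simps)
  then have "0 < Re (w * (c - a))" using * by simp
  ultimately show ?thesis using that by blast
qed

lemma cis_ang:
  assumes "a \<noteq> 0" "b \<noteq> 0"
  shows "cis (ang a b) = sgn b / sgn a"
  using assms by (simp add: ang_def cis_Arg sgn_divide)

text \<open>Vertices form a periodic sequence on all naturals, so that any corner can be made number
  0 by a shift. The bounds in \<open>apart\<close> say that the sides are neither equal nor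
  neighbours cyclically.\<close>

locale cyclic_polygon =
  fixes v :: "nat \<Rightarrow> complex" and n :: nat
  assumes n3: "3 \<le> n"
    and periodic: "v (i + n) = v i"
    and vertex_neq: "v i \<noteq> v (Suc i)"
    and adjacent: "closed_segment (v i) (v (Suc i)) \<inter> closed_segment (v (Suc i)) (v (Suc (Suc i))) = {v (Suc i)}"
    and apart: "Suc i < j \<Longrightarrow> Suc j < i + n \<Longrightarrow>
      closed_segment (v i) (v (Suc i)) \<inter> closed_segment (v j) (v (Suc j)) = {}"
begin

definition edge :: "nat \<Rightarrow> complex" where "edge i = v (Suc i) - v i"

definition turn :: "nat \<Rightarrow> real" where "turn i = ang (edge i) (edge (Suc i))"

text \<open>\<open>hor\<close> and \<open>ver\<close> are the changes of direction of the chord from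
  \<open>v i\<close> to \<open>v j\<close> when \<open>j\<close>, respectively \<open>i\<close>,
  increases by one: the steps along rows and columns of the grid of pairs (i, j) in the discrete
  Hopf argument.\<close>

definition hor :: "nat \<Rightarrow> nat \<Rightarrow> real" where "hor i j = ang (v j - v i) (v (Suc j) - v i)"

definition ver :: "nat \<Rightarrow> nat \<Rightarrow> real" where "ver i j = ang (v j - v i) (v j - v (Suc i))"

text \<open>The angle that the curve from \<open>v 1\<close> to \<open>v (n - 1)\<close> sweeps as seen from \<open>v 0\<close>.\<close>

definition sweep :: real where "sweep = (\<Sum>j=1..<n-1. hor 0 j)"

lemma vn: "v n = v 0" "v (Suc n) = v 1" using periodic[of 0] periodic[of 1] by simp_all

lemma shifted: "cyclic_polygon (\<lambda>i. v (i + k)) n"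
proof
  show "3 \<le> n" by (rule n3)
  show "v (i + n + k) = v (i + k)" for i using periodic[of "i + k"] by (simp add: ac_simps)
qed (use vertex_neq adjacent apart in auto)

lemma edge_periodic: "edge (i + n) = edge i"
  using periodic[of i] periodic[of "Suc i"] by (simp add: edge_def)

lemma turn_periodic: "turn (i + n) = turn i"
  using edge_periodic[of i] edge_periodic[of "Suc i"] by (simp add: turn_def)

lemma edge_nonzero: "edge i \<noteq> 0" using vertex_neq[of i] by (simp add: edge_def)

lemma vertex_distinct:
  assumes "i < j" "j < i + n" shows "v i \<noteq> v j"
proof -
  consider "j = Suc i" | "Suc i < j" "Suc j < i + n" | "i + n = Suc j" using assms by linarith
  then show ?thesis
  proof cases
    case 1 then show ?thesis using vertex_neq by simp
  next
    case 2 then show ?thesis using apart[of i j] by (metis disjoint_iff ends_in_segment(1))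
  next
    case 3 then show ?thesis using vertex_neq[of j] periodic[of i] by auto
  qed
qed

lemma turn_bound: "\<bar>turn i\<bar> < pi"
proof -
  obtain w where "0 < Re (w * edge i)" "0 < Re (w * edge (Suc i))"
    using adjacent_halfplane[OF adjacent[of i] vertex_neq vertex_neq] unfolding edge_def by metis
  then show ?thesis unfolding turn_def by (rule ang_halfplane)
qed

lemma cell: "Suc i < j \<Longrightarrow> Suc j < i + n \<Longrightarrow> hor i j + ver i (Suc j) = ver i j + hor (Suc i) j"
  using ang_cell[OF apart[of i j]] by (simp add: hor_def ver_def)

text \<open>The grid cells along the diagonal are triangles, since the chord from a vertex to itself
  has no direction. Their two legs add up to the turn between consecutive sides.\<close>

lemma triangle_cell: "hor i (Suc i) + ver i (Suc (Suc i)) = turn i"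
proof -
  obtain w where w: "0 < Re (w * (v (Suc i) - v i))" "0 < Re (w * (v (Suc (Suc i)) - v (Suc i)))"
      "0 < Re (w * (v (Suc (Suc i)) - v i))"
    using adjacent_halfplane[OF adjacent[of i] vertex_neq vertex_neq] by metis
  then show ?thesis
    using ang_add[OF w(1,3,2)] by (simp add: hor_def ver_def turn_def edge_def)
qed

text \<open>At the pair (0, n - 1) the vertices are \<open>v n\<close>, \<open>v (n - 1)\<close> and
  \<open>v (Suc n)\<close>, so this is \<open>triangle_cell\<close> for index \<open>n - 1\<close>
  with all chords reversed, which does not affect angles.\<close>

lemma corner_cell: "ver 0 (n - 1) + hor 1 (n - 1) = turn (n - 1)"
proof -
  have n: "Suc (n - 1) = n" "Suc (Suc (n - 1)) = Suc n" using n3 by auto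
  have "ver 0 (n - 1) = ang (v n - v (n - 1)) (v (Suc n) - v (n - 1))"
    using ang_minus[of "v n - v (n - 1)" "v (Suc n) - v (n - 1)"] by (simp add: ver_def vn)
  moreover have "hor 1 (n - 1) = ang (v (Suc n) - v (n - 1)) (v (Suc n) - v n)"
    using ang_minus[of "v (Suc n) - v (n - 1)" "v (Suc n) - v n"] n by (simp add: hor_def vn)
  ultimately show ?thesis
    using triangle_cell[of "n - 1"] unfolding hor_def ver_def n by simp
qed

text \<open>The path along the diagonal is deformed, cell by cell, to the one that runs along row 0
  and then down column \<open>Suc m\<close>. In the step the column moves one place to the
  right.\<close>

lemma turn_partial_sum:
  assumes "m \<le> n - 2"
  shows "(\<Sum>i<m. turn i) = (\<Sum>j=1..<Suc m. hor 0 j) + (\<Sum>i<m. ver i (Suc m))"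
  using assms
proof (induction m)
  case (Suc m)
  have shift: "(\<Sum>i<k. ver i (Suc m)) = hor 0 (Suc m) - hor k (Suc m) + (\<Sum>i<k. ver i (Suc (Suc m)))"
    if "k \<le> m" for k
    using that
  proof (induction k)
    case (Suc k)
    have "hor k (Suc m) + ver k (Suc (Suc m)) = ver k (Suc m) + hor (Suc k) (Suc m)"
      using Suc.prems \<open>Suc m \<le> n - 2\<close> n3 by (intro cell) auto
    then show ?case using Suc by simp
  qed simp
  have "(\<Sum>i<Suc m. turn i) = (\<Sum>j=1..<Suc m. hor 0 j) + (\<Sum>i<m. ver i (Suc m)) + (hor m (Suc m) + ver m (Suc (Suc m)))"
    using Suc triangle_cell[of m] by simp
  then show ?case using shift[of m] by simp
qed simp

text \<open>The deformation reaches column \<open>n - 1\<close> by \<open>turn_partial_sum\<close>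
  and column \<open>n\<close> here. The cell at (0, n - 1) is again a triangle and contributes
  \<open>turn (n - 1)\<close>, which also occurs as the last summand on the left; row 0 and column
  \<open>n\<close> contribute \<open>sweep\<close> each.\<close>

lemma turning: "(\<Sum>i<n. turn i) = 2 * (sweep + turn (n - 1))"
proof -
  obtain k where k: "n = k + 3" using n3 by (metis add.commute le_Suc_ex)
  have n: "n - 1 = k + 2" "n - 2 = Suc k" using k by auto
  have shift: "(\<Sum>i=1..<Suc m. ver i (k + 2)) = hor 1 (k + 2) - hor (Suc m) (k + 2) + (\<Sum>i=1..<Suc m. ver i n)"
    if "m \<le> k" for m
    using that
  proof (induction m)
    case (Suc m)
    have "hor (Suc m) (k + 2) + ver (Suc m) (Suc (k + 2)) = ver (Suc m) (k + 2) + hor (Suc (Suc m)) (k + 2)"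
      using Suc.prems k by (intro cell) auto
    moreover have "Suc (k + 2) = n" using k by simp
    ultimately show ?case using Suc by simp
  qed simp
  \<comment> \<open>Column \<open>n\<close> is row 0 with all chords reversed, because
    \<open>v n = v 0\<close>.\<close>
  have ver_n: "ver i n = hor 0 i" for i
    using ang_minus[of "v i - v 0" "v (Suc i) - v 0"] by (simp add: ver_def hor_def vn)
  have split0: "(\<Sum>i<Suc k. ver i (k + 2)) = ver 0 (k + 2) + (\<Sum>i=1..<Suc k. ver i (k + 2))"
    by (simp add: sum.atLeast1_atMost_eq sum.lessThan_Suc_shift lessThan_atLeast0 sum.atLeast_Suc_lessThan)
  have "(\<Sum>i<n. turn i) = (\<Sum>i<Suc k. turn i) + turn (Suc k) + turn (k + 2)"
    by (simp add: k numeral_3_eq_3)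
  also have "(\<Sum>i<Suc k. turn i) = (\<Sum>j=1..<k+2. hor 0 j) + (\<Sum>i<Suc k. ver i (k + 2))"
    using turn_partial_sum[of "Suc k"] n by simp
  also have "turn (Suc k) = hor (Suc k) (k + 2) + ver (Suc k) n"
    using triangle_cell[of "Suc k"] k by (simp add: numeral_3_eq_3)
  also have "(\<Sum>i<Suc k. ver i (k + 2)) = turn (k + 2) - hor (Suc k) (k + 2) + (\<Sum>i=1..<Suc k. ver i n)"
    using split0 shift[of k] corner_cell n by simp
  finally show ?thesis unfolding sweep_def n(1) ver_n by simp
qed

text \<open>Up to multiples of 2 * pi, \<open>sweep\<close> leads from \<open>edge 0\<close> to
  \<open>- edge (n - 1)\<close>, and the turn leads from \<open>edge (n - 1)\<close> back to
  \<open>edge 0\<close>. Together they make a half turn.\<close>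

lemma cis_sweep: "cis (sweep + turn (n - 1)) = -1"
proof -
  have ne: "v j - v 0 \<noteq> 0" if "1 \<le> j" "j < n" for j
    using vertex_distinct[of 0 j] that by auto
  have part: "cis (\<Sum>j=1..<m. hor 0 j) = sgn (v m - v 0) / sgn (v 1 - v 0)" if "1 \<le> m" "m < n" for m
    using that
  proof (induction m rule: dec_induct)
    case base
    then show ?case using ne[of 1] by (simp add: sgn_zero_iff)
  next
    case (step m)
    then have "cis (\<Sum>j=1..<m. hor 0 j) = sgn (v m - v 0) / sgn (v 1 - v 0)" by simp
    moreover have "cis (hor 0 m) = sgn (v (Suc m) - v 0) / sgn (v m - v 0)"
      unfolding hor_def using step by (intro cis_ang ne) auto
    ultimately show ?case using step ne[of m] by (simp add: cis_mult[symmetric] sgn_zero_iff)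
  qed
  have n: "Suc (n - 1) = n" using n3 by simp
  have "cis sweep = sgn (v (n - 1) - v 0) / sgn (v 1 - v 0)"
    unfolding sweep_def using n3 by (intro part) auto
  also have "v (n - 1) - v 0 = - edge (n - 1)" unfolding edge_def n vn by simp
  also have "v 1 - v 0 = edge 0" by (simp add: edge_def)
  finally have "cis sweep = - sgn (edge (n - 1)) / sgn (edge 0)" by (simp add: sgn_minus)
  moreover have "edge n = edge 0" using edge_periodic[of 0] by simp
  then have "cis (turn (n - 1)) = sgn (edge 0) / sgn (edge (n - 1))"
    unfolding turn_def using cis_ang[OF edge_nonzero edge_nonzero] n by simp
  ultimately show ?thesis using edge_nonzero by (simp add: cis_mult[symmetric] sgn_zero_iff)
qed

text \<open>The sum is an odd multiple of pi. The bounds place it strictly between -pi and 3 * pi,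
  so it is pi. Here \<open>\<theta>\<close> will be the interior angle and \<open>\<sigma>\<close>
  the orientation.\<close>

lemma exterior_angle:
  assumes "\<sigma> * sweep = \<theta>" "0 \<le> \<theta>" "\<theta> \<le> 2 * pi" "\<bar>\<sigma>\<bar> = 1"
  shows "\<sigma> * (sweep + turn (n - 1)) = pi"
proof -
  have "cos (sweep + turn (n - 1)) = -1" using cis_sweep by (simp add: complex_eq_iff)
  then have "cos (\<sigma> * (sweep + turn (n - 1))) = -1"
  proof -
    have "\<sigma> = 1 \<or> \<sigma> = -1" using assms(4) by linarith
    moreover have "cos (1 * x) = cos x" "cos (-1 * x) = cos x" for x :: real by simp_all
    ultimately show ?thesis using \<open>cos (sweep + turn (n - 1)) = -1\<close> by metis
  qed
  then obtain k :: int where k: "\<sigma> * (sweep + turn (n - 1)) = (2 * k + 1) * pi"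
    unfolding cos_eq_minus1 by (auto simp: algebra_simps)
  have "\<bar>\<sigma> * turn (n - 1)\<bar> < pi" using turn_bound[of "n - 1"] assms(4) by (simp add: abs_mult)
  then have "- pi < \<sigma> * (sweep + turn (n - 1))" "\<sigma> * (sweep + turn (n - 1)) < 3 * pi"
    using assms by (simp_all add: distrib_left)
  then have "-1 < (2 * real_of_int k + 1)" "2 * real_of_int k + 1 < 3"
    unfolding k using mult_less_cancel_right_pos[OF pi_gt_zero, of "-1"] mult_less_cancel_right_pos[OF pi_gt_zero, of _ 3] by auto
  then have "k = 0" by linarith
  then show ?thesis using k by simp
qed

end

section \<open>Winding numbers near a corner\<close>

lemma segment_quotient:
  fixes a b z :: complex
  assumes "z \<notin> closed_segment a b" "w \<in> closed_segment a b"
  shows "(w - z) / (a - z) \<notin> \<real>\<^sub>\<le>\<^sub>0"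
proof
  assume "(w - z) / (a - z) \<in> \<real>\<^sub>\<le>\<^sub>0"
  then obtain r where r: "(w - z) / (a - z) = of_real r" "r \<le> 0" by (auto elim: nonpos_Reals_cases)
  have "a \<noteq> z" using assms by auto
  then have eq: "w - z = r *\<^sub>R (a - z)" using r by (simp add: divide_eq_eq scaleR_conv_of_real)
  define u where "u = - r / (1 - r)"
  have u: "0 \<le> u" "u \<le> 1" "(1 - r) * u = - r" using r by (auto simp: u_def field_simps)
  have "(1 - r) *\<^sub>R z = w - r *\<^sub>R a" using eq by (simp add: algebra_simps)
  also have "\<dots> = (1 - r) *\<^sub>R ((1 - u) *\<^sub>R w + u *\<^sub>R a)"
  proof -
    have "(1 - r) * (1 - u) = 1" using u(3) by (simp add: algebra_simps)
    then show ?thesis by (simp add: scaleR_add_right u(3))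
  qed
  finally have "z = (1 - u) *\<^sub>R w + u *\<^sub>R a" using r by simp
  then have "z \<in> closed_segment w a" using u by (auto simp: in_segment)
  moreover have "closed_segment w a \<subseteq> closed_segment a b"
    using assms by (simp add: closed_segment_subset)
  ultimately show False using assms by blast
qed

text \<open>By \<open>segment_quotient\<close> the segment, seen from \<open>z\<close> and divided
  by \<open>a - z\<close>, avoids the branch cut, so \<open>Ln\<close> is a primitive along it. A
  single side is not a closed path: its winding number is complex, and only the real part is an
  angle.\<close>

lemma winding_number_linepath_ang:
  assumes "z \<notin> closed_segment a b"
  shows "2 * pi * Re (winding_number (linepath a b) z) = ang (a - z) (b - z)"
proof -
  have az: "a \<noteq> z" using assms by auto
  have "((\<lambda>w. 1 / (w - z)) has_contour_integral
      (Ln ((pathfinish (linepath a b) - z) / (a - z)) - Ln ((pathstart (linepath a b) - z) / (a - z)))) (linepath a b)"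
  proof (rule contour_integral_primitive[where S = "closed_segment a b"])
    fix w assume w: "w \<in> closed_segment a b"
    have nz: "w - z \<noteq> 0" using w assms by auto
    show "((\<lambda>w. Ln ((w - z) / (a - z))) has_field_derivative 1 / (w - z)) (at w within closed_segment a b)"
    proof -
      have "((\<lambda>w. (w - z) / (a - z)) has_field_derivative 1 / (a - z)) (at w within closed_segment a b)"
        using az by (auto intro!: derivative_eq_intros)
      from DERIV_chain2[OF has_field_derivative_Ln[OF segment_quotient[OF assms w]] this] show ?thesis
        using az nz by simp
    qed
  qed auto
  then have "contour_integral (linepath a b) (\<lambda>w. 1 / (w - z)) = Ln ((b - z) / (a - z))"
    using az by (simp add: contour_integral_unique)
  then have "winding_number (linepath a b) z = 1 / (2 * of_real pi * \<i>) * Ln ((b - z) / (a - z))"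
    using assms by (subst winding_number_valid_path) auto
  then have "Ln ((b - z) / (a - z)) = 2 * of_real pi * \<i> * winding_number (linepath a b) z"
    by (simp add: field_simps)
  then have "Im (Ln ((b - z) / (a - z))) = Im (2 * of_real pi * \<i> * winding_number (linepath a b) z)"
    by (rule arg_cong)
  moreover have "(b - z) / (a - z) \<noteq> 0" using assms by auto
  ultimately show ?thesis by (simp add: ang_def Arg_eq_Im_Ln)
qed

context cyclic_polygon
begin

section \<open>The polygon as a simple closed path\<close>

primrec side_path :: "nat \<Rightarrow> real \<Rightarrow> complex" where
  "side_path 0 = linepath (v 0) (v 1)"
| "side_path (Suc m) = side_path m +++ linepath (v (Suc m)) (v (Suc (Suc m)))"

lemma side_path_ends [simp]: "pathstart (side_path m) = v 0" "pathfinish (side_path m) = v (Suc m)"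
  by (induction m) auto

lemma path_side_path [simp]: "path (side_path m)"
  by (induction m) auto

lemma side_path_image: "path_image (side_path m) = (\<Union>i\<le>m. closed_segment (v i) (v (Suc i)))"
  by (induction m) (auto simp: path_image_join atMost_Suc)

lemma side_path_inter:
  assumes "Suc m < n"
  shows "path_image (side_path m) \<inter> closed_segment (v (Suc m)) (v (Suc (Suc m))) \<subseteq>
    {v (Suc m)} \<union> (if Suc (Suc m) = n then {v 0} else {})"
proof
  fix x assume "x \<in> path_image (side_path m) \<inter> closed_segment (v (Suc m)) (v (Suc (Suc m)))"
  then obtain i where i: "i \<le> m" "x \<in> closed_segment (v i) (v (Suc i))" and
    x: "x \<in> closed_segment (v (Suc m)) (v (Suc (Suc m)))" by (auto simp: side_path_image)
  show "x \<in> {v (Suc m)} \<union> (if Suc (Suc m) = n then {v 0} else {})"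
  proof (cases "i = m")
    case True then show ?thesis using adjacent[of m] i x by auto
  next
    case False
    then have im: "Suc i < Suc m" using i by simp
    show ?thesis
    proof (cases "Suc (Suc m) < i + n")
      case True
      then show ?thesis using apart[OF im] i x by blast
    next
      case False
      then have "i = 0" "Suc (Suc m) = n" using assms by auto
      moreover have "closed_segment (v (Suc m)) (v n) \<inter> closed_segment (v n) (v (Suc n)) = {v n}"
        using adjacent[of "Suc m"] \<open>Suc (Suc m) = n\<close> by simp
      ultimately show ?thesis using i x by (auto simp: vn)
    qed
  qed
qed

lemma arc_side_path:
  assumes "Suc m < n" shows "arc (side_path m)"
  using assms
proof (induction m)
  case 0 then show ?case using vertex_neq[of 0] by (simp add: arc_linepath)
next
  case (Suc m)
  have "arc (side_path m +++ linepath (v (Suc m)) (v (Suc (Suc m))))"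
    using Suc side_path_inter[of m] vertex_neq[of "Suc m"] by (intro arc_join) (auto simp: arc_linepath)
  then show ?case by simp
qed

definition loop :: "real \<Rightarrow> complex" where "loop = side_path (n - 1)"

definition polyline :: "complex set" where "polyline = (\<Union>i<n. closed_segment (v i) (v (Suc i)))"

lemma loop_closed: "pathstart loop = v 0" "pathfinish loop = v 0"
  using n3 vn by (auto simp: loop_def)

lemma loop_image: "path_image loop = polyline"
proof -
  have "{..n - 1} = {..<n}" using n3 by auto
  then show ?thesis by (simp add: loop_def polyline_def side_path_image)
qed

lemma simple_loop: "simple_path loop"
proof -
  obtain k where k: "n = Suc (Suc (Suc k))" using n3 that[of "n - 3"] by simp
  have "simple_path (side_path (Suc k) +++ linepath (v (Suc (Suc k))) (v n))"
  proof (rule simple_path_join_loop)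
    show "arc (side_path (Suc k))" by (rule arc_side_path) (simp add: k)
    show "arc (linepath (v (Suc (Suc k))) (v n))" using vertex_neq[of "Suc (Suc k)"] k by (simp add: arc_linepath)
    show "path_image (side_path (Suc k)) \<inter> path_image (linepath (v (Suc (Suc k))) (v n)) \<subseteq>
        {pathstart (side_path (Suc k)), pathstart (linepath (v (Suc (Suc k))) (v n))}"
      using side_path_inter[of "Suc k"] k by simp
  qed (use vn in simp_all)
  moreover have nk: "n - 1 = Suc (Suc k)" using k by simp
  have "loop = side_path (Suc k) +++ linepath (v (Suc (Suc k))) (v n)"
    unfolding loop_def nk by (simp add: k)
  ultimately show ?thesis by simp
qed

lemma winding_side_path:
  assumes "z \<notin> path_image (side_path m)"
  shows "2 * pi * Re (winding_number (side_path m) z) = (\<Sum>i\<le>m. ang (v i - z) (v (Suc i) - z))"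
  using assms
proof (induction m)
  case 0 then show ?case by (simp add: winding_number_linepath_ang)
next
  case (Suc m)
  then have z: "z \<notin> path_image (side_path m)" "z \<notin> closed_segment (v (Suc m)) (v (Suc (Suc m)))"
    by (auto simp: path_image_join)
  have "winding_number (side_path (Suc m)) z =
     winding_number (side_path m) z + winding_number (linepath (v (Suc m)) (v (Suc (Suc m)))) z"
    using z by (simp add: winding_number_join)
  then show ?case using Suc.IH[OF z(1)] winding_number_linepath_ang[OF z(2)] by (simp add: algebra_simps)
qed

lemma winding_loop:
  assumes "z \<notin> polyline"
  shows "2 * pi * Re (winding_number loop z) = (\<Sum>i<n. ang (v i - z) (v (Suc i) - z))"
proof -
  have eq: "{..n - 1} = {..<n}" using n3 by auto
  have "z \<notin> path_image (side_path (n - 1))"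
    using assms loop_image unfolding loop_def by simp
  from winding_side_path[OF this] show ?thesis unfolding eq loop_def .
qed

text \<open>\<open>\<sigma>\<close> is the orientation. It is fixed once, since the same sign must
  serve at all corners.\<close>

lemma winding_sign:
  obtains \<sigma> :: real where "\<bar>\<sigma>\<bar> = 1"
    "\<And>z. z \<in> inside polyline \<Longrightarrow> (\<Sum>i<n. ang (v i - z) (v (Suc i) - z)) = 2 * pi * \<sigma>"
    "\<And>z. z \<in> outside polyline \<Longrightarrow> (\<Sum>i<n. ang (v i - z) (v (Suc i) - z)) = 0"
proof -
  have closed: "pathfinish loop = pathstart loop" by (simp add: loop_closed)
  note J = Jordan_inside_outside[OF simple_loop closed, unfolded loop_image]
  have const: "winding_number loop constant_on inside polyline"
  proof (rule winding_number_constant)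
    show "path loop" using simple_loop by (rule simple_path_imp_path)
    show "connected (inside polyline)" using J by blast
    show "inside polyline \<inter> path_image loop = {}" by (simp add: loop_image inside_no_overlap)
  qed (rule closed)
  then obtain W where W: "\<And>z. z \<in> inside polyline \<Longrightarrow> winding_number loop z = W"
    by (auto simp: constant_on_def)
  obtain z0 where "z0 \<in> inside polyline" using J by blast
  then have "\<bar>Re W\<bar> = 1"
    using simple_closed_path_abs_winding_number_inside[OF simple_loop, of z0] W loop_image by simp
  moreover have "(\<Sum>i<n. ang (v i - z) (v (Suc i) - z)) = 2 * pi * Re W" if "z \<in> inside polyline" for z
  proof -
    have "z \<notin> polyline" using that inside_no_overlap by blast
    then show ?thesis using winding_loop[of z] W[OF that] by simp
  qed
  moreover have "(\<Sum>i<n. ang (v i - z) (v (Suc i) - z)) = 0" if "z \<in> outside polyline" for z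
  proof -
    have "z \<notin> polyline" using that outside_no_overlap by blast
    moreover have "winding_number loop z = 0"
      using that winding_number_zero_in_outside[of loop z] closed simple_loop
      by (simp add: loop_image simple_path_imp_path)
    ultimately show ?thesis using winding_loop[of z] by simp
  qed
  ultimately show ?thesis using that by blast
qed

lemma tendsto_ang:
  assumes "(f \<longlongrightarrow> a) F" "(g \<longlongrightarrow> b) F" "a \<noteq> 0" "b / a \<notin> \<real>\<^sub>\<le>\<^sub>0"
  shows "((\<lambda>x. ang (f x) (g x)) \<longlongrightarrow> ang a b) F"
  unfolding ang_def using assms by (intro tendsto_Arg tendsto_divide)

lemma opposite_vertex:
  assumes "1 \<le> i" "Suc i < n"
  shows "v 0 \<notin> closed_segment (v i) (v (Suc i))"
proof (cases "i = 1")
  case True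
  have "v 0 \<noteq> v 1" using vertex_neq[of 0] by simp
  moreover have "v 0 \<in> closed_segment (v 0) (v (Suc 0))" by simp
  ultimately show ?thesis using adjacent[of 0] True by auto
next
  case False
  then have "closed_segment (v 0) (v (Suc 0)) \<inter> closed_segment (v i) (v (Suc i)) = {}"
    using assms by (intro apart) auto
  then show ?thesis by auto
qed

text \<open>As the point tends to \<open>v 0\<close> along \<open>e\<close>, the sides away from
  \<open>v 0\<close> yield \<open>sweep\<close> by continuity. For the two sides at
  \<open>v 0\<close> one vector degenerates to 0, but its direction stays that of
  \<open>- e\<close>. The assumptions on \<open>e\<close> keep these angles off the branch
  cut.\<close>

lemma corner_limit:
  assumes e: "e \<noteq> 0" "e / edge 0 \<notin> \<real>" "e / edge (n - 1) \<notin> \<real>"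
  shows "((\<lambda>r. \<Sum>i<n. ang (v i - (v 0 + of_real r * e)) (v (Suc i) - (v 0 + of_real r * e)))
     \<longlongrightarrow> sweep + ang (- e) (edge 0) + ang (- edge (n - 1)) (- e)) (at_right 0)"
proof -
  obtain k where k: "n = Suc (Suc (Suc k))" using n3 that[of "n - 3"] by simp
  define z where "z r = v 0 + of_real r * e" for r :: real
  have zlim: "(z \<longlongrightarrow> v 0) (at_right 0)"
    unfolding z_def by (auto intro!: tendsto_eq_intros)
  have pos: "\<forall>\<^sub>F r :: real in at_right 0. 0 < r" by (simp add: eventually_at_right_less)
  have mid: "((\<lambda>r. \<Sum>i=1..<n-1. ang (v i - z r) (v (Suc i) - z r)) \<longlongrightarrow> sweep) (at_right 0)"
    unfolding sweep_def hor_def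
  proof (intro tendsto_sum tendsto_ang tendsto_diff tendsto_const zlim)
    fix i assume i: "i \<in> {1..<n-1}"
    then have o: "v 0 \<notin> closed_segment (v i) (v (Suc i))" using opposite_vertex by auto
    then show "v i - v 0 \<noteq> 0" by auto
    show "(v (Suc i) - v 0) / (v i - v 0) \<notin> \<real>\<^sub>\<le>\<^sub>0" by (rule segment_quotient[OF o]) simp
  qed
  have e0: "edge 0 / (- e) \<notin> \<real>\<^sub>\<le>\<^sub>0"
  proof
    assume "edge 0 / (- e) \<in> \<real>\<^sub>\<le>\<^sub>0"
    then have "edge 0 / (- e) \<in> \<real>" by (auto elim: nonpos_Reals_cases)
    then have "- inverse (edge 0 / (- e)) \<in> \<real>" by (intro Reals_minus Reals_inverse)
    moreover have "- inverse (edge 0 / (- e)) = e / edge 0" by simp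
    ultimately show False using e by simp
  qed
  have first: "((\<lambda>r. ang (v 0 - z r) (v 1 - z r)) \<longlongrightarrow> ang (- e) (edge 0)) (at_right 0)"
  proof (rule Lim_transform_eventually)
    have "((\<lambda>r. v 1 - z r) \<longlongrightarrow> edge 0) (at_right 0)"
      using tendsto_diff[OF tendsto_const zlim, of "v 1"] by (simp add: edge_def)
    then show "((\<lambda>r. ang (- e) (v 1 - z r)) \<longlongrightarrow> ang (- e) (edge 0)) (at_right 0)"
      using e e0 by (intro tendsto_ang) auto
    \<comment> \<open>\<open>v 0 - z r\<close> is \<open>- e\<close> times the positive number
      \<open>r\<close>, and \<open>ang\<close> ignores positive factors.\<close>
    show "\<forall>\<^sub>F r in at_right 0. ang (- e) (v 1 - z r) = ang (v 0 - z r) (v 1 - z r)"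
      using pos
    proof eventually_elim
      case (elim r)
      have "(v 1 - z r) / (v 0 - z r) = ((v 1 - z r) / (- e)) / of_real r"
        using elim e by (simp add: z_def field_simps)
      then show ?case using elim by (simp only: ang_def Arg_divide_of_real)
    qed
  qed
  have en: "(- e) / (- edge (n - 1)) \<notin> \<real>\<^sub>\<le>\<^sub>0"
    using e by (auto elim!: nonpos_Reals_cases)
  have last: "((\<lambda>r. ang (v (n - 1) - z r) (v n - z r)) \<longlongrightarrow> ang (- edge (n - 1)) (- e)) (at_right 0)"
  proof (rule Lim_transform_eventually)
    have "v (n - 1) - v 0 = - edge (n - 1)" using k vn by (simp add: edge_def)
    then have "((\<lambda>r. v (n - 1) - z r) \<longlongrightarrow> - edge (n - 1)) (at_right 0)"
      using tendsto_diff[OF tendsto_const zlim, of "v (n - 1)"] by simp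
    then show "((\<lambda>r. ang (v (n - 1) - z r) (- e)) \<longlongrightarrow> ang (- edge (n - 1)) (- e)) (at_right 0)"
      using en edge_nonzero by (intro tendsto_ang) auto
    show "\<forall>\<^sub>F r in at_right 0. ang (v (n - 1) - z r) (- e) = ang (v (n - 1) - z r) (v n - z r)"
      using pos
    proof eventually_elim
      case (elim r)
      have "(v n - z r) / (v (n - 1) - z r) = ((- e) / (v (n - 1) - z r)) * of_real r"
        by (simp add: z_def vn)
      then show ?case using elim by (simp only: ang_def Arg_times_of_real2)
    qed
  qed
  have split: "(\<Sum>i<n. ang (v i - z r) (v (Suc i) - z r)) = ang (v 0 - z r) (v 1 - z r) +
    (\<Sum>i=1..<n-1. ang (v i - z r) (v (Suc i) - z r)) + ang (v (n - 1) - z r) (v n - z r)" for r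
  proof -
    have "{..<n} = insert 0 (insert (n - 1) {1..<n-1})" using k by auto
    moreover have "Suc (n - 1) = n" using k by simp
    ultimately show ?thesis using k by simp
  qed
  have "((\<lambda>r. \<Sum>i<n. ang (v i - z r) (v (Suc i) - z r)) \<longlongrightarrow> ang (- e) (edge 0) + sweep + ang (- edge (n - 1)) (- e)) (at_right 0)"
    unfolding split by (intro tendsto_add first mid last)
  then show ?thesis by (simp add: z_def add.commute)
qed

lemma off_polyline:
  assumes e: "e \<noteq> 0" "e / edge 0 \<notin> \<real>" "e / edge (n - 1) \<notin> \<real>"
  shows "\<forall>\<^sub>F r in at_right 0. v 0 + of_real r * e \<notin> polyline"
proof -
  have zlim: "((\<lambda>r. v 0 + of_real r * e) \<longlongrightarrow> v 0) (at_right 0)"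
    by (auto intro!: tendsto_eq_intros)
  have pos: "\<forall>\<^sub>F r :: real in at_right 0. 0 < r" by (simp add: eventually_at_right_less)
  have "\<forall>\<^sub>F r in at_right 0. v 0 + of_real r * e \<notin> closed_segment (v i) (v (Suc i))" if i: "i < n" for i
  proof -
    consider "i = 0" | "i = n - 1" | "1 \<le> i" "Suc i < n" using i by linarith
    then show ?thesis
    proof cases
      case 1
      show ?thesis using pos
      proof eventually_elim
        case (elim r)
        show ?case
        proof
          assume "v 0 + of_real r * e \<in> closed_segment (v i) (v (Suc i))"
          then obtain u where "v 0 + of_real r * e = (1 - u) *\<^sub>R v 0 + u *\<^sub>R v 1" using 1 by (auto simp: in_segment)
          then have "of_real r * e = of_real u * edge 0" by (simp add: edge_def scaleR_conv_of_real algebra_simps)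
          then have "e / edge 0 = of_real (u / r)" using elim edge_nonzero by (simp add: field_simps)
          then show False using e by simp
        qed
      qed
    next
      case 2
      have n: "Suc (n - 1) = n" using n3 by simp
      show ?thesis using pos
      proof eventually_elim
        case (elim r)
        show ?case
        proof
          assume "v 0 + of_real r * e \<in> closed_segment (v i) (v (Suc i))"
          then obtain u where "v 0 + of_real r * e = (1 - u) *\<^sub>R v (n - 1) + u *\<^sub>R v 0"
            using 2 n vn by (auto simp: in_segment)
          then have "of_real r * e = of_real (u - 1) * edge (n - 1)"
            unfolding edge_def n vn by (simp add: scaleR_conv_of_real algebra_simps)
          then have "e / edge (n - 1) = of_real ((u - 1) / r)" using elim edge_nonzero by (simp add: field_simps)
          then show False using e by simp
        qed
      qed
    next
      case 3
      have "open (- closed_segment (v i) (v (Suc i)))" by (simp add: open_Compl)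
      then show ?thesis
        using topological_tendstoD[OF zlim] opposite_vertex[OF 3] by fastforce
    qed
  qed
  then show ?thesis unfolding polyline_def by (auto simp: eventually_ball_finite_distrib)
qed

text \<open>Near \<open>v 0\<close> the winding sum takes only two values, which are 2 * pi apart.
  Since it converges, it is eventually constant, and its value tells whether the ray starts inside
  or outside.\<close>

lemma corner_dichotomy:
  assumes e: "e \<noteq> 0" "e / edge 0 \<notin> \<real>" "e / edge (n - 1) \<notin> \<real>"
    and \<sigma>: "\<bar>\<sigma>\<bar> = 1"
      "\<And>z. z \<in> inside polyline \<Longrightarrow> (\<Sum>i<n. ang (v i - z) (v (Suc i) - z)) = 2 * pi * \<sigma>"
      "\<And>z. z \<in> outside polyline \<Longrightarrow> (\<Sum>i<n. ang (v i - z) (v (Suc i) - z)) = 0"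
  defines "T \<equiv> sweep + ang (- e) (edge 0) + ang (- edge (n - 1)) (- e)"
  shows "T = 2 * pi * \<sigma> \<and> (\<forall>\<^sub>F r in at_right 0. v 0 + of_real r * e \<in> inside polyline) \<or>
         T = 0 \<and> (\<forall>\<^sub>F r in at_right 0. v 0 + of_real r * e \<in> outside polyline)"
proof -
  define f where "f r = (\<Sum>i<n. ang (v i - (v 0 + of_real r * e)) (v (Suc i) - (v 0 + of_real r * e)))" for r :: real
  have lim: "(f \<longlongrightarrow> T) (at_right 0)" unfolding f_def T_def by (rule corner_limit[OF e])
  have io: "\<forall>\<^sub>F r in at_right 0. (v 0 + of_real r * e \<in> inside polyline \<and> f r = 2 * pi * \<sigma>) \<or>
      (v 0 + of_real r * e \<in> outside polyline \<and> f r = 0)"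
    using off_polyline[OF e]
  proof eventually_elim
    case (elim r)
    then have "v 0 + of_real r * e \<in> inside polyline \<union> outside polyline"
      using inside_Un_outside[of polyline] by blast
    then show ?case unfolding f_def using \<sigma>(2,3) by (elim UnE) blast+
  qed
  have s0: "2 * pi * \<sigma> \<noteq> 0" using \<sigma>(1) by auto
  have near: "\<forall>\<^sub>F r in at_right 0. dist (f r) T < pi" by (rule tendstoD[OF lim pi_gt_zero])
  have "\<exists>x\<in>{2 * pi * \<sigma>, 0}. \<forall>\<^sub>F r in at_right 0. f r = x"
  proof (cases "dist (2 * pi * \<sigma>) T < pi")
    case True
    have "2 * pi \<le> dist (2 * pi * \<sigma>) T + dist T 0"
      using dist_triangle[of "2 * pi * \<sigma>" 0 T] \<sigma>(1) by (simp add: dist_real_def abs_mult)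
    then have "\<not> dist 0 T < pi" using True by (simp add: dist_commute)
    have "\<forall>\<^sub>F r in at_right 0. f r = 2 * pi * \<sigma>"
      using io near by eventually_elim (use \<open>\<not> dist 0 T < pi\<close> in auto)
    then show ?thesis by blast
  next
    case False
    have "\<forall>\<^sub>F r in at_right 0. f r = 0" using io near by eventually_elim (use False in auto)
    then show ?thesis by blast
  qed
  then obtain x where x: "x \<in> {2 * pi * \<sigma>, 0}" "\<forall>\<^sub>F r in at_right 0. f r = x" by blast
  have "(f \<longlongrightarrow> x) (at_right 0)" using x(2) by (rule tendsto_eventually)
  then have xT: "T = x" using lim tendsto_unique trivial_limit_at_right_real by blast
  show ?thesis
  proof (cases "x = 0")
    case True
    have "\<forall>\<^sub>F r in at_right 0. v 0 + of_real r * e \<in> outside polyline"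
      using io x(2) by eventually_elim (use True s0 in auto)
    then show ?thesis using xT True by simp
  next
    case False
    have "\<forall>\<^sub>F r in at_right 0. v 0 + of_real r * e \<in> inside polyline"
      using io x(2) by eventually_elim (use False in auto)
    then show ?thesis using xT x False by simp
  qed
qed

end

section \<open>Angle sum\<close>

definition to_complex :: "point \<Rightarrow> complex" where
  "to_complex p = Complex (p $ 1) (p $ 2)"

definition of_complex :: "complex \<Rightarrow> point" where
  "of_complex z = vector [Re z, Im z]"

lemma to_of_complex [simp]: "to_complex (of_complex z) = z"
  by (simp add: to_complex_def of_complex_def)

lemma of_to_complex [simp]: "of_complex (to_complex p) = p"
  by (simp add: to_complex_def of_complex_def vec_eq_iff forall_2)

lemma linear_to_complex: "linear to_complex"
  by (rule linearI) (simp_all add: to_complex_def complex_eq_iff)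

lemma linear_of_complex: "linear of_complex"
  by (rule linearI) (simp_all add: of_complex_def vec_eq_iff forall_2)

lemma to_complex_add: "to_complex (p + q) = to_complex p + to_complex q"
  by (rule linear_add[OF linear_to_complex])

lemma to_complex_diff: "to_complex (p - q) = to_complex p - to_complex q"
  by (rule linear_diff[OF linear_to_complex])

lemma to_complex_scaleR: "to_complex (r *\<^sub>R p) = of_real r * to_complex p"
  unfolding linear_scale[OF linear_to_complex] by (rule scaleR_conv_of_real)

lemma to_complex_eq_iff [simp]: "to_complex p = to_complex q \<longleftrightarrow> p = q"
  by (metis of_to_complex)

lemma continuous_on_to_complex [continuous_intros]: "continuous_on S to_complex"
  by (intro linear_continuous_on) (simp add: linear_to_complex flip: linear_conv_bounded_linear)

lemma continuous_on_of_complex: "continuous_on S of_complex"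
  by (intro linear_continuous_on) (simp add: linear_of_complex flip: linear_conv_bounded_linear)

lemma to_complex_reflect:
  assumes "w \<noteq> 0"
  shows "to_complex (reflect 0 (of_complex w) u) = w * cnj (to_complex u / w)"
proof -
  have n: "of_complex w \<bullet> of_complex w = (cmod w)\<^sup>2"
    by (simp add: of_complex_def inner_vec_def sum_2 cmod_power2 flip: power2_eq_square)
  have i: "u \<bullet> of_complex w = Re (to_complex u * cnj w)"
    by (simp add: of_complex_def to_complex_def inner_vec_def sum_2)
  have "to_complex (reflect 0 (of_complex w) u) = of_real (2 * Re (to_complex u * cnj w) / (cmod w)\<^sup>2) * w - to_complex u"
    by (simp add: reflect_def to_complex_diff to_complex_scaleR n i)
  also have "\<dots> = w * cnj (to_complex u / w)"
  proof -
    let ?z = "to_complex u"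
    have "complex_of_real (2 * Re (?z * cnj w)) = ?z * cnj w + cnj (?z * cnj w)"
      by (rule complex_add_cnj[symmetric])
    moreover have "complex_of_real ((cmod w)\<^sup>2) = w * cnj w" by (simp only: complex_norm_square)
    ultimately have eq: "of_real (2 * Re (?z * cnj w) / (cmod w)\<^sup>2) * w = (?z * cnj w + cnj ?z * w) / (w * cnj w) * w"
      by (simp only: of_real_divide complex_cnj_mult complex_cnj_cnj)
    show ?thesis unfolding eq using assms by (simp add: field_simps)
  qed
  finally show ?thesis .
qed

text \<open>The direction-dependent terms of \<open>corner_limit\<close>, as functions of the
  direction. The value 0 on the line of \<open>w\<close> avoids the cut of \<open>Arg\<close> and
  makes the function odd under reflection in that line without exception.\<close>

definition subtended :: "complex \<Rightarrow> point \<Rightarrow> real" where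
  "subtended w u = (if to_complex u / w \<in> \<real> then 0 else Arg (w / to_complex u))"

lemma closed_real_line: "closed {u. to_complex u / w \<in> \<real>}"
proof -
  have "closed ((\<lambda>u. to_complex u / w) -` \<real>)"
  proof (cases "w = 0")
    case False
    then show ?thesis
      by (intro closed_vimage closed_complex_Reals continuous_intros) auto
  qed simp
  then show ?thesis by (simp add: vimage_def)
qed

lemma negligible_real_line: assumes "w \<noteq> 0" shows "negligible {u. to_complex u / w \<in> \<real>}"
proof (rule negligible_subset[OF negligible_line[of 0 "of_complex w"]])
  show "{u. to_complex u / w \<in> \<real>} \<subseteq> {0 + t *\<^sub>R of_complex w |t. True}"
  proof
    fix u assume "u \<in> {u. to_complex u / w \<in> \<real>}"
    then obtain t where "to_complex u / w = of_real t" by (auto elim: Reals_cases)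
    then have "to_complex u = to_complex (t *\<^sub>R of_complex w)"
      using assms by (simp add: to_complex_scaleR divide_eq_eq)
    then show "u \<in> {0 + t *\<^sub>R of_complex w |t. True}" by auto
  qed
qed

lemma subtended_measurable [measurable]:
  assumes "w \<noteq> 0" shows "subtended w \<in> borel_measurable borel"
proof -
  let ?A = "- {u. to_complex u / w \<in> \<real>}"
  have "(\<lambda>u. indicator ?A u *\<^sub>R Arg (w / to_complex u)) \<in> borel_measurable borel"
  proof (rule borel_measurable_continuous_on_indicator)
    show "?A \<in> sets borel" using closed_real_line[of w] by (intro borel_open) (simp add: open_Compl)
    show "continuous_on ?A (\<lambda>u. Arg (w / to_complex u))"
    proof (intro continuous_intros ballI)
      fix u assume u: "u \<in> ?A"
      then show "to_complex u \<noteq> 0" by auto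
      show "w / to_complex u \<notin> \<real>\<^sub>\<le>\<^sub>0"
      proof
        assume "w / to_complex u \<in> \<real>\<^sub>\<le>\<^sub>0"
        then have "inverse (w / to_complex u) \<in> \<real>"
          by (intro Reals_inverse) (auto elim: nonpos_Reals_cases)
        then show False using u by simp
      qed
    qed
  qed
  moreover have "subtended w = (\<lambda>u. indicator ?A u *\<^sub>R Arg (w / to_complex u))"
    by (auto simp: subtended_def indicator_def)
  ultimately show ?thesis by simp
qed

lemma subtended_reflect:
  assumes "w \<noteq> 0"
  shows "subtended w (reflect 0 (of_complex w) u) = - subtended w u"
proof -
  let ?z = "to_complex u"
  have q: "w * cnj (?z / w) / w = cnj (?z / w)" using assms by simp
  have r: "w / (w * cnj (?z / w)) = cnj (w / ?z)" using assms by simp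
  have "cnj (?z / w) \<in> \<real> \<longleftrightarrow> ?z / w \<in> \<real>" by (metis Reals_cnj_iff complex_cnj_cnj)
  moreover have "w / ?z \<notin> \<real>" if "?z / w \<notin> \<real>"
    using that Reals_inverse[of "w / ?z"] by (auto simp: inverse_divide)
  ultimately show ?thesis
    unfolding subtended_def to_complex_reflect[OF assms] q r
    by (auto simp: Arg_cnj simp del: complex_cnj_divide)
qed

lemma subtended_bound: "\<bar>subtended w u\<bar> \<le> pi"
  using mpi_less_Arg[of "w / to_complex u"] Arg_le_pi[of "w / to_complex u"]
  by (auto simp: subtended_def abs_le_iff)

lemma subtended_disc_measurable:
  assumes "w \<noteq> 0"
  shows "(\<lambda>u. indicator (cball 0 1) u * subtended w u) \<in> borel_measurable borel"
  by (intro borel_measurable_times borel_measurable_indicator subtended_measurable assms) auto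

lemma subtended_integrable:
  assumes "w \<noteq> 0"
  shows "integrable lborel (\<lambda>u. indicator (cball 0 1) u * subtended w u)"
proof (rule Bochner_Integration.integrable_bound)
  show "integrable lborel (\<lambda>u :: point. indicator (cball 0 1) u * pi)"
    using emeasure_lborel_cball_finite[of "0 :: point" 1] by (intro integrable_mult_left integrable_real_indicator) auto
  show "(\<lambda>u. indicator (cball 0 1) u * subtended w u) \<in> borel_measurable lborel"
    using subtended_disc_measurable[OF assms] by simp
  show "AE u in lborel. norm (indicator (cball 0 1) u * subtended w u) \<le> norm (indicator (cball 0 1) u * pi)"
    using subtended_bound by (auto simp: abs_mult indicator_def)
qed

text \<open>Reflection in the line of \<open>w\<close> preserves the disc and the area but changes
  the sign of the integrand.\<close>

lemma integral_subtended:
  assumes "w \<noteq> 0"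
  shows "(LINT u|lborel. indicator (cball 0 1) u * subtended w u) = 0"
proof -
  let ?R = "reflect 0 (of_complex w)"
  have ot: "orthogonal_transformation ?R"
    by (simp add: orthogonal_transformation reflect_linear)
  have meas: "?R \<in> measurable lborel borel"
  proof -
    have "?R \<in> borel_measurable borel"
      using reflect_linear[of 0 "of_complex w"]
      by (intro borel_measurable_continuous_onI linear_continuous_on) (simp add: linear_conv_bounded_linear)
    then show ?thesis by simp
  qed
  let ?f = "\<lambda>u. indicator (cball 0 1) u * subtended w u"
  have "integral\<^sup>L lborel ?f = integral\<^sup>L (distr lborel borel ?R) ?f"
    by (simp add: distr_lborel_orthogonal[OF ot])
  also have "\<dots> = (LINT u|lborel. ?f (?R u))"
    by (intro integral_distr meas subtended_disc_measurable assms)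
  also have "\<dots> = (LINT u|lborel. - ?f u)"
    by (intro Bochner_Integration.integral_cong) (auto simp: subtended_reflect[OF assms] indicator_def)
  finally show ?thesis by simp
qed

lemma measure_unit_disc: "measure lborel (cball (0 :: point) 1) = pi"
  by (simp add: content_cball unit_ball_vol_2)

context cyclic_polygon
begin

text \<open>As part of the unit disc this cone has area equal to half the interior angle at
  \<open>v k\<close>.\<close>

definition inward :: "nat \<Rightarrow> point set" where
  "inward k = {u \<in> cball 0 1. \<forall>\<^sub>F r in at_right 0. v k + of_real r * to_complex u \<in> inside polyline}"

definition outward :: "nat \<Rightarrow> point set" where
  "outward k = {u \<in> cball 0 1. \<forall>\<^sub>F r in at_right 0. v k + of_real r * to_complex u \<in> outside polyline}"

text \<open>Off a null set, the limit \<open>F\<close> of the winding sum is 2 * pi *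
  \<open>\<sigma>\<close> on inward and 0 on outward directions. Its integral over the disc is
  \<open>sweep * pi\<close>, because both \<open>subtended\<close> terms integrate to 0; comparison
  gives the area.\<close>

lemma corner_angle_measure:
  assumes \<sigma>: "\<bar>\<sigma>\<bar> = 1"
      "\<And>z. z \<in> inside polyline \<Longrightarrow> (\<Sum>i<n. ang (v i - z) (v (Suc i) - z)) = 2 * pi * \<sigma>"
      "\<And>z. z \<in> outside polyline \<Longrightarrow> (\<Sum>i<n. ang (v i - z) (v (Suc i) - z)) = 0"
  shows "inward 0 \<in> lmeasurable" "measure lebesgue (inward 0) = \<sigma> * sweep / 2"
    "measure lebesgue (outward 0) = pi - \<sigma> * sweep / 2"
proof -
  let ?D = "cball (0 :: point) 1"
  define F where "F u = sweep + subtended (- edge 0) u - subtended (edge (n - 1)) u" for u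
  \<comment> \<open>A Borel description of the inward directions, valid off the lines of the two
    sides at the corner.\<close>
  define B where "B = {u \<in> ?D. F u = 2 * pi * \<sigma>}"
  define N where "N = {u. to_complex u / edge 0 \<in> \<real>} \<union> {u. to_complex u / edge (n - 1) \<in> \<real>}"
  have N: "negligible N" unfolding N_def by (intro negligible_Un negligible_real_line edge_nonzero)
  have e0: "- edge 0 \<noteq> 0" using edge_nonzero by simp
  have Fm [measurable]: "F \<in> borel_measurable borel"
    unfolding F_def[abs_def]
    using subtended_measurable[OF e0] subtended_measurable[OF edge_nonzero[of "n - 1"]] by simp
  have s0: "2 * pi * \<sigma> \<noteq> 0" using \<sigma>(1) by auto
  have key: "(F u = 2 * pi * \<sigma> \<and> (\<forall>\<^sub>F r in at_right 0. v 0 + of_real r * to_complex u \<in> inside polyline)) \<or>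
      (F u = 0 \<and> (\<forall>\<^sub>F r in at_right 0. v 0 + of_real r * to_complex u \<in> outside polyline))"
    if u: "u \<notin> N" for u
  proof -
    let ?e = "to_complex u"
    have e: "?e \<noteq> 0" "?e / edge 0 \<notin> \<real>" "?e / edge (n - 1) \<notin> \<real>" using u by (auto simp: N_def)
    have "subtended (- edge 0) u = ang (- ?e) (edge 0)"
      using e Reals_minus[of "?e / - edge 0"] by (auto simp: subtended_def ang_def)
    moreover have "- subtended (edge (n - 1)) u = ang (- edge (n - 1)) (- ?e)"
      using e Arg_inverse[of "?e / edge (n - 1)"] by (simp add: subtended_def ang_def)
    ultimately have "F u = sweep + ang (- ?e) (edge 0) + ang (- edge (n - 1)) (- ?e)"
      by (simp add: F_def)
    then show ?thesis using corner_dichotomy[OF e \<sigma>] by simp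
  qed
  have excl: "\<not> ((\<forall>\<^sub>F r in at_right 0. v 0 + of_real r * to_complex u \<in> inside polyline) \<and>
       (\<forall>\<^sub>F r in at_right 0. v 0 + of_real r * to_complex u \<in> outside polyline))" for u
  proof
    assume a: "(\<forall>\<^sub>F r in at_right 0. v 0 + of_real r * to_complex u \<in> inside polyline) \<and>
       (\<forall>\<^sub>F r in at_right 0. v 0 + of_real r * to_complex u \<in> outside polyline)"
    have "\<forall>\<^sub>F r in at_right (0 :: real). False"
      using conjunct1[OF a] conjunct2[OF a]
      by eventually_elim (use inside_Int_outside[of polyline] in blast)
    then show False by simp
  qed
  have Bb: "B \<in> sets borel"
  proof -
    have "B = ?D \<inter> F -` {2 * pi * \<sigma>}" by (auto simp: B_def)
    then show ?thesis using measurable_sets_borel[OF Fm, of "{2 * pi * \<sigma>}"] by auto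
  qed
  have DB: "?D \<in> lmeasurable" by simp
  have Bl: "B \<in> lmeasurable"
    by (rule fmeasurableI2[OF DB]) (use Bb in \<open>auto simp: B_def\<close>)
  have sub1: "negligible ((B - inward 0) \<union> (inward 0 - B))"
  proof (rule negligible_subset[OF N], rule subsetI, rule ccontr)
    fix u assume "u \<in> (B - inward 0) \<union> (inward 0 - B)" "u \<notin> N"
    then show False using key[of u] excl[of u] s0 unfolding B_def inward_def by auto
  qed
  have sub2: "negligible ((?D - B - outward 0) \<union> (outward 0 - (?D - B)))"
  proof (rule negligible_subset[OF N], rule subsetI, rule ccontr)
    fix u assume "u \<in> (?D - B - outward 0) \<union> (outward 0 - (?D - B))" "u \<notin> N"
    then show False using key[of u] excl[of u] s0 unfolding B_def outward_def by auto
  qed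
  have DBl: "?D - B \<in> lmeasurable" using DB Bl by (rule fmeasurable.Diff)
  have mD: "measure lebesgue ?D = pi" using measure_unit_disc by simp
  have "measure lebesgue B = \<sigma> * sweep / 2"
  proof -
    have AEN: "AE u in lborel. u \<notin> N"
    proof -
      have "closed N" unfolding N_def by (intro closed_Un closed_real_line)
      then have "N \<in> sets borel" by auto
      moreover have "N \<in> null_sets lebesgue" using N by (simp flip: negligible_iff_null_sets)
      ultimately have "N \<in> null_sets lborel" by (simp add: null_sets_def)
      then show ?thesis by (rule AE_not_in)
    qed
    have "(LINT u|lborel. indicator ?D u * F u) = (LINT u|lborel. 2 * pi * \<sigma> * indicator B u)"
    proof (rule integral_cong_AE)
      show "AE u in lborel. indicator ?D u * F u = 2 * pi * \<sigma> * indicator B u"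
        using AEN
      proof eventually_elim
        case (elim u)
        then show ?case using key[of u] s0 by (auto simp: B_def indicator_def)
      qed
      have "(\<lambda>u. indicator ?D u * F u) \<in> borel_measurable borel"
        by (intro borel_measurable_times borel_measurable_indicator Fm) auto
      then show "(\<lambda>u. indicator ?D u * F u) \<in> borel_measurable lborel" by simp
    qed (use Bb in simp_all)
    moreover have "(LINT u|lborel. indicator ?D u * F u) = sweep * pi"
    proof -
      have "(\<lambda>u. indicator ?D u * F u) = (\<lambda>u. indicator ?D u * sweep + indicator ?D u * subtended (- edge 0) u
          - indicator ?D u * subtended (edge (n - 1)) u)" by (auto simp: F_def algebra_simps)
      moreover have "integrable lborel (\<lambda>u. indicator ?D u * sweep)"
        using emeasure_lborel_cball_finite[of "0 :: point" 1] by (intro integrable_mult_left integrable_real_indicator) auto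
      ultimately show ?thesis
        using subtended_integrable[OF e0] subtended_integrable[OF edge_nonzero[of "n - 1"]]
          integral_subtended[OF e0] integral_subtended[OF edge_nonzero[of "n - 1"]]
        by (simp add: measure_unit_disc)
    qed
    moreover have "(LINT u|lborel. 2 * pi * \<sigma> * indicator B u) = 2 * pi * \<sigma> * measure lborel B"
      by simp
    ultimately have eq: "sweep = 2 * \<sigma> * measure lborel B" by simp
    have "\<sigma> * \<sigma> = 1" using \<sigma>(1) by (metis abs_mult_self_eq mult_1)
    then have "\<sigma> * sweep = 2 * measure lborel B" unfolding eq by simp
    then show ?thesis using Bb by simp
  qed
  then show "inward 0 \<in> lmeasurable" "measure lebesgue (inward 0) = \<sigma> * sweep / 2"
    using lmeasurable_negligible_symdiff[OF Bl sub1] measure_negligible_symdiff[OF Bl sub1] by auto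
  have "measure lebesgue (outward 0) = measure lebesgue (?D - B)"
    using measure_negligible_symdiff[OF DBl sub2] .
  also have "\<dots> = pi - measure lebesgue B"
    using DB Bl mD by (subst measurable_measure_Diff) (auto simp: B_def fmeasurableD)
  finally show "measure lebesgue (outward 0) = pi - \<sigma> * sweep / 2"
    using \<open>measure lebesgue B = \<sigma> * sweep / 2\<close> by simp
qed

lemma periodic_sum:
  fixes f :: "nat \<Rightarrow> real"
  assumes "\<And>i. f (i + n) = f i"
  shows "(\<Sum>i<n. f (i + k)) = (\<Sum>i<n. f i)"
proof (induction k)
  case (Suc k)
  have "(\<Sum>i<n. f (Suc i + k)) + f k = (\<Sum>i<Suc n. f (i + k))"
    by (subst sum.lessThan_Suc_shift) simp
  also have "\<dots> = (\<Sum>i<n. f (i + k)) + f k" using assms[of k] by (simp add: add.commute)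
  finally show ?case using Suc by simp
qed simp

text \<open>Taking the union over all indices makes the set visibly independent of the vertex that
  is number 0.\<close>

lemma polyline_all: "polyline = (\<Union>i. closed_segment (v i) (v (Suc i)))"
proof -
  have per: "v (i + m * n) = v i" for i m
  proof (induction m)
    case (Suc m) then show ?case using periodic[of "i + m * n"] by (simp add: ac_simps)
  qed simp
  have "closed_segment (v i) (v (Suc i)) \<subseteq> polyline" for i
  proof -
    have "v i = v (i mod n)" "v (Suc i) = v (Suc (i mod n))"
      using per[of "i mod n" "i div n"] per[of "Suc (i mod n)" "i div n"] by simp_all
    moreover have "i mod n < n" using n3 by simp
    ultimately show ?thesis unfolding polyline_def by auto
  qed
  then show ?thesis unfolding polyline_def by blast
qed

lemma shifted_polyline: "cyclic_polygon.polyline (\<lambda>i. v (i + k)) n = polyline"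
proof -
  interpret s: cyclic_polygon "\<lambda>i. v (i + k)" n by (rule shifted)
  have "s.polyline \<subseteq> polyline" unfolding s.polyline_all polyline_all by auto
  moreover have "polyline \<subseteq> s.polyline"
  proof -
    have "closed_segment (v i) (v (Suc i)) \<subseteq> s.polyline" for i
    proof -
      have "v (i + k * n) = v i" for i
      proof (induction k)
        case (Suc m) then show ?case using periodic[of "i + m * n"] by (simp add: ac_simps)
      qed simp
      \<comment> \<open>Adding \<open>k\<close> full periods to \<open>i\<close> makes room for
        subtracting \<open>k\<close> in the naturals.\<close>
      moreover have "k \<le> k * n" using n3 by simp
      then have j: "i + k * n = (i + k * n - k) + k" by (simp only: le_add_diff_inverse2 trans_le_add2)
      ultimately have "v i = v ((i + k * n - k) + k)" "v (Suc i) = v (Suc (i + k * n - k) + k)"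
        by (metis, metis add_Suc)
      then show ?thesis unfolding s.polyline_all by auto
    qed
    then show ?thesis unfolding polyline_all by blast
  qed
  ultimately show ?thesis by blast
qed

text \<open>Each corner in turn is made number 0. Being an area inside the unit disc, its cone
  satisfies the bounds of \<open>exterior_angle\<close>, so half its interior angle is (pi -
  \<open>\<sigma>\<close> * turn) / 2. By \<open>turning\<close> the turns, multiplied by
  \<open>\<sigma>\<close>, add up to 2 * pi.\<close>

theorem angle_sum:
  shows "inward k \<in> lmeasurable"
    and "measure lebesgue (outward k) = pi - measure lebesgue (inward k)"
    and "(\<Sum>k<n. measure lebesgue (inward k)) = (real n - 2) * pi / 2"
proof -
  obtain \<sigma> :: real where \<sigma>: "\<bar>\<sigma>\<bar> = 1"
    "\<And>z. z \<in> inside polyline \<Longrightarrow> (\<Sum>i<n. ang (v i - z) (v (Suc i) - z)) = 2 * pi * \<sigma>"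
    "\<And>z. z \<in> outside polyline \<Longrightarrow> (\<Sum>i<n. ang (v i - z) (v (Suc i) - z)) = 0"
    using winding_sign by blast
  have 1: "inward k \<in> lmeasurable \<and> measure lebesgue (outward k) = pi - measure lebesgue (inward k) \<and>
      measure lebesgue (inward k) = pi / 2 - \<sigma> * turn (n - 1 + k) / 2" for k
  proof -
    interpret s: cyclic_polygon "\<lambda>i. v (i + k)" n by (rule shifted)
    \<comment> \<open>The winding sum does not depend on the starting vertex, so the same
      \<open>\<sigma>\<close> works for the shifted polygon.\<close>
    have sum: "(\<Sum>i<n. ang (v (i + k) - z) (v (Suc i + k) - z)) = (\<Sum>i<n. ang (v i - z) (v (Suc i) - z))" for z
      using periodic_sum[of "\<lambda>i. ang (v i - z) (v (Suc i) - z)" k] periodic periodic[of "Suc _"] by simp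
    have in_eq: "s.inward 0 = inward k" "s.outward 0 = outward k"
      by (simp_all add: s.inward_def inward_def s.outward_def outward_def shifted_polyline)
    have t: "s.turn (n - 1) = turn (n - 1 + k)" by (simp add: s.turn_def turn_def s.edge_def edge_def)
    note m = s.corner_angle_measure[OF \<sigma>(1), unfolded shifted_polyline sum in_eq, OF \<sigma>(2,3)]
    have "inward k \<subseteq> cball 0 1" by (auto simp: inward_def)
    then have "measure lebesgue (inward k) \<le> measure lebesgue (cball (0 :: point) 1)"
      using m(1) by (intro measure_mono_fmeasurable) (auto simp: fmeasurableD)
    then have le: "measure lebesgue (inward k) \<le> pi" using measure_unit_disc by simp
    have "\<sigma> * (s.sweep + s.turn (n - 1)) = pi"
    proof (rule s.exterior_angle[OF refl _ _ \<sigma>(1)])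
      show "0 \<le> \<sigma> * s.sweep" using m(2) measure_nonneg[of lebesgue "inward k"] by linarith
      show "\<sigma> * s.sweep \<le> 2 * pi" using m(2) le by linarith
    qed
    then have "\<sigma> * s.sweep + \<sigma> * turn (n - 1 + k) = pi" unfolding t distrib_left .
    then have "\<sigma> * s.sweep = pi - \<sigma> * turn (n - 1 + k)" by linarith
    then show ?thesis using m by (simp add: diff_divide_distrib)
  qed
  then show "inward k \<in> lmeasurable" "measure lebesgue (outward k) = pi - measure lebesgue (inward k)" by auto
  have "\<sigma> * (sweep + turn (n - 1)) = pi"
  proof -
    have "measure lebesgue (inward 0) = \<sigma> * sweep / 2" using corner_angle_measure[OF \<sigma>] by blast
    then have "\<sigma> * sweep = pi - \<sigma> * turn (n - 1)" using 1[of 0] by simp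
    then show ?thesis by (simp add: distrib_left)
  qed
  then have T: "\<sigma> * (\<Sum>i<n. turn i) = 2 * pi" unfolding turning by (metis mult.left_commute)
  have "(\<Sum>k<n. turn (n - 1 + k)) = (\<Sum>i<n. turn i)"
    using periodic_sum[of turn "n - 1", OF turn_periodic] by (simp add: add.commute)
  then have "(\<Sum>k<n. measure lebesgue (inward k)) = real n * (pi / 2) - \<sigma> * (\<Sum>i<n. turn i) / 2"
    using 1 by (simp add: sum_subtractf sum_distrib_left[symmetric] sum_divide_distrib[symmetric])
  then show "(\<Sum>k<n. measure lebesgue (inward k)) = (real n - 2) * pi / 2"
    using T by (simp add: algebra_simps diff_divide_distrib)
qed

end

section \<open>Polygons with obstacles\<close>

lemma homeomorphism_to_complex: "homeomorphism S (to_complex ` S) to_complex of_complex"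
  by (simp add: homeomorphism_def continuous_on_to_complex continuous_on_of_complex image_image)

lemma bounded_to_complex: "bounded (to_complex ` S) \<longleftrightarrow> bounded S"
proof
  assume "bounded (to_complex ` S)"
  then have "bounded (of_complex ` (to_complex ` S))"
    using linear_of_complex by (rule bounded_linear_image[OF _ linear_conv_bounded_linear[THEN iffD1]])
  then show "bounded S" by (simp add: image_image)
next
  assume "bounded S"
  then show "bounded (to_complex ` S)"
    using linear_to_complex by (rule bounded_linear_image[OF _ linear_conv_bounded_linear[THEN iffD1]])
qed

lemma Compl_to_complex: "- (to_complex ` S) = to_complex ` (- S)"
proof -
  have "bij to_complex" by (rule o_bij[of of_complex]) auto
  then show ?thesis by (simp add: bij_image_Compl_eq)
qed

lemma mem_to_complex_image: "to_complex x \<in> to_complex ` S \<longleftrightarrow> x \<in> S"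
  by auto

lemma inside_to_complex: "to_complex x \<in> inside (to_complex ` S) \<longleftrightarrow> x \<in> inside S"
proof (cases "x \<in> S")
  case False
  then have "connected_component_set (- (to_complex ` S)) (to_complex x) = to_complex ` connected_component_set (- S) x"
    unfolding Compl_to_complex by (intro connected_component_set_homeomorphism[OF homeomorphism_to_complex]) auto
  then show ?thesis by (simp add: inside_def mem_to_complex_image bounded_to_complex)
qed (simp add: inside_def mem_to_complex_image)

lemma outside_to_complex: "to_complex x \<in> outside (to_complex ` S) \<longleftrightarrow> x \<in> outside S"
  using inside_Un_outside[of S] inside_Int_outside[of S]
    inside_Un_outside[of "to_complex ` S"] inside_Int_outside[of "to_complex ` S"]
    inside_to_complex[of x S] mem_to_complex_image[of x S] by blast

lemma inside_to_complex_image: "inside (to_complex ` S) = to_complex ` inside S"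
proof (rule set_eqI)
  fix z show "z \<in> inside (to_complex ` S) \<longleftrightarrow> z \<in> to_complex ` inside S"
    using inside_to_complex[of "of_complex z" S] mem_to_complex_image[of "of_complex z" "inside S"] by simp
qed

lemma outside_to_complex_image: "outside (to_complex ` S) = to_complex ` outside S"
proof (rule set_eqI)
  fix z show "z \<in> outside (to_complex ` S) \<longleftrightarrow> z \<in> to_complex ` outside S"
    using outside_to_complex[of "of_complex z" S] mem_to_complex_image[of "of_complex z" "outside S"] by simp
qed

lemma closure_to_complex: "closure (to_complex ` S) = to_complex ` closure S"
  by (rule closure_injective_linear_image[symmetric]) (auto simp: linear_to_complex intro: injI)

lemma curve_sides_eq:
  assumes "3 \<le> length vs"
  shows "(vs ! (i mod length vs), vs ! (Suc i mod length vs)) \<in> curve_sides vs"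
proof -
  have "i mod length vs < length vs" using assms by (intro mod_less_divisor) linarith
  then show ?thesis unfolding curve_sides_def by (auto intro!: exI[of _ "i mod length vs"] simp: mod_Suc_eq)
qed

lemma curve_eq: "curve vs = (\<Union>e\<in>curve_sides vs. side_closed e)"
  by (simp add: curve_def case_prod_beta)

lemma mod_neq:
  fixes i j n :: nat
  assumes "i < j" "j < i + n"
  shows "i mod n \<noteq> j mod n"
proof
  assume "i mod n = j mod n"
  then have "n dvd j - i" using assms by (metis less_imp_le mod_eq_dvd_iff_nat)
  then show False using assms by (auto dest: dvd_imp_le)
qed

lemma simple_polygonD:
  assumes "simple_polygon vs"
  shows "3 \<le> length vs" "distinct vs"
    and "e \<in> curve_sides vs \<Longrightarrow> f \<in> curve_sides vs \<Longrightarrow> e \<noteq> f \<Longrightarrow>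
      side_closed e \<inter> side_closed f = {fst e, snd e} \<inter> {fst f, snd f}"
proof -
  show "3 \<le> length vs" "distinct vs" using assms by (simp_all add: simple_polygon_def)
  have A: "\<forall>e\<in>curve_sides vs. \<forall>f\<in>curve_sides vs. e \<noteq> f \<longrightarrow>
      side_closed e \<inter> side_closed f = {fst e, snd e} \<inter> {fst f, snd f}"
    using assms unfolding simple_polygon_def case_prod_beta prod.collapse by blast
  show "e \<in> curve_sides vs \<Longrightarrow> f \<in> curve_sides vs \<Longrightarrow> e \<noteq> f \<Longrightarrow>
      side_closed e \<inter> side_closed f = {fst e, snd e} \<inter> {fst f, snd f}"
    by (rule A[rule_format])
qed

definition corner :: "point list \<Rightarrow> nat \<Rightarrow> complex" where
  "corner vs i = to_complex (vs ! (i mod length vs))"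

lemma polygon_cyclic:
  assumes sp: "simple_polygon vs"
  shows "cyclic_polygon (corner vs) (length vs)"
proof
  let ?n = "length vs"
  let ?w = "\<lambda>i. vs ! (i mod ?n)"
  note n3 = simple_polygonD(1)[OF sp]
  have w_neq: "?w i \<noteq> ?w j" if "i < j" "j < i + ?n" for i j
  proof -
    have "0 < ?n" using n3 by linarith
    then have "i mod ?n < ?n" "j mod ?n < ?n" by (simp_all only: mod_less_divisor)
    then show ?thesis using mod_neq[OF that] simple_polygonD(2)[OF sp] by (simp add: nth_eq_iff_index_eq)
  qed
  have seg: "closed_segment (corner vs i) (corner vs j) = to_complex ` closed_segment (?w i) (?w j)" for i j
    unfolding corner_def by (rule closed_segment_linear_image[OF linear_to_complex])
  have meet: "closed_segment (?w i) (?w (Suc i)) \<inter> closed_segment (?w j) (?w (Suc j)) =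
      {?w i, ?w (Suc i)} \<inter> {?w j, ?w (Suc j)}" if "i < j" "j < i + ?n" for i j
    using simple_polygonD(3)[OF sp curve_sides_eq[OF n3, of i] curve_sides_eq[OF n3, of j]] w_neq[OF that] by simp
  have inj: "to_complex ` A \<inter> to_complex ` B = to_complex ` (A \<inter> B)" for A B
    by (rule image_Int[symmetric]) (auto intro: injI)
  show "3 \<le> ?n" by (rule n3)
  show "corner vs (i + ?n) = corner vs i" for i by (simp add: corner_def)
  show "corner vs i \<noteq> corner vs (Suc i)" for i
    using w_neq[of i "Suc i"] n3 by (simp add: corner_def)
  show "closed_segment (corner vs i) (corner vs (Suc i)) \<inter> closed_segment (corner vs (Suc i)) (corner vs (Suc (Suc i))) = {corner vs (Suc i)}" for i
  proof -
    have "closed_segment (?w i) (?w (Suc i)) \<inter> closed_segment (?w (Suc i)) (?w (Suc (Suc i))) = {?w (Suc i)}"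
      using meet[of i "Suc i"] w_neq[of i "Suc i"] w_neq[of "Suc i" "Suc (Suc i)"] w_neq[of i "Suc (Suc i)"] n3 by auto
    then show ?thesis unfolding seg inj by (simp add: corner_def)
  qed
  show "closed_segment (corner vs i) (corner vs (Suc i)) \<inter> closed_segment (corner vs j) (corner vs (Suc j)) = {}"
    if ij: "Suc i < j" "Suc j < i + ?n" for i j
  proof -
    have "closed_segment (?w i) (?w (Suc i)) \<inter> closed_segment (?w j) (?w (Suc j)) = {}"
      using meet[of i j] w_neq[of i j] w_neq[of i "Suc j"] w_neq[of "Suc i" j] w_neq[of "Suc i" "Suc j"] ij by auto
    then show ?thesis unfolding seg inj by simp
  qed
qed

lemma polyline_curve:
  assumes sp: "simple_polygon vs"
  shows "cyclic_polygon.polyline (corner vs) (length vs) = to_complex ` curve vs"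
proof -
  interpret cyclic_polygon "corner vs" "length vs" by (rule polygon_cyclic[OF sp])
  have "curve vs = (\<Union>i<length vs. closed_segment (vs ! i) (vs ! (Suc i mod length vs)))"
    unfolding curve_def curve_sides_def by auto
  then show ?thesis
    by (simp add: polyline_def image_UN corner_def closed_segment_linear_image[OF linear_to_complex])
qed

lemma compact_curve: "compact (curve vs)"
proof -
  have "finite (curve_sides vs)" unfolding curve_sides_def by simp
  then show ?thesis unfolding curve_def by (intro compact_UN) auto
qed

text \<open>By the Jordan curve theorem the curve is the frontier of both components of its
  complement. This keeps boundary points out of the interior of the region.\<close>

lemma curve_frontier:
  assumes sp: "simple_polygon vs"
  shows "curve vs \<subseteq> closure (inside (curve vs))" "curve vs \<subseteq> closure (outside (curve vs))"
proof -
  interpret cyclic_polygon "corner vs" "length vs" by (rule polygon_cyclic[OF sp])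
  have closed: "pathfinish loop = pathstart loop" by (simp add: loop_closed)
  note J = Jordan_inside_outside[OF simple_loop closed, unfolded loop_image polyline_curve[OF sp]]
  have "to_complex ` curve vs \<subseteq> closure (inside (to_complex ` curve vs))"
    "to_complex ` curve vs \<subseteq> closure (outside (to_complex ` curve vs))"
    using J by (auto simp: frontier_def)
  then show "curve vs \<subseteq> closure (inside (curve vs))" "curve vs \<subseteq> closure (outside (curve vs))"
    unfolding inside_to_complex_image outside_to_complex_image closure_to_complex by auto
qed

lemma curve_angle_sum:
  assumes sp: "simple_polygon vs"
  defines "K \<equiv> \<lambda>A c. {u \<in> cball 0 1. \<forall>\<^sub>F r in at_right 0. c + r *\<^sub>R u \<in> A (curve vs)}"
  shows "(\<Sum>c\<in>set vs. measure lebesgue (K inside c)) = (real (length vs) - 2) * pi / 2"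
    and "(\<Sum>c\<in>set vs. measure lebesgue (K outside c)) = (real (length vs) + 2) * pi / 2"
proof -
  interpret cyclic_polygon "corner vs" "length vs" by (rule polygon_cyclic[OF sp])
  have pt: "corner vs k + of_real r * to_complex u = to_complex (vs ! k + r *\<^sub>R u)" if "k < length vs" for k r u
    using that by (simp add: corner_def to_complex_add to_complex_scaleR)
  have in_eq: "inward k = K inside (vs ! k)" "outward k = K outside (vs ! k)" if "k < length vs" for k
    unfolding inward_def outward_def K_def polyline_curve[OF sp] pt[OF that] inside_to_complex outside_to_complex
    by simp_all
  have reindex: "(\<Sum>c\<in>set vs. f c) = (\<Sum>k<length vs. f (vs ! k))" for f :: "point \<Rightarrow> real"
    using sum.reindex_bij_betw[OF bij_betw_nth[OF simple_polygonD(2)[OF sp] refl refl], of f] by simp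
  show "(\<Sum>c\<in>set vs. measure lebesgue (K inside c)) = (real (length vs) - 2) * pi / 2"
    unfolding reindex using angle_sum(3) by (simp add: in_eq)
  have "(\<Sum>c\<in>set vs. measure lebesgue (K outside c)) = (\<Sum>k<length vs. pi - measure lebesgue (inward k))"
    unfolding reindex using angle_sum(2) by (intro sum.cong) (simp_all flip: in_eq)
  also have "\<dots> = (real (length vs) + 2) * pi / 2"
    unfolding sum_subtractf angle_sum(3) by (simp add: field_simps)
  finally show "(\<Sum>c\<in>set vs. measure lebesgue (K outside c)) = (real (length vs) + 2) * pi / 2" .
qed

lemma closed_filled: "closed (filled vs)"
proof -
  have "filled vs = - outside (curve vs)"
    using inside_Un_outside[of "curve vs"] inside_Int_outside[of "curve vs"] outside_no_overlap[of "curve vs"]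
    unfolding filled_def by blast
  then show ?thesis by (simp add: closed_Compl open_outside compact_imp_closed[OF compact_curve])
qed

lemma outside_not_filled: "x \<in> outside (curve vs) \<longleftrightarrow> x \<notin> filled vs"
  using inside_Un_outside[of "curve vs"] inside_Int_outside[of "curve vs"] outside_no_overlap[of "curve vs"]
  unfolding filled_def by blast

lemma open_inside_curve: "open (inside (curve vs))"
  by (intro open_inside compact_imp_closed compact_curve)

lemma curve_not_inside: "x \<in> curve vs \<Longrightarrow> x \<notin> inside (curve vs)"
  using inside_no_overlap by blast

section \<open>The region of a polygon with obstacles as a billiard table\<close>

context
  fixes P :: polygon
  assumes P: "is_polygon P"
begin

lemma outline_simple: "simple_polygon (outline P)"
  and obstacle_simple: "vs \<in> obstacles P \<Longrightarrow> simple_polygon vs"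
  and finite_obstacles: "finite (obstacles P)"
  and obstacle_inside: "vs \<in> obstacles P \<Longrightarrow> filled vs \<subseteq> inside (curve (outline P))"
  and obstacles_disjoint: "vs \<in> obstacles P \<Longrightarrow> ws \<in> obstacles P \<Longrightarrow> vs \<noteq> ws \<Longrightarrow> filled vs \<inter> filled ws = {}"
  using P unfolding is_polygon_def pairwise_def disjnt_def by auto

lemma curve_simple: "vs \<in> insert (outline P) (obstacles P) \<Longrightarrow> simple_polygon vs"
  using outline_simple obstacle_simple by auto

lemma curves_disjoint:
  assumes "vs \<in> insert (outline P) (obstacles P)" "ws \<in> insert (outline P) (obstacles P)" "vs \<noteq> ws"
  shows "curve vs \<inter> curve ws = {}"
proof -
  have c: "curve us \<subseteq> filled us" for us by (simp add: filled_def)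
  show ?thesis
  proof (cases "vs = outline P \<or> ws = outline P")
    case True
    then show ?thesis
      using assms obstacle_inside c inside_no_overlap[of "curve (outline P)"] by blast
  next
    case False
    then show ?thesis using assms obstacles_disjoint[of vs ws] c by blast
  qed
qed

definition table :: "point set" where
  "table = inside (curve (outline P)) - (\<Union>vs\<in>obstacles P. filled vs)"

lemma open_table: "open table"
  unfolding table_def using finite_obstacles
  by (intro open_Diff open_inside_curve closed_UN) (auto intro: closed_filled)

lemma closed_region: "closed (polygon_region P)"
proof -
  have "polygon_region P = filled (outline P) \<inter> (\<Inter>vs\<in>obstacles P. - inside (curve vs))"
    by (auto simp: polygon_region_def)
  then show ?thesis by (auto intro!: closed_Int closed_INT closed_filled closed_Compl open_inside_curve)
qed

lemma region_eq: "polygon_region P = table \<union> (\<Union>vs\<in>insert (outline P) (obstacles P). curve vs)"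
proof (intro set_eqI iffI)
  fix x assume "x \<in> polygon_region P"
  then show "x \<in> table \<union> (\<Union>vs\<in>insert (outline P) (obstacles P). curve vs)"
    by (auto simp: polygon_region_def table_def filled_def)
next
  fix x assume x: "x \<in> table \<union> (\<Union>vs\<in>insert (outline P) (obstacles P). curve vs)"
  then consider "x \<in> table" | "x \<in> curve (outline P)" | vs where "vs \<in> obstacles P" "x \<in> curve vs" by auto
  then show "x \<in> polygon_region P"
  proof cases
    case 1 then show ?thesis by (auto simp: polygon_region_def table_def filled_def)
  next
    case 2
    then have "x \<notin> filled vs" if "vs \<in> obstacles P" for vs
      using obstacle_inside[OF that] curve_not_inside by blast
    then show ?thesis using 2 by (auto simp: polygon_region_def filled_def)
  next
    case (3 vs)
    have fx: "x \<in> filled vs" using 3 by (simp add: filled_def)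
    have "x \<notin> inside (curve ws)" if "ws \<in> obstacles P" for ws
    proof (cases "ws = vs")
      case True then show ?thesis using 3 curve_not_inside by blast
    next
      case False
      then show ?thesis using obstacles_disjoint[OF 3(1) that] fx by (auto simp: filled_def)
    qed
    then show ?thesis using fx obstacle_inside[OF 3(1)] by (auto simp: polygon_region_def filled_def)
  qed
qed

text \<open>Arbitrarily close to the outline there are points outside it, and arbitrarily close to
  the curve of an obstacle there are points inside that obstacle; neither belong to the region. The
  flow is defined by the interior, the locale by an open set, and this identifies the two.\<close>

lemma interior_region: "interior (polygon_region P) = table"
proof
  show "table \<subseteq> interior (polygon_region P)"
    using region_eq open_table by (intro interior_maximal) auto
  show "interior (polygon_region P) \<subseteq> table"
  proof
    fix x assume x: "x \<in> interior (polygon_region P)"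
    then have xr: "x \<in> polygon_region P" using interior_subset by blast
    have "x \<notin> curve (outline P)"
    proof
      assume "x \<in> curve (outline P)"
      then have "x \<in> closure (outside (curve (outline P)))" using curve_frontier(2)[OF outline_simple] by blast
      then have "interior (polygon_region P) \<inter> closure (outside (curve (outline P))) \<noteq> {}" using x by blast
      then have "interior (polygon_region P) \<inter> outside (curve (outline P)) \<noteq> {}"
        by (simp add: open_Int_closure_eq_empty)
      then obtain y where "y \<in> polygon_region P" "y \<in> outside (curve (outline P))"
        using interior_subset by blast
      then show False by (auto simp: polygon_region_def outside_not_filled)
    qed
    moreover have "x \<notin> curve vs" if vs: "vs \<in> obstacles P" for vs
    proof
      assume "x \<in> curve vs"
      then have "x \<in> closure (inside (curve vs))" using curve_frontier(1)[OF obstacle_simple[OF vs]] by blast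
      then have "interior (polygon_region P) \<inter> closure (inside (curve vs)) \<noteq> {}" using x by blast
      then have "interior (polygon_region P) \<inter> inside (curve vs) \<noteq> {}"
        by (simp add: open_Int_closure_eq_empty)
      then obtain y where "y \<in> polygon_region P" "y \<in> inside (curve vs)"
        using interior_subset by blast
      then show False using vs by (auto simp: polygon_region_def)
    qed
    ultimately show "x \<in> table" using xr region_eq by auto
  qed
qed

lemma sides_alt: "sides P = (\<Union>vs\<in>insert (outline P) (obstacles P). curve_sides vs)"
  by (auto simp: sides_def)

lemma side_curve: "e \<in> curve_sides vs \<Longrightarrow> side_closed e \<subseteq> curve vs"
  unfolding curve_def by (cases e) auto

lemma curve_table_disjoint:
  assumes "vs \<in> insert (outline P) (obstacles P)" shows "curve vs \<inter> table = {}"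
  using assms curve_not_inside by (auto simp: table_def filled_def)

lemma billiard: "billiard_table (sides P) table"
proof
  show "finite (sides P)"
    unfolding sides_alt using finite_obstacles by (auto simp: curve_sides_def)
  show "open table" by (rule open_table)
  show "bounded table"
    unfolding table_def
    by (rule bounded_subset[OF bounded_inside[OF compact_imp_bounded[OF compact_curve]]]) auto
  show "side_closed e \<inter> table = {}" if "e \<in> sides P" for e
    using that curve_table_disjoint side_curve unfolding sides_alt by blast
  show "closure table \<subseteq> table \<union> (\<Union>e\<in>sides P. side_closed e)"
  proof -
    have "closure table \<subseteq> polygon_region P" using closed_region region_eq by (intro closure_minimal) auto
    also have "\<dots> \<subseteq> table \<union> (\<Union>e\<in>sides P. side_closed e)"
      unfolding region_eq sides_alt curve_eq by blast
    finally show ?thesis .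
  qed
  show "fst e \<noteq> snd e" if e: "e \<in> sides P" for e
  proof -
    obtain vs where vs: "vs \<in> insert (outline P) (obstacles P)" "e \<in> curve_sides vs" using e unfolding sides_alt by blast
    note sp = curve_simple[OF vs(1)]
    obtain i where i: "i < length vs" "e = (vs ! i, vs ! (Suc i mod length vs))"
      using vs(2) by (auto simp: curve_sides_def)
    have "i mod length vs \<noteq> Suc i mod length vs" using simple_polygonD(1)[OF sp] by (intro mod_neq) auto
    moreover have "Suc i mod length vs < length vs" using simple_polygonD(1)[OF sp] by (intro mod_less_divisor) linarith
    ultimately show ?thesis using i simple_polygonD(2)[OF sp] by (simp add: nth_eq_iff_index_eq)
  qed
  show "side_closed e \<inter> side_closed f \<subseteq> {fst e, snd e} \<inter> {fst f, snd f}"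
    if ef: "e \<in> sides P" "f \<in> sides P" "e \<noteq> f" for e f
  proof -
    obtain vs ws where vs: "vs \<in> insert (outline P) (obstacles P)" "e \<in> curve_sides vs"
      and ws: "ws \<in> insert (outline P) (obstacles P)" "f \<in> curve_sides ws" using ef unfolding sides_alt by blast
    show ?thesis
    proof (cases "vs = ws")
      case True
      then show ?thesis using simple_polygonD(3)[OF curve_simple[OF vs(1)] vs(2) _ ef(3)] ws by blast
    next
      case False
      then have "side_closed e \<inter> side_closed f = {}"
        using curves_disjoint[OF vs(1) ws(1)] side_curve[OF vs(2)] side_curve[OF ws(2)] by blast
      then show ?thesis by simp
    qed
  qed
qed

interpretation billiard_table "sides P" table by (rule billiard)

lemma vertices: "fst ` curve_sides vs \<union> snd ` curve_sides vs = set vs"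
proof
  show "fst ` curve_sides vs \<union> snd ` curve_sides vs \<subseteq> set vs"
    by (auto simp: curve_sides_def intro!: nth_mem mod_less_divisor)
  show "set vs \<subseteq> fst ` curve_sides vs \<union> snd ` curve_sides vs"
    by (force simp: curve_sides_def set_conv_nth)
qed

lemma corners_eq: "Cor = corners P"
proof -
  have "Cor = (\<Union>vs\<in>insert (outline P) (obstacles P). fst ` curve_sides vs \<union> snd ` curve_sides vs)"
    unfolding Cor_def unfolding sides_alt by auto
  then show ?thesis unfolding vertices by (simp add: corners_def)
qed

lemma singular_directions_eq: "singular_directions P z l = singular z l"
proof (intro set_eqI iffI)
  fix u assume "u \<in> singular_directions P z l"
  then obtain t c w where u: "norm u = 1" "t \<le> l" "c \<in> corners P" "billiard_flow P t (z, u) (c, w)"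
    by (auto simp: singular_directions_def)
  then have "u \<noteq> 0" by auto
  from flow_imp_reach[OF u(4) this refl interior_region]
  show "u \<in> singular z l" using u by (auto simp: singular_def corners_eq)
next
  fix u assume "u \<in> singular z l"
  then obtain t s where u: "norm u = 1" "0 < t" "t \<le> l" "reach s z (z + t *\<^sub>R u)"
    "unfold_map s (z + t *\<^sub>R u) \<in> corners P"
    by (auto simp: singular_def corners_eq)
  from reach_imp_flow[OF u(4,2) refl interior_region]
  show "u \<in> singular_directions P z l" using u by (auto simp: singular_directions_def)
qed

text \<open>Entering the table from \<open>c\<close> depends only on the table near
  \<open>c\<close>. Hence at each corner a single boundary curve decides, and the angle sums for one
  curve apply.\<close>

lemma directions_into_local:
  assumes V: "open V" "c \<in> V" "\<And>x. x \<in> V \<Longrightarrow> x \<in> table \<longleftrightarrow> x \<in> A"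
  shows "directions_into c \<inter> cball 0 1 = {u \<in> cball 0 1. \<forall>\<^sub>F r in at_right 0. c + r *\<^sub>R u \<in> A}"
proof -
  have "u \<in> directions_into c \<longleftrightarrow> (\<forall>\<^sub>F r in at_right 0. c + r *\<^sub>R u \<in> A)" for u
  proof -
    have "((\<lambda>r. c + r *\<^sub>R u) \<longlongrightarrow> c + 0 *\<^sub>R u) (at_right 0)" by (intro tendsto_intros)
    then have ev: "\<forall>\<^sub>F r in at_right 0. c + r *\<^sub>R u \<in> V" using V by (intro topological_tendstoD) auto
    have "u \<in> directions_into c \<longleftrightarrow> (\<forall>\<^sub>F r in at_right 0. c + r *\<^sub>R u \<in> table)"
      unfolding directions_into_def eventually_at_right_field by auto
    also have "\<dots> \<longleftrightarrow> (\<forall>\<^sub>F r in at_right 0. c + r *\<^sub>R u \<in> A)"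
      by (rule eventually_cong[OF ev V(3)])
    finally show ?thesis .
  qed
  then show ?thesis by auto
qed

lemma outline_directions:
  assumes "c \<in> set (outline P)"
  shows "directions_into c \<inter> cball 0 1 =
    {u \<in> cball 0 1. \<forall>\<^sub>F r in at_right 0. c + r *\<^sub>R u \<in> inside (curve (outline P))}"
proof (rule directions_into_local)
  show "open (- (\<Union>vs\<in>obstacles P. filled vs))"
    using finite_obstacles by (intro open_Compl closed_UN) (auto intro: closed_filled)
  have "c \<in> curve (outline P)"
    using assms vertices[of "outline P"] side_curve[of _ "outline P"] by fastforce
  then show "c \<in> - (\<Union>vs\<in>obstacles P. filled vs)" using obstacle_inside curve_not_inside by blast
qed (auto simp: table_def)

text \<open>The other obstacles and the outline stay away from \<open>c\<close>, so the table looks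
  there like the exterior of \<open>vs\<close>. This is why obstacles contribute complementary
  angles.\<close>

lemma obstacle_directions:
  assumes vs: "vs \<in> obstacles P" and c: "c \<in> set vs"
  shows "directions_into c \<inter> cball 0 1 =
    {u \<in> cball 0 1. \<forall>\<^sub>F r in at_right 0. c + r *\<^sub>R u \<in> outside (curve vs)}"
proof (rule directions_into_local)
  let ?V = "inside (curve (outline P)) - (\<Union>ws\<in>obstacles P - {vs}. filled ws)"
  show "open ?V"
    using finite_obstacles by (intro open_Diff open_inside_curve closed_UN) (auto intro: closed_filled)
  have "c \<in> curve vs" using c vertices[of vs] side_curve[of _ vs] by fastforce
  then have "c \<in> filled vs" by (simp add: filled_def)
  then show "c \<in> ?V" using obstacle_inside[OF vs] obstacles_disjoint[OF vs] by blast
  show "x \<in> table \<longleftrightarrow> x \<in> outside (curve vs)" if "x \<in> ?V" for x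
    using that vs unfolding outside_not_filled table_def by blast
qed

text \<open>The boundary curves are pairwise disjoint, so every corner belongs to exactly one of
  them.\<close>

lemma sum_corners:
  fixes f :: "point \<Rightarrow> 'b::comm_monoid_add"
  shows "(\<Sum>c\<in>corners P. f c) = (\<Sum>c\<in>set (outline P). f c) + (\<Sum>vs\<in>obstacles P. \<Sum>c\<in>set vs. f c)"
proof -
  have sub: "set vs \<subseteq> curve vs" for vs
    using vertices[of vs] side_curve[of _ vs] by fastforce
  have "set (outline P) \<inter> (\<Union>vs\<in>obstacles P. set vs) = {}"
  proof -
    have "outline P \<noteq> vs" if "vs \<in> obstacles P" for vs
    proof
      assume eq: "outline P = vs"
      have "0 < length vs" using simple_polygonD(1)[OF outline_simple] unfolding eq by linarith
      then have "vs ! 0 \<in> curve vs" using sub by (metis nth_mem subsetD)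
      then show False using obstacle_inside[OF that] curve_not_inside eq by (auto simp: filled_def)
    qed
    then show ?thesis using curves_disjoint[of "outline P"] sub by blast
  qed
  moreover have "(\<Sum>c\<in>(\<Union>vs\<in>obstacles P. set vs). f c) = (\<Sum>vs\<in>obstacles P. \<Sum>c\<in>set vs. f c)"
    using curves_disjoint sub by (intro sum.UNION_disjoint finite_obstacles) (simp, blast)
  ultimately show ?thesis
    unfolding corners_def using finite_obstacles by (subst sum.union_disjoint) auto
qed

text \<open>Half the angle sum: (n - 2) * pi / 2 for the outline and (n + 2) * pi / 2 for each
  obstacle. The summands 2 add up to 2q - 2, and the lengths to the number of corners.\<close>

lemma total_angle: "(\<Sum>c\<in>corners P. measure lebesgue (directions_into c \<inter> cball 0 1)) = pi * kappa P / 2"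
proof -
  let ?m = "\<lambda>c. measure lebesgue (directions_into c \<inter> cball 0 1)"
  have 1: "(\<Sum>c\<in>set (outline P). ?m c) = (real (length (outline P)) - 2) * pi / 2"
    unfolding curve_angle_sum(1)[OF outline_simple, symmetric]
    by (intro sum.cong refl arg_cong[of _ _ "measure lebesgue"] outline_directions)
  have 2: "(\<Sum>c\<in>set vs. ?m c) = (real (length vs) + 2) * pi / 2" if "vs \<in> obstacles P" for vs
    unfolding curve_angle_sum(2)[OF obstacle_simple[OF that], symmetric]
    by (intro sum.cong refl arg_cong[of _ _ "measure lebesgue"] obstacle_directions that)
  have card: "real (card (corners P)) = real (length (outline P)) + (\<Sum>vs\<in>obstacles P. real (length vs))"
  proof -
    have len: "(\<Sum>c\<in>set vs. 1 :: real) = real (length vs)" if "simple_polygon vs" for vs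
      using distinct_card[OF simple_polygonD(2)[OF that]] by simp
    have "real (card (corners P)) = (\<Sum>c\<in>corners P. 1)" by simp
    also have "\<dots> = real (length (outline P)) + (\<Sum>vs\<in>obstacles P. real (length vs))"
      unfolding sum_corners using len[OF outline_simple] len[OF obstacle_simple] by simp
    finally show ?thesis .
  qed
  have "(\<Sum>c\<in>corners P. ?m c) = (real (length (outline P)) - 2) * pi / 2 + (\<Sum>vs\<in>obstacles P. (real (length vs) + 2) * pi / 2)"
    unfolding sum_corners 1 by (intro arg_cong2[of _ _ _ _ "(+)"] sum.cong refl 2)
  also have "(\<Sum>vs\<in>obstacles P. (real (length vs) + 2) * pi / 2) =
      ((\<Sum>vs\<in>obstacles P. real (length vs)) + 2 * real (card (obstacles P))) * pi / 2"
    by (simp add: sum.distrib flip: sum_distrib_right sum_divide_distrib)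
  finally show ?thesis by (simp add: kappa_def card field_simps)
qed

section \<open>Integration over the region\<close>

lemma region_boundary: "polygon_region P = table \<union> Bd"
  unfolding region_eq curve_eq Bd_def unfolding sides_alt by blast

lemma AE_table: "AE z in lebesgue. z \<in> polygon_region P \<longleftrightarrow> z \<in> table"
proof -
  have "negligible Bd"
    unfolding Bd_def
  proof (rule negligible_Union)
    show "finite (side_closed ` sides P)" using finite_S by simp
    fix T assume "T \<in> side_closed ` sides P"
    then obtain e where T: "T = side_closed e" by blast
    show "negligible T" unfolding T
      by (rule negligible_subset[OF negligible_line[of "fst e" "snd e - fst e"]])
         (auto simp: in_segment algebra_simps)
  qed
  then have "AE z in lebesgue. z \<notin> Bd" by (intro AE_not_in) (simp flip: negligible_iff_null_sets)
  then show ?thesis by eventually_elim (auto simp: region_boundary)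
qed

lemma counting_function_integral:
  assumes l: "0 < l"
  shows "AE z in lebesgue_on (polygon_region P). finite (singular_directions P z l)"
    and "2 * (LINT z|lebesgue_on (polygon_region P). real (gc P z l)) = pi * kappa P * l\<^sup>2"
proof -
  let ?R = "polygon_region P"
  have R: "?R \<inter> space lebesgue \<in> sets lebesgue"
    using closed_region by (simp add: borel_closed)
  have fin: "AE z in lebesgue. z \<in> table \<longrightarrow> finite (singular z l)"
    by (rule AE_completion[OF counting_integral(1)])
  show "AE z in lebesgue_on ?R. finite (singular_directions P z l)"
    unfolding AE_restrict_space_iff[OF R] singular_directions_eq
    using fin AE_table by eventually_elim auto
  \<comment> \<open>A Borel function that agrees with the counting function almost everywhere.
    Measurability of \<open>gc\<close> itself is then inferred from completeness of Lebesgue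
    measure.\<close>
  define h where "h z = enn2real (hit_count l z)" for z
  have hm: "h \<in> borel_measurable lborel"
    unfolding h_def[abs_def] using hit_count_measurable by measurable
  have total: "(\<Sum>c\<in>Cor. emeasure lebesgue (sector c l)) = ennreal (l\<^sup>2 * (pi * kappa P / 2))"
  proof -
    have "(\<Sum>c\<in>Cor. emeasure lebesgue (sector c l)) =
        (\<Sum>c\<in>Cor. ennreal (l\<^sup>2 * measure lebesgue (directions_into c \<inter> cball 0 1)))"
      by (intro sum.cong refl emeasure_sector_eq corner_not_Om l)
    also have "\<dots> = ennreal (\<Sum>c\<in>Cor. l\<^sup>2 * measure lebesgue (directions_into c \<inter> cball 0 1))"
      by (intro sum_ennreal) simp
    also have "\<dots> = ennreal (l\<^sup>2 * (pi * kappa P / 2))"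
      unfolding sum_distrib_left[symmetric] corners_eq total_angle ..
    finally show ?thesis .
  qed
  have finite_count: "AE z in lborel. hit_count l z \<noteq> \<infinity>"
    by (rule nn_integral_noteq_infinite[OF hit_count_measurable]) (simp add: integral_hit_count total)
  have eq: "AE z in lebesgue. h z = indicator ?R z *\<^sub>R real (gc P z l)"
    using AE_completion[OF finite_count] AE_table
  proof eventually_elim
    case (elim z)
    show ?case
    proof (cases "z \<in> table")
      case True
      have "hit_count l z = of_nat (card (singular z l))" using hit_count_eq_card(2)[OF True elim(1)] .
      then show ?thesis using elim True
        by (simp add: h_def gc_def singular_directions_eq ennreal_of_nat_eq_real_of_nat)
    next
      case False
      then show ?thesis using elim hit_count_outside[OF False] by (simp add: h_def)
    qed
  qed
  have hl: "h \<in> borel_measurable lebesgue" using hm by (rule measurable_completion)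
  have "(LINT z|lebesgue_on ?R. real (gc P z l)) = (LINT z|lebesgue. indicator ?R z *\<^sub>R real (gc P z l))"
    by (rule integral_restrict_space[OF R])
  also have "\<dots> = (LINT z|lebesgue. h z)"
    by (rule integral_cong_AE[symmetric, OF hl borel_measurable_AE[OF hl eq] eq])
  also have "\<dots> = (LINT z|lborel. h z)" by (rule integral_completion[OF hm])
  also have "\<dots> = enn2real (\<integral>\<^sup>+z. ennreal (h z) \<partial>lborel)"
    by (rule integral_eq_nn_integral[OF hm]) (simp add: h_def)
  also have "(\<integral>\<^sup>+z. ennreal (h z) \<partial>lborel) = (\<integral>\<^sup>+z. hit_count l z \<partial>lborel)"
    by (rule nn_integral_cong_AE) (use finite_count in eventually_elim, simp add: h_def less_top)
  also have "\<dots> = ennreal (l\<^sup>2 * (pi * kappa P / 2))" unfolding integral_hit_count total ..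
  also have "enn2real \<dots> = l\<^sup>2 * (pi * kappa P / 2)"
  proof -
    \<comment> \<open>\<open>enn2real\<close> inverts \<open>ennreal\<close> only on nonnegative
      reals. The sign of \<open>kappa P\<close> comes from its meaning as a sum of areas.\<close>
    have "0 \<le> pi * kappa P / 2" unfolding total_angle[symmetric] by (intro sum_nonneg) simp
    then show ?thesis by (intro enn2real_ennreal mult_nonneg_nonneg) auto
  qed
  finally show "2 * (LINT z|lebesgue_on ?R. real (gc P z l)) = pi * kappa P * l\<^sup>2"
    by (simp add: field_simps)
qed

end

theorem corollary2:
  fixes P :: polygon and l :: real
  assumes "is_polygon P" and "l > 0"
  shows "(AE z in lebesgue_on (polygon_region P). finite (singular_directions P z l)) \<and>
    2 * (LINT z|lebesgue_on (polygon_region P). real (gc P z l)) = pi * real_of_int (kappa P) * l\<^sup>2"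
  using counting_function_integral[OF assms] by blast

end
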